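(* Let $n\ge 1$, $0<s<1$, $1<p<\infty$, and let $\beta\in\mathbb{R}$ satisfy $\beta>-s$ and $\delta:=p(s+\beta)<n$. Let $\{\psi_{k,\lambda}\}_{k\in\mathbb{N},\lambda\in\Lambda_k}$ be a wavelet basis on $\mathbb{T}^n$ as described in the context, and consider the random series $$f=\sum_{k\in\mathbb{N}}\sum_{\lambda\in\Lambda_k}c_{k,\lambda}\psi_{k,\lambda},\qquad c_{k,\lambda}=W_{k,\lambda}\bigl(2^{-ks}(1-B_{k,\lambda})+2^{k\beta}B_{k,\lambda}\bigr),$$ where the $W_{k,\lambda}$ are independent identically distributed real random variables with mean zero, variance $1$ and finite moments, the $B_{k,\lambda}$ are independent Bernoulli random variables taking the value $1$ with probability $2^{-\delta k}$ and the value $0$ with probability $1-2^{-\delta k}$, and the families $\{W_{k,\lambda}\}$ and $\{B_{k,\lambda}\}$ are independent of each other. Let $\mathbb{P}$ be the law of $f$, regarded as a probability measure on $L^1(\mathbb{T}^n)$. Then the following holds for $\mathbb{P}$-a.e. $f$: (i) $f\in W^{\alpha,p}(\mathbb{T}^n)$ for every $\alpha\in(0,s)$; (ii) $f\notin W^{\alpha,p}(\mathbb{T}^n)$ for any $\alpha\in(s,1)$; (iii) for every $q\in(p,\infty)$ there is $\alpha\in(0,s)$ such that $f\notin W^{\sigma,q}(\mathbb{T}^n)$ for all $\sigma\in(\alpha,s)$.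
   Context: $\mathbb{T}^n=\mathbb{R}^n/\mathbb{Z}^n$ is the periodic torus with distance $d$ induced by the Euclidean one, and $\mathbb{N}=\{0,1,2,\dots\}$. For $0<\alpha<1$ and $1\le q<\infty$, $W^{\alpha,q}(\mathbb{T}^n)$ is the space of $f\in L^q(\mathbb{T}^n)$ with $\int_{\mathbb{T}^n}\int_{\mathbb{T}^n}\frac{|f(x)-f(y)|^q}{d(x,y)^{\alpha q+n}}\,dx\,dy<\infty$. Wavelet basis: $\{\psi_{k,\lambda}\}$ is an orthogonal, $L^\infty$-normalized basis of the space of mean-zero elements of $L^2(\mathbb{T}^n)$, where $k\in\mathbb{N}$ is the scale and $\Lambda_k$ indexes the wavelets of scale $k$. It is constructed as the standard periodization of a basis of compactly supported wavelets on $\mathbb{R}^n$ whose mother wavelets are $C^1$. That is, there is a finite family of compactly supported $C^1$ functions $\Psi^e:\mathbb{R}^n\to\mathbb{R}$ (the mother wavelets; $2^n-1$ of them) such that $\{2^{kn/2}\Psi^e(2^kx-m)\}_{e,\,k\in\mathbb{Z},\,m\in\mathbb{Z}^n}$ is an orthonormal basis of $L^2(\mathbb{R}^n)$; $\Lambda_k$ is the set of pairs $\lambda=(e,m)$ with $m\in\{0,\dots,2^k-1\}^n$; and $\psi_{k,\lambda}(x)=\sum_{\ell\in\mathbb{Z}^n}\Psi^e(2^k(x-\ell)-m)$. For every choice of the parameters as in the claim the series belongs to $L^1(\mathbb{T}^n)$ almost surely, so that $\mathbb{P}$ is well defined. *)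

theory Defs
  imports "HOL-Probability.Probability"
begin

section \<open>The torus\<close>

text \<open>The torus \<open>\<real>\<^sup>n / \<int>\<^sup>n\<close>, \<open>n = CARD('n)\<close>, is represented by the fundamental domain
  \<open>[0,1)\<^sup>n\<close> with Lebesgue measure and with the quotient distance.\<close>

definition torus :: "(real ^ 'n::finite) measure" where
  "torus = restrict_space lborel {x. \<forall>i. 0 \<le> x $ i \<and> x $ i < 1}"

definition of_int_vec :: "int ^ 'n \<Rightarrow> real ^ 'n::finite" where
  "of_int_vec m = (\<chi> i. real_of_int (m $ i))"

definition torus_dist :: "real ^ 'n::finite \<Rightarrow> real ^ 'n \<Rightarrow> real" where
  "torus_dist x y = (INF l\<in>UNIV. norm (x - y - of_int_vec l))"


section \<open>The normed space \<open>L\<^sup>1\<close> of the torus\<close>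

definition L1_rel :: "(real ^ 'n::finite \<Rightarrow> real) \<Rightarrow> (real ^ 'n \<Rightarrow> real) \<Rightarrow> bool" where
  "L1_rel f g \<longleftrightarrow> integrable torus f \<and> integrable torus g \<and> (AE x in torus. f x = g x)"

quotient_type (overloaded) 'n L1_torus = "real ^ ('n::finite) \<Rightarrow> real" / partial: L1_rel
proof (rule part_equivpI)
  show "\<exists>f. L1_rel f f"
    by (rule exI[of _ "\<lambda>_. 0"]) (simp add: L1_rel_def)
  show "symp L1_rel"
    by (rule sympI) (simp add: L1_rel_def eq_commute)
  show "transp (L1_rel :: (real ^ 'n \<Rightarrow> real) \<Rightarrow> _)"
  proof (rule transpI)
    fix f g h :: "real ^ 'n \<Rightarrow> real"
    assume fg: "L1_rel f g" and gh: "L1_rel g h"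
    have "AE x in torus. f x = g x" "AE x in torus. g x = h x"
      using fg gh by (auto simp: L1_rel_def)
    then have "AE x in torus. f x = h x" by eventually_elim simp
    then show "L1_rel f h" using fg gh by (simp add: L1_rel_def)
  qed
qed

instantiation L1_torus :: (finite) real_normed_vector
begin

lift_definition zero_L1_torus :: "'a L1_torus" is "\<lambda>_. 0"
  by (simp add: L1_rel_def)

lift_definition plus_L1_torus :: "'a L1_torus \<Rightarrow> 'a L1_torus \<Rightarrow> 'a L1_torus"
  is "\<lambda>f g x. f x + g x"
  by (auto simp: L1_rel_def)

lift_definition minus_L1_torus :: "'a L1_torus \<Rightarrow> 'a L1_torus \<Rightarrow> 'a L1_torus"
  is "\<lambda>f g x. f x - g x"
  by (auto simp: L1_rel_def)

lift_definition uminus_L1_torus :: "'a L1_torus \<Rightarrow> 'a L1_torus" is "\<lambda>f x. - f x"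
  by (auto simp: L1_rel_def)

lift_definition scaleR_L1_torus :: "real \<Rightarrow> 'a L1_torus \<Rightarrow> 'a L1_torus" is "\<lambda>c f x. c * f x"
  by (auto simp: L1_rel_def)

lift_definition norm_L1_torus :: "'a L1_torus \<Rightarrow> real" is "\<lambda>f. LINT x|torus. \<bar>f x\<bar>"
  by (rule integral_cong_AE) (auto simp: L1_rel_def)

definition "dist (f :: 'a L1_torus) g = norm (f - g)"

definition "sgn (f :: 'a L1_torus) = inverse (norm f) *\<^sub>R f"

definition "(uniformity :: ('a L1_torus \<times> 'a L1_torus) filter) =
  (INF e\<in>{0<..}. principal {(f, g). dist f g < e})"

definition "open (U :: 'a L1_torus set) \<longleftrightarrow>
  (\<forall>f\<in>U. eventually (\<lambda>(f', g). f' = f \<longrightarrow> g \<in> U) uniformity)"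

instance
proof
  fix f g h :: "'a L1_torus" and a b :: real
  show "f + g + h = f + (g + h)" by transfer (auto simp: L1_rel_def add.assoc)
  show "f + g = g + f" by transfer (auto simp: L1_rel_def add.commute)
  show "0 + f = f" by transfer (auto simp: L1_rel_def)
  show "- f + f = 0" by transfer (auto simp: L1_rel_def)
  show "f - g = f + - g" by transfer (auto simp: L1_rel_def)
  show "a *\<^sub>R (f + g) = a *\<^sub>R f + a *\<^sub>R g" by transfer (auto simp: L1_rel_def algebra_simps)
  show "(a + b) *\<^sub>R f = a *\<^sub>R f + b *\<^sub>R f" by transfer (auto simp: L1_rel_def algebra_simps)
  show "a *\<^sub>R b *\<^sub>R f = (a * b) *\<^sub>R f" by transfer (auto simp: L1_rel_def algebra_simps)
  show "1 *\<^sub>R f = f" by transfer (auto simp: L1_rel_def)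
  show "dist f g = norm (f - g)" by (rule dist_L1_torus_def)
  show "sgn f = inverse (norm f) *\<^sub>R f" by (rule sgn_L1_torus_def)
  show "(uniformity :: ('a L1_torus \<times> 'a L1_torus) filter) =
      (INF e\<in>{0<..}. principal {(x, y). dist x y < e})"
    by (rule uniformity_L1_torus_def)
  show "open U \<longleftrightarrow> (\<forall>x\<in>U. eventually (\<lambda>(x', y). x' = x \<longrightarrow> y \<in> U) uniformity)"
    for U :: "'a L1_torus set"
    by (rule open_L1_torus_def)
  show "norm f = 0 \<longleftrightarrow> f = 0"
    by transfer (auto simp: L1_rel_def integral_nonneg_eq_0_iff_AE)
  show "norm (f + g) \<le> norm f + norm g"
  proof transfer
    fix f g :: "real ^ 'a \<Rightarrow> real"
    assume "L1_rel f f" "L1_rel g g"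
    then have i: "integrable torus f" "integrable torus g" by (auto simp: L1_rel_def)
    have "(LINT x|torus. \<bar>f x + g x\<bar>) \<le> (LINT x|torus. \<bar>f x\<bar> + \<bar>g x\<bar>)"
      by (rule integral_mono) (use i in auto)
    also have "\<dots> = (LINT x|torus. \<bar>f x\<bar>) + (LINT x|torus. \<bar>g x\<bar>)"
      using i by simp
    finally show "(LINT x|torus. \<bar>f x + g x\<bar>) \<le> (LINT x|torus. \<bar>f x\<bar>) + (LINT x|torus. \<bar>g x\<bar>)" .
  qed
  show "norm (a *\<^sub>R f) = \<bar>a\<bar> * norm f"
    by transfer (simp add: abs_mult)
qed

end

text \<open>The class of an integrable function (and \<open>0\<close> for a non-integrable one).\<close>

lift_definition L1_class :: "(real ^ 'n::finite \<Rightarrow> real) \<Rightarrow> 'n L1_torus"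
  is "\<lambda>f. if integrable torus f then f else (\<lambda>_. 0)"
  by (simp add: L1_rel_def)


section \<open>Fractional Sobolev spaces on the torus\<close>

definition sobolev_integral :: "real \<Rightarrow> real \<Rightarrow> (real ^ 'n::finite \<Rightarrow> real) \<Rightarrow> ennreal" where
  "sobolev_integral \<alpha> q f =
    (\<integral>\<^sup>+ x. \<integral>\<^sup>+ y. ennreal (\<bar>f x - f y\<bar> powr q / torus_dist x y powr (\<alpha> * q + real CARD('n)))
      \<partial>torus \<partial>torus)"

lemma sobolev_integral_cong:
  assumes "AE x in torus. f x = g x"
  shows "sobolev_integral \<alpha> q f = sobolev_integral \<alpha> q g"
  unfolding sobolev_integral_def
proof (rule nn_integral_cong_AE)
  let ?k = "\<lambda>f x y. ennreal (\<bar>f x - f y\<bar> powr q / torus_dist x y powr (\<alpha> * q + real CARD('a)))"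
  show "AE x in torus. (\<integral>\<^sup>+ y. ?k f x y \<partial>torus) = (\<integral>\<^sup>+ y. ?k g x y \<partial>torus)"
    using assms
  proof eventually_elim
    case (elim x)
    have "AE y in torus. ?k f x y = ?k g x y"
      using assms by eventually_elim (simp add: elim)
    then show ?case by (rule nn_integral_cong_AE)
  qed
qed

text \<open>Since \<open>q \<ge> 1\<close> and the torus has finite measure, \<open>L\<^sup>q\<close> and hence \<open>W\<^sup>\<alpha>\<^sup>,\<^sup>q\<close> are
  subspaces of \<open>L\<^sup>1\<close>.\<close>

lift_definition is_sobolev :: "real \<Rightarrow> real \<Rightarrow> 'n::finite L1_torus \<Rightarrow> bool"
  is "\<lambda>\<alpha> q f. integrable torus (\<lambda>x. \<bar>f x\<bar> powr q) \<and> sobolev_integral \<alpha> q f < \<infinity>"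
proof -
  fix \<alpha> q :: real and f g :: "real ^ 'n \<Rightarrow> real"
  assume fg: "L1_rel f g"
  then have [measurable]: "f \<in> borel_measurable torus" "g \<in> borel_measurable torus"
    and ae: "AE x in torus. f x = g x"
    by (auto simp: L1_rel_def)
  have "integrable torus (\<lambda>x. \<bar>f x\<bar> powr q) = integrable torus (\<lambda>x. \<bar>g x\<bar> powr q)"
    by (rule integrable_cong_AE) (use ae in auto)
  with sobolev_integral_cong[OF ae]
  show "(integrable torus (\<lambda>x. \<bar>f x\<bar> powr q) \<and> sobolev_integral \<alpha> q f < \<infinity>) =
    (integrable torus (\<lambda>x. \<bar>g x\<bar> powr q) \<and> sobolev_integral \<alpha> q g < \<infinity>)"
    by simp
qed

definition W_space :: "real \<Rightarrow> real \<Rightarrow> 'n::finite L1_torus set" where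
  "W_space \<alpha> q = {f. is_sobolev \<alpha> q f}"


section \<open>Periodized wavelets\<close>

definition square_integrable :: "(real ^ 'n::finite \<Rightarrow> real) \<Rightarrow> bool" where
  "square_integrable g \<longleftrightarrow> g \<in> borel_measurable lborel \<and> integrable lborel (\<lambda>x. (g x)\<^sup>2)"

text \<open>Orthonormal basis in the Hilbert space sense: an orthonormal family whose finite linear
  combinations are dense in \<open>L\<^sup>2\<close>.\<close>

definition L2_orthonormal_basis :: "'i set \<Rightarrow> ('i \<Rightarrow> real ^ 'n::finite \<Rightarrow> real) \<Rightarrow> bool" where
  "L2_orthonormal_basis I \<phi> \<longleftrightarrow>
    (\<forall>i\<in>I. square_integrable (\<phi> i)) \<and>
    (\<forall>i\<in>I. \<forall>j\<in>I. (LINT x|lborel. \<phi> i x * \<phi> j x) = (if i = j then 1 else 0)) \<and>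
    (\<forall>g. square_integrable g \<longrightarrow>
      (\<forall>\<epsilon>>0. \<exists>J a. finite J \<and> J \<subseteq> I \<and> (LINT x|lborel. (g x - (\<Sum>j\<in>J. a j * \<phi> j x))\<^sup>2) < \<epsilon>))"

definition C1_function :: "(real ^ 'n::finite \<Rightarrow> real) \<Rightarrow> bool" where
  "C1_function g \<longleftrightarrow> (\<exists>D. (\<forall>x. (g has_derivative blinfun_apply (D x)) (at x)) \<and> continuous_on UNIV D)"

text \<open>Mother wavelets \<open>\<Psi> e\<close>, indexed by \<open>e < 2\<^sup>n - 1\<close>.\<close>

definition wavelet_family :: "(nat \<Rightarrow> real ^ 'n::finite \<Rightarrow> real) \<Rightarrow> bool" where
  "wavelet_family \<Psi> \<longleftrightarrow>
    (\<forall>e < 2 ^ CARD('n) - 1. C1_function (\<Psi> e) \<and> compact (closure {x. \<Psi> e x \<noteq> 0})) \<and>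
    L2_orthonormal_basis ({..< 2 ^ CARD('n) - 1} \<times> (UNIV :: int set) \<times> (UNIV :: (int ^ 'n) set))
      (\<lambda>(e, k, m) x. 2 powr (real_of_int k * real CARD('n) / 2) *
        \<Psi> e ((2 powi k) *\<^sub>R x - of_int_vec m))"

definition Lam :: "nat \<Rightarrow> (nat \<times> (int ^ 'n::finite)) set" where
  "Lam k = {..< 2 ^ CARD('n) - 1} \<times> {m. \<forall>i. 0 \<le> m $ i \<and> m $ i < 2 ^ k}"

text \<open>Pointwise, only finitely many terms of the sum are nonzero when \<open>\<Psi> e\<close> has compact support.\<close>

definition periodized_wavelet ::
  "(nat \<Rightarrow> real ^ 'n::finite \<Rightarrow> real) \<Rightarrow> nat \<Rightarrow> nat \<times> (int ^ 'n) \<Rightarrow> real ^ 'n \<Rightarrow> real" where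
  "periodized_wavelet \<Psi> k = (\<lambda>(e, m) x.
    \<Sum>\<^sub>\<infinity>l\<in>UNIV. \<Psi> e ((2 ^ k) *\<^sub>R (x - of_int_vec l) - of_int_vec m))"

end

theory Submission
  imports Defs
begin

text \<open>The membership and non-membership statements are read off the wavelet coefficients. If
  \<open>2\<^bsup>\<gamma>pk\<^esup> 2\<^bsup>-nk\<^esup> \<Sum>\<^sub>\<lambda> \<bar>c\<^sub>k\<^sub>,\<^sub>\<lambda>\<bar>\<^sup>p\<close> is summable in \<open>k\<close> for some \<open>\<gamma> > \<alpha>\<close>, the series lies in
  \<open>W\<^sup>\<alpha>\<^sup>,\<^sup>p\<close>, because the increments of the \<open>k\<close>-th block are at most of order
  \<open>min (1, 2\<^sup>k\<bar>h\<bar>)\<close> times its coefficients, with bounded overlap of the supports. Conversely the mean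
  of a wavelet vanishes, so a coefficient of size \<open>\<theta>\<close> at scale \<open>k\<close> forces oscillation at distance
  \<open>2\<^bsup>-k\<^esup>\<close>: if at all large scales at least \<open>\<eta> 2\<^bsup>(n-d)k\<^esup>\<close> coefficients exceed \<open>a 2\<^bsup>bk\<^esup>\<close>, then
  the function is outside \<open>W\<^sup>\<alpha>\<^sup>,\<^sup>q\<close> whenever \<open>\<alpha>q + bq > d\<close>. For the random series the first
  criterion holds almost surely for every \<open>\<gamma> < s\<close> by computing expectations. By Chebyshev and
  Borel-Cantelli the second holds with \<open>(b, d) = (-s, 0)\<close> (all coefficients) and with
  \<open>(b, d) = (\<beta>, \<delta>)\<close> (those with \<open>B = 1\<close>); these give (ii) and (iii), the latter since
  \<open>p(s + \<beta>) = \<delta>\<close> and \<open>q > p\<close>.\<close>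

section \<open>Sums with few or geometrically decaying terms\<close>

text \<open>The conclusion concerns a law on L^1 and uncountably many exponents, so all exceptional
  sets must be caught by one Borel subset of L^1. Membership is reduced to a sequence of exponents
  increasing to \<open>s\<close>, because the torus has finite diameter and the spaces therefore
  decrease in \<alpha>; each \<open>W_space\<close> is Borel as a countable union of sets that are
  closed by Fatou's lemma. Non-membership is read off two counting conditions on coefficients, each
  of which settles all exponents of its claim. These conditions are Borel because the wavelets are
  bounded, so that coefficients are continuous functionals on L^1; orthogonality on the torus
  recovers \<open>c\<close> from the sum of the series. In the first criterion the gap between
  \<alpha> and \<gamma> pays for the convergence of a radial integral at the origin and for the
  summation over scales. In the second, the vanishing mean allows f(y) to be subtracted for every y
  in the dyadic cube of the wavelet, which turns one coefficient into a lower bound for the inner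
  Sobolev integral at each such y.\<close>

lemma powr_abs_sum_le:
  fixes a :: "'i \<Rightarrow> real"
  assumes fin: "finite J" and card: "card {i \<in> J. a i \<noteq> 0} \<le> K" and p: "0 < p"
  shows "\<bar>\<Sum>i\<in>J. a i\<bar> powr p \<le> real K powr p * (\<Sum>i\<in>J. \<bar>a i\<bar> powr p)"
proof -
  define S where "S = {i \<in> J. a i \<noteq> 0}"
  have finS: "finite S" using fin by (simp add: S_def)
  have sumS: "(\<Sum>i\<in>J. a i) = (\<Sum>i\<in>S. a i)"
    by (rule sum.mono_neutral_right) (use fin in \<open>auto simp: S_def\<close>)
  show ?thesis
  proof (cases "S = {}")
    case True
    then show ?thesis using sumS by (simp add: sum_nonneg)
  next
    case False
    \<comment> \<open>The largest term \<open>m\<close> bounds the sum by \<open>K * m\<close>, and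
      its p-th power is a single term of the right-hand sum. No convexity enters, so every p > 0 is
      covered.\<close>
    define m where "m = Max ((\<lambda>i. \<bar>a i\<bar>) ` S)"
    have "m \<in> (\<lambda>i. \<bar>a i\<bar>) ` S" unfolding m_def using finS False by (intro Max_in) auto
    then obtain i0 where i0: "i0 \<in> S" "m = \<bar>a i0\<bar>" by auto
    have le: "\<bar>a i\<bar> \<le> m" if "i \<in> S" for i
      unfolding m_def using finS that by (intro Max_ge) auto
    have "\<bar>\<Sum>i\<in>J. a i\<bar> \<le> (\<Sum>i\<in>S. \<bar>a i\<bar>)" unfolding sumS by (rule sum_abs)
    also have "\<dots> \<le> real (card S) * m" using sum_bounded_above[of S "\<lambda>i. \<bar>a i\<bar>" m] le by simp
    also have "\<dots> \<le> real K * m"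
      using card i0 by (intro mult_right_mono) (auto simp: S_def)
    finally have "\<bar>\<Sum>i\<in>J. a i\<bar> powr p \<le> (real K * m) powr p"
      using p by (intro powr_mono2) auto
    also have "\<dots> = real K powr p * \<bar>a i0\<bar> powr p"
      using i0 by (simp add: powr_mult)
    also have "\<dots> \<le> real K powr p * (\<Sum>i\<in>J. \<bar>a i\<bar> powr p)"
      using i0 fin by (intro mult_left_mono member_le_sum) (auto simp: S_def)
    finally show ?thesis .
  qed
qed

text \<open>Bounding every term by the supremum of \<open>2\<^bsup>\<epsilon>k\<^esup> \<bar>a k\<bar>\<close> replaces Hoelder's inequality.\<close>

lemma geometric_weight_sum:
  fixes a :: "nat \<Rightarrow> real"
  assumes \<epsilon>: "0 < \<epsilon>" and p: "0 < p"
    and sum: "summable (\<lambda>k. 2 powr (\<epsilon> * p * real k) * \<bar>a k\<bar> powr p)"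
  shows "summable (\<lambda>k. \<bar>a k\<bar>)"
    and "(\<Sum>k. \<bar>a k\<bar>) \<le> (1 / (1 - 2 powr - \<epsilon>)) *
      (\<Sum>k. 2 powr (\<epsilon> * p * real k) * \<bar>a k\<bar> powr p) powr (1 / p)"
proof -
  define S where "S = (\<Sum>k. 2 powr (\<epsilon> * p * real k) * \<bar>a k\<bar> powr p)"
  define r where "r = (2::real) powr - \<epsilon>"
  have r: "0 < r" "r < 1" using \<epsilon> by (auto simp: r_def powr_less_one)
  have bound: "\<bar>a k\<bar> \<le> r ^ k * S powr (1 / p)" for k
  proof -
    have "2 powr (\<epsilon> * p * real k) * \<bar>a k\<bar> powr p \<le> S"
      unfolding S_def using sum_le_suminf[OF sum, of "{k}"] by simp
    moreover have "2 powr (\<epsilon> * p * real k) * \<bar>a k\<bar> powr p = (2 powr (\<epsilon> * real k) * \<bar>a k\<bar>) powr p"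
      by (simp add: powr_mult powr_powr algebra_simps)
    ultimately have "((2 powr (\<epsilon> * real k) * \<bar>a k\<bar>) powr p) powr (1/p) \<le> S powr (1/p)"
      using p by (intro powr_mono2) auto
    then have "2 powr (\<epsilon> * real k) * \<bar>a k\<bar> \<le> S powr (1/p)"
      using p by (simp add: powr_powr)
    moreover have "r ^ k * 2 powr (\<epsilon> * real k) = 1"
      by (simp add: r_def powr_realpow[symmetric] powr_powr powr_add[symmetric])
    ultimately show ?thesis
      by (metis (no_types, opaque_lifting) mult.assoc mult_1 mult_left_mono r(1) zero_le_power less_imp_le)
  qed
  have g: "summable (\<lambda>k. r ^ k * S powr (1 / p))"
    using r by (intro summable_mult2 summable_geometric) auto
  show s: "summable (\<lambda>k. \<bar>a k\<bar>)"
    by (rule summable_comparison_test[OF _ g]) (use bound in auto)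
  have "(\<Sum>k. \<bar>a k\<bar>) \<le> (\<Sum>k. r ^ k * S powr (1 / p))"
    by (rule suminf_le[OF bound s g])
  also have "\<dots> = (1 / (1 - r)) * S powr (1 / p)"
    using r by (subst suminf_mult2[symmetric]) (auto simp: suminf_geometric summable_geometric)
  finally show "(\<Sum>k. \<bar>a k\<bar>) \<le> (1 / (1 - 2 powr - \<epsilon>)) *
      (\<Sum>k. 2 powr (\<epsilon> * p * real k) * \<bar>a k\<bar> powr p) powr (1 / p)"
    by (simp add: S_def r_def)
qed

lemma geometric_weight_powr:
  fixes a :: "nat \<Rightarrow> real"
  assumes \<epsilon>: "0 < \<epsilon>" and p: "0 < p"
    and sum: "summable (\<lambda>k. 2 powr (\<epsilon> * p * real k) * \<bar>a k\<bar> powr p)"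
  shows "\<bar>\<Sum>k. a k\<bar> powr p \<le> (1 / (1 - 2 powr - \<epsilon>)) powr p *
      (\<Sum>k. 2 powr (\<epsilon> * p * real k) * \<bar>a k\<bar> powr p)"
proof -
  have r: "(2::real) powr - \<epsilon> < 1" using \<epsilon> by (auto simp: powr_less_one)
  define S where "S = (\<Sum>k. 2 powr (\<epsilon> * p * real k) * \<bar>a k\<bar> powr p)"
  have S: "0 \<le> S" unfolding S_def using sum by (intro suminf_nonneg) auto
  have "\<bar>\<Sum>k. a k\<bar> \<le> (\<Sum>k. \<bar>a k\<bar>)"
    by (rule summable_rabs[OF geometric_weight_sum(1)[OF assms]])
  also have "\<dots> \<le> (1 / (1 - 2 powr - \<epsilon>)) * S powr (1 / p)"
    using geometric_weight_sum(2)[OF assms] by (simp add: S_def)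
  finally have "\<bar>\<Sum>k. a k\<bar> powr p \<le> ((1 / (1 - 2 powr - \<epsilon>)) * S powr (1 / p)) powr p"
    using p by (intro powr_mono2) auto
  also have "\<dots> = (1 / (1 - 2 powr - \<epsilon>)) powr p * S"
    using r S p by (subst powr_mult) (auto simp: powr_powr)
  finally show ?thesis by (simp add: S_def)
qed

section \<open>The lattice and the unit cell\<close>

definition unit_cell :: "(real ^ 'n::finite) set" where
  "unit_cell = {x. \<forall>i. 0 \<le> x $ i \<and> x $ i < 1}"

text \<open>Finite stand-in for the lattice in sums over translates. Cubes rather than balls are
  used for points and lattice vectors alike, so that supports can be checked and lattice points
  counted coordinate by coordinate.\<close>

definition int_box :: "nat \<Rightarrow> (int ^ 'n::finite) set" where
  "int_box r = {l. \<forall>i. \<bar>l $ i\<bar> \<le> int r}"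

definition real_box :: "real \<Rightarrow> (real ^ 'n::finite) set" where
  "real_box r = {x. \<forall>i. \<bar>x $ i\<bar> \<le> r}"

lemma torus_eq: "torus = restrict_space lborel unit_cell"
  by (simp add: torus_def unit_cell_def)

lemma of_int_vec_nth [simp]: "of_int_vec l $ i = real_of_int (l $ i)"
  by (simp add: of_int_vec_def)

lemma of_int_vec_0 [simp]: "of_int_vec 0 = 0"
  and of_int_vec_add: "of_int_vec (l + m) = of_int_vec l + of_int_vec m"
  and of_int_vec_minus: "of_int_vec (- l) = - of_int_vec l"
  by (simp_all add: vec_eq_iff)

lemma card_vec_set:
  fixes S :: "'n::finite \<Rightarrow> 'a set"
  assumes "\<And>i. finite (S i)"
  shows "finite {l :: 'a ^ 'n. \<forall>i. l $ i \<in> S i}"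
    and "card {l :: 'a ^ 'n. \<forall>i. l $ i \<in> S i} = (\<Prod>i\<in>UNIV. card (S i))"
proof -
  have b: "bij_betw (\<lambda>l. ($) l) {l :: 'a ^ 'n. \<forall>i. l $ i \<in> S i} (Pi\<^sub>E UNIV S)"
    by (rule bij_betwI[where g = vec_lambda]) (auto simp: PiE_iff)
  have "finite (Pi\<^sub>E UNIV S)" using assms by (intro finite_PiE) auto
  then show "finite {l :: 'a ^ 'n. \<forall>i. l $ i \<in> S i}" using b bij_betw_finite by blast
  show "card {l :: 'a ^ 'n. \<forall>i. l $ i \<in> S i} = (\<Prod>i\<in>UNIV. card (S i))"
    using bij_betw_same_card[OF b] by (simp add: card_PiE)
qed

lemma finite_int_box [simp]: "finite (int_box r :: (int ^ 'n::finite) set)"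
proof -
  have "(int_box r :: (int ^ 'n) set) = {l. \<forall>i. l $ i \<in> {- int r..int r}}"
    by (auto simp: int_box_def abs_le_iff minus_le_iff)
  then show ?thesis using card_vec_set(1)[of "\<lambda>_. {- int r..int r}"] by simp
qed

text \<open>A closed interval of length 2R contains at most 2R + 1 integers, and the coordinates
  multiply. The bound does not depend on \<open>z\<close>; this uniformity later bounds the overlap
  of wavelet supports at all scales.\<close>

lemma card_lattice_near:
  fixes z :: "real ^ 'n::finite"
  shows "finite {l :: int ^ 'n. z - of_int_vec l \<in> real_box (real R)}"
    and "card {l :: int ^ 'n. z - of_int_vec l \<in> real_box (real R)} \<le> (2 * R + 1) ^ CARD('n)"
proof -
  have sub: "{l :: int ^ 'n. z - of_int_vec l \<in> real_box (real R)} \<subseteq>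
      {l. \<forall>i. l $ i \<in> {\<lceil>z $ i - real R\<rceil> .. \<lfloor>z $ i + real R\<rfloor>}}"
  proof (intro subsetI CollectI allI)
    fix l :: "int ^ 'n" and i
    assume "l \<in> {l. z - of_int_vec l \<in> real_box (real R)}"
    then have "\<bar>z $ i - of_int (l $ i)\<bar> \<le> real R" by (simp add: real_box_def)
    then have "z $ i - real R \<le> of_int (l $ i)" "of_int (l $ i) \<le> z $ i + real R" by linarith+
    then show "l $ i \<in> {\<lceil>z $ i - real R\<rceil> .. \<lfloor>z $ i + real R\<rfloor>}"
      unfolding atLeastAtMost_iff ceiling_le_iff le_floor_iff by simp
  qed
  have c: "card {\<lceil>z $ i - real R\<rceil> .. \<lfloor>z $ i + real R\<rfloor>} \<le> 2 * R + 1" for i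
  proof -
    have "real_of_int \<lfloor>z $ i + real R\<rfloor> - real_of_int \<lceil>z $ i - real R\<rceil> \<le> 2 * real R"
      using of_int_floor_le[of "z $ i + real R"] le_of_int_ceiling[of "z $ i - real R"] by linarith
    then have "\<lfloor>z $ i + real R\<rfloor> - \<lceil>z $ i - real R\<rceil> \<le> 2 * int R" by linarith
    then show ?thesis by simp
  qed
  note F = card_vec_set[of "\<lambda>i. {\<lceil>z $ i - real R\<rceil> .. \<lfloor>z $ i + real R\<rfloor>}"]
  show "finite {l :: int ^ 'n. z - of_int_vec l \<in> real_box (real R)}"
    by (rule finite_subset[OF sub F(1)]) auto
  have "card {l :: int ^ 'n. z - of_int_vec l \<in> real_box (real R)} \<le>
     card {l. \<forall>i. l $ i \<in> {\<lceil>z $ i - real R\<rceil> .. \<lfloor>z $ i + real R\<rfloor>}}"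
    by (rule card_mono[OF F(1) sub]) auto
  also have "\<dots> = (\<Prod>i\<in>UNIV. card {\<lceil>z $ i - real R\<rceil> .. \<lfloor>z $ i + real R\<rfloor>})"
    by (rule F(2)) auto
  also have "\<dots> \<le> (\<Prod>i\<in>(UNIV::'n set). 2 * R + 1)" by (rule prod_mono) (use c in auto)
  finally show "card {l :: int ^ 'n. z - of_int_vec l \<in> real_box (real R)} \<le> (2 * R + 1) ^ CARD('n)"
    by simp
qed

section \<open>Integration over the cell and unfolding\<close>

lemma unit_cell_measurable [measurable]: "unit_cell \<in> sets borel"
  unfolding unit_cell_def by measurable

lemma real_box_cbox: "real_box r = cbox (\<chi> i. - r) (\<chi> i. r)"
  by (auto simp: real_box_def cbox_def Basis_vec_def inner_axis abs_le_iff minus_le_iff)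

lemma real_box_measurable [measurable]: "real_box r \<in> sets borel"
  by (simp add: real_box_cbox)

lemma emeasure_real_box_finite: "emeasure lborel (real_box r) < \<infinity>"
  unfolding real_box_cbox by (rule emeasure_bounded_finite) (rule bounded_cbox)

lemma space_torus: "space torus = unit_cell"
  by (simp add: torus_eq space_restrict_space)

lemma measurable_torus: "f \<in> borel_measurable borel \<Longrightarrow> f \<in> borel_measurable torus"
  unfolding torus_eq by (rule measurable_restrict_space1) simp

lemma nn_integral_torus:
  "(\<integral>\<^sup>+x. f x \<partial>torus) = (\<integral>\<^sup>+x. f x * indicator unit_cell x \<partial>lborel)"
  unfolding torus_eq by (rule nn_integral_restrict_space) simp

lemma integral_torus:
  fixes f :: "_ \<Rightarrow> real"
  shows "(LINT x|torus. f x) = (LINT x|lborel. indicator unit_cell x * f x)"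
  unfolding torus_eq by (subst integral_restrict_space) simp_all

lemma integrable_torus:
  fixes f :: "_ \<Rightarrow> real"
  shows "integrable torus f \<longleftrightarrow> integrable lborel (\<lambda>x. indicator unit_cell x * f x)"
  unfolding torus_eq by (subst integrable_restrict_space) simp_all

lemma sigma_finite_torus: "sigma_finite_measure torus"
  unfolding torus_eq by (rule sigma_finite_measure_restrict_space) (simp_all add: sigma_finite_lborel)

lemma nn_integral_lborel_shift:
  fixes t :: "'a::euclidean_space"
  assumes [measurable]: "h \<in> borel_measurable borel"
  shows "(\<integral>\<^sup>+x. h (t + x) \<partial>lborel) = (\<integral>\<^sup>+x. h x \<partial>lborel)"
  by (subst (2) lborel_distr_plus[of t, symmetric]) (simp add: nn_integral_distr)

lemma integral_lborel_shift:
  fixes t :: "'a::euclidean_space" and h :: "'a \<Rightarrow> real"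
  assumes [measurable]: "h \<in> borel_measurable borel"
  shows "(LINT x|lborel. h (t + x)) = (LINT x|lborel. h x)"
  by (subst (2) lborel_distr_plus[of t, symmetric]) (simp add: integral_distr)

lemma nn_integral_lborel_affine:
  fixes t :: "real ^ 'n::finite"
  assumes [measurable]: "h \<in> borel_measurable borel" and c: "0 < c"
  shows "(\<integral>\<^sup>+x. h (t + c *\<^sub>R x) \<partial>lborel) = ennreal (1 / c ^ CARD('n)) * (\<integral>\<^sup>+x. h x \<partial>lborel)"
proof -
  have "(\<integral>\<^sup>+x. h x \<partial>lborel) = ennreal (c ^ CARD('n)) * (\<integral>\<^sup>+x. h (t + c *\<^sub>R x) \<partial>lborel)"
    using c by (subst lborel_affine[of c t]) (auto simp: nn_integral_density nn_integral_distr nn_integral_cmult)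
  then show ?thesis using c
    by (simp add: mult.assoc[symmetric] ennreal_mult[symmetric])
qed

lemma integral_lborel_affine:
  fixes t :: "real ^ 'n::finite" and h :: "_ \<Rightarrow> real"
  assumes [measurable]: "h \<in> borel_measurable borel" and c: "0 < c"
  shows "(LINT x|lborel. h (t + c *\<^sub>R x)) = (1 / c ^ CARD('n)) * (LINT x|lborel. h x)"
proof -
  have "(LINT x|lborel. h x) = c ^ CARD('n) * (LINT x|lborel. h (t + c *\<^sub>R x))"
    using c by (subst lborel_affine[of c t]) (auto simp: integral_density integral_distr)
  then show ?thesis using c by simp
qed

text \<open>The half-open cell meets each lattice orbit exactly once, in the vector of fractional
  parts; the translation is minus the coordinatewise floor.\<close>

lemma unit_cell_translate:
  fixes x :: "real ^ 'n::finite"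
  assumes "x \<in> real_box (real r)" "r < s"
  shows "\<exists>l0\<in>int_box s. \<forall>l. x + of_int_vec l \<in> unit_cell \<longleftrightarrow> l = l0"
proof (intro bexI[of _ "\<chi> i. - \<lfloor>x $ i\<rfloor>"] allI)
  show "(\<chi> i. - \<lfloor>x $ i\<rfloor>) \<in> int_box s"
    using assms by (simp add: int_box_def real_box_def abs_le_iff) (smt (verit) floor_less_iff le_floor_iff of_int_of_nat_eq of_int_minus of_nat_less_iff)
  show "x + of_int_vec l \<in> unit_cell \<longleftrightarrow> l = (\<chi> i. - \<lfloor>x $ i\<rfloor>)" for l
  proof -
    have "0 \<le> x $ i + of_int (l $ i) \<and> x $ i + of_int (l $ i) < 1 \<longleftrightarrow> l $ i = - \<lfloor>x $ i\<rfloor>" for i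
      by linarith
    then show ?thesis by (simp add: unit_cell_def vec_eq_iff)
  qed
qed

text \<open>Unfolding of a torus integral: each point of the support has exactly one translate in
  the cell, which splits \<open>h\<close> into pieces indexed by the lattice, and each piece is
  shifted into the cell. Since the support is bounded, a finite box of shifts contains all
  pieces.\<close>

lemma nn_integral_unfold:
  fixes h :: "real ^ 'n::finite \<Rightarrow> ennreal"
  assumes [measurable]: "h \<in> borel_measurable borel"
    and supp: "\<And>x. h x \<noteq> 0 \<Longrightarrow> x \<in> real_box (real r)" and rs: "r < s"
  shows "(\<Sum>l\<in>int_box s. \<integral>\<^sup>+x. h (x - of_int_vec l) \<partial>torus) = (\<integral>\<^sup>+x. h x \<partial>lborel)"
proof -
  have "(\<integral>\<^sup>+x. h x \<partial>lborel) = (\<integral>\<^sup>+x. (\<Sum>l\<in>int_box s. h x * indicator unit_cell (x + of_int_vec l)) \<partial>lborel)"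
  proof (rule nn_integral_cong)
    fix x
    show "h x = (\<Sum>l\<in>int_box s. h x * indicator unit_cell (x + of_int_vec l))"
    proof (cases "h x = 0")
      case False
      then obtain l0 where l0: "l0 \<in> int_box s" "\<And>l. x + of_int_vec l \<in> unit_cell \<longleftrightarrow> l = l0"
        using unit_cell_translate[OF supp rs] by blast
      have "(\<Sum>l\<in>int_box s. h x * indicator unit_cell (x + of_int_vec l)) =
          (\<Sum>l\<in>int_box s. if l = l0 then h x else 0)"
        by (rule sum.cong) (auto simp: l0 indicator_def)
      then show ?thesis using l0 by simp
    qed simp
  qed
  also have "\<dots> = (\<Sum>l\<in>int_box s. \<integral>\<^sup>+x. h x * indicator unit_cell (x + of_int_vec l) \<partial>lborel)"
    by (rule nn_integral_sum) measurable
  also have "\<dots> = (\<Sum>l\<in>int_box s. \<integral>\<^sup>+x. h (x - of_int_vec l) \<partial>torus)"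
  proof (rule sum.cong[OF refl])
    fix l :: "int ^ 'n"
    have "(\<integral>\<^sup>+x. h x * indicator unit_cell (x + of_int_vec l) \<partial>lborel) =
      (\<integral>\<^sup>+x. h (- of_int_vec l + x) * indicator unit_cell (- of_int_vec l + x + of_int_vec l) \<partial>lborel)"
      by (subst nn_integral_lborel_shift[where t = "- of_int_vec l" and h = "\<lambda>x. h x * indicator unit_cell (x + of_int_vec l)"])
        simp_all
    then show "(\<integral>\<^sup>+x. h x * indicator unit_cell (x + of_int_vec l) \<partial>lborel) = (\<integral>\<^sup>+x. h (x - of_int_vec l) \<partial>torus)"
      by (simp add: nn_integral_torus)
  qed
  finally show ?thesis ..
qed

lemma integral_unfold:
  fixes h :: "real ^ 'n::finite \<Rightarrow> real"
  assumes h: "integrable lborel h"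
    and supp: "\<And>x. h x \<noteq> 0 \<Longrightarrow> x \<in> real_box (real r)" and rs: "r < s"
  shows "(LINT x|torus. (\<Sum>l\<in>int_box s. h (x - of_int_vec l))) = (LINT x|lborel. h x)"
proof -
  have [measurable]: "h \<in> borel_measurable borel" using borel_measurable_integrable[OF h] by simp
  have i1: "integrable lborel (\<lambda>x. indicator unit_cell (x + of_int_vec l) * h x)" for l :: "int ^ 'n"
    by (rule Bochner_Integration.integrable_bound[OF h]) (auto simp: indicator_def)
  have shift: "integrable lborel (\<lambda>x. g (t + x))" if "integrable lborel g" for g :: "real ^ 'n \<Rightarrow> real" and t
  proof -
    have [measurable]: "g \<in> borel_measurable borel" using borel_measurable_integrable[OF that] by simp
    have "integrable (distr lborel borel ((+) t)) g" using that by (simp add: lborel_distr_plus)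
    then show ?thesis by (subst (asm) integrable_distr_eq) auto
  qed
  have i2: "integrable torus (\<lambda>x. h (x - of_int_vec l))" for l :: "int ^ 'n"
    using shift[OF i1[of l], of "- of_int_vec l"] by (simp add: integrable_torus)
  have "(LINT x|lborel. h x) = (LINT x|lborel. (\<Sum>l\<in>int_box s. indicator unit_cell (x + of_int_vec l) * h x))"
  proof (rule Bochner_Integration.integral_cong[OF refl])
    fix x
    show "h x = (\<Sum>l\<in>int_box s. indicator unit_cell (x + of_int_vec l) * h x)"
    proof (cases "h x = 0")
      case False
      then obtain l0 where l0: "l0 \<in> int_box s" "\<And>l. x + of_int_vec l \<in> unit_cell \<longleftrightarrow> l = l0"
        using unit_cell_translate[OF supp rs] by blast
      have "(\<Sum>l\<in>int_box s. indicator unit_cell (x + of_int_vec l) * h x) =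
          (\<Sum>l\<in>int_box s. if l = l0 then h x else 0)"
        by (rule sum.cong) (auto simp: l0 indicator_def)
      then show ?thesis using l0 by simp
    qed simp
  qed
  also have "\<dots> = (\<Sum>l\<in>int_box s. LINT x|lborel. indicator unit_cell (x + of_int_vec l) * h x)"
    by (rule Bochner_Integration.integral_sum[OF i1])
  also have "\<dots> = (\<Sum>l\<in>int_box s. LINT x|torus. h (x - of_int_vec l))"
  proof (rule sum.cong[OF refl])
    fix l :: "int ^ 'n"
    show "(LINT x|lborel. indicator unit_cell (x + of_int_vec l) * h x) = (LINT x|torus. h (x - of_int_vec l))"
      by (subst integral_lborel_shift[where t = "- of_int_vec l", symmetric])
        (simp_all add: integral_torus)
  qed
  also have "\<dots> = (LINT x|torus. (\<Sum>l\<in>int_box s. h (x - of_int_vec l)))"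
    by (rule Bochner_Integration.integral_sum[symmetric, OF i2])
  finally show "(LINT x|torus. (\<Sum>l\<in>int_box s. h (x - of_int_vec l))) = (LINT x|lborel. h x)" ..
qed

section \<open>The quotient distance\<close>

lemma torus_dist_le: "torus_dist x y \<le> norm (x - y - of_int_vec l)"
  unfolding torus_dist_def by (rule cINF_lower) (auto intro!: bdd_belowI[of _ 0])

lemma torus_dist_nonneg: "0 \<le> torus_dist x y"
  unfolding torus_dist_def by (rule cINF_greatest) auto

text \<open>Coordinates of \<open>x - y\<close> lie strictly between -1 and 1, so clamping each
  coordinate of \<open>l\<close> to {-1, 0, 1} cannot increase any coordinate of
  \<open>x - y - of_int_vec l\<close>. The infimum over the lattice is thus a minimum over
  \<open>int_box 1\<close>, which later lets a finite sum of Euclidean kernels dominate the torus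
  kernel.\<close>

lemma torus_dist_attained:
  fixes x y :: "real ^ 'n::finite"
  assumes "x \<in> unit_cell" "y \<in> unit_cell"
  shows "\<exists>l\<in>int_box 1. torus_dist x y = norm (x - y - of_int_vec l)"
proof -
  let ?N = "\<lambda>l. norm (x - y - of_int_vec l)"
  define m where "m = Min (?N ` (int_box 1))"
  have ne: "(int_box 1 :: (int ^ 'n) set) \<noteq> {}" by (auto simp: int_box_def intro!: exI[of _ 0])
  have "m \<in> ?N ` (int_box 1)" unfolding m_def using ne by (intro Min_in) auto
  then obtain l0 where l0: "l0 \<in> int_box 1" "m = ?N l0" by auto
  have "m \<le> ?N l" for l
  proof -
    define l' :: "int ^ 'n" where "l' = (\<chi> i. max (-1) (min 1 (l $ i)))"
    have l': "l' \<in> int_box 1" by (auto simp: l'_def int_box_def)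
    have "\<bar>(x - y - of_int_vec l') $ i\<bar> \<le> \<bar>(x - y - of_int_vec l) $ i\<bar>" for i
    proof -
      have "-1 < x $ i - y $ i" "x $ i - y $ i < 1"
        using assms by (auto simp: unit_cell_def) (smt (verit))+
      moreover consider "l $ i \<le> -1" | "l $ i = 0" | "1 \<le> l $ i" by linarith
      then have "\<bar>x $ i - y $ i - of_int (max (-1) (min 1 (l $ i)))\<bar> \<le> \<bar>x $ i - y $ i - of_int (l $ i)\<bar>"
        by cases (use calculation in auto)
      ultimately show ?thesis by (simp add: l'_def)
    qed
    then have "?N l' \<le> ?N l" by (intro norm_le_componentwise_cart) auto
    moreover have "m \<le> ?N l'" unfolding m_def using l' by (intro Min_le) auto
    ultimately show ?thesis by simp
  qed
  then have "m \<le> torus_dist x y" unfolding torus_dist_def by (intro cINF_greatest) auto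
  with torus_dist_le[of x y l0] l0 show ?thesis by (auto intro!: bexI[of _ l0])
qed

lemma torus_dist_eq_0:
  assumes "x \<in> unit_cell" "y \<in> unit_cell" "torus_dist x y = 0"
  shows "x = y"
proof -
  obtain l where "x - y - of_int_vec l = 0" using torus_dist_attained[OF assms(1,2)] assms(3) by auto
  then have l: "x $ i - y $ i = of_int (l $ i)" for i by (simp add: vec_eq_iff)
  have "l $ i = 0" for i
  proof -
    have "-1 < x $ i - y $ i" "x $ i - y $ i < 1"
      using assms(1,2) by (auto simp: unit_cell_def) (smt (verit))+
    then show ?thesis using l[of i] by linarith
  qed
  then show ?thesis using l by (simp add: vec_eq_iff)
qed

lemma norm_le_card_sup:
  fixes x :: "real ^ 'n::finite"
  assumes "x \<in> real_box r"
  shows "norm x \<le> real CARD('n) * r"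
proof -
  have "norm x \<le> (\<Sum>i\<in>UNIV. \<bar>x $ i\<bar>)" by (rule norm_le_l1_cart)
  also have "\<dots> \<le> (\<Sum>i\<in>(UNIV::'n set). r)" using assms by (intro sum_mono) (auto simp: real_box_def)
  finally show ?thesis by simp
qed

lemma torus_dist_le_card:
  fixes x y :: "real ^ 'n::finite"
  assumes "x \<in> unit_cell" "y \<in> unit_cell"
  shows "torus_dist x y \<le> real CARD('n)"
proof -
  have "x - y \<in> real_box 1" using assms
    by (auto simp: unit_cell_def real_box_def abs_le_iff) (smt (verit))+
  from norm_le_card_sup[OF this] torus_dist_le[of x y 0] show ?thesis by simp
qed

section \<open>Local integrability of the radial kernel\<close>

lemma dyadic_bracket:
  fixes x :: real
  assumes "1 \<le> x"
  shows "\<exists>j::nat. 2 ^ j \<le> x \<and> x < 2 ^ Suc j"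
proof -
  define j where "j = nat \<lfloor>log 2 x\<rfloor>"
  have 0: "0 \<le> log 2 x" using assms by simp
  have "real j \<le> log 2 x" "log 2 x < real j + 1" using 0 unfolding j_def by linarith+
  then have "2 powr real j \<le> x" "x < 2 powr (real j + 1)"
    using assms by (simp_all add: le_log_iff log_less_iff)
  then show ?thesis by (intro exI[of _ j]) (simp add: powr_realpow[symmetric] powr_add add.commute)
qed

lemma ennreal_le_suminf: "f j \<le> (\<Sum>j. f j :: ennreal)"
  using sum_le_suminf[of f "{j}"] by simp

text \<open>Dyadic balls replace polar coordinates: a point with r / 2^(j+1) < |h| <= r / 2^j is
  charged to the ball of radius r / 2^j, with the weight taken at the inner radius, which dominates
  because \<kappa> is at most the dimension. Ball volume times weight is of order 2^(-\<kappa> j),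
  so the series is geometric.\<close>

lemma nn_integral_radial_finite:
  fixes r \<kappa> :: real
  assumes \<kappa>: "0 < \<kappa>" "\<kappa> \<le> real CARD('n::finite)" and r: "0 < r"
  shows "(\<integral>\<^sup>+h. ennreal (norm h powr (\<kappa> - real CARD('n))) * indicator (cball 0 r) h
      \<partial>(lborel :: (real ^ 'n) measure)) < \<infinity>"
proof -
  let ?n = "real CARD('n)"
  define V where "V = unit_ball_vol ?n"
  have V: "0 \<le> V" by (simp add: V_def)
  define w where "w j = (r / 2 ^ Suc j) powr (\<kappa> - ?n)" for j :: nat
  have "(\<integral>\<^sup>+h. ennreal (norm h powr (\<kappa> - ?n)) * indicator (cball 0 r) h \<partial>(lborel :: (real ^ 'n) measure))
    \<le> (\<integral>\<^sup>+h. (\<Sum>j. ennreal (w j) * indicator (cball 0 (r / 2 ^ j)) h) \<partial>(lborel :: (real ^ 'n) measure))"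
  proof (rule nn_integral_mono)
    fix h :: "real ^ 'n"
    show "ennreal (norm h powr (\<kappa> - ?n)) * indicator (cball 0 r) h
      \<le> (\<Sum>j. ennreal (w j) * indicator (cball 0 (r / 2 ^ j)) h)"
    proof (cases "h \<noteq> 0 \<and> norm h \<le> r")
      case True
      then obtain j :: nat where j: "2 ^ j \<le> r / norm h" "r / norm h < 2 ^ Suc j"
        using dyadic_bracket[of "r / norm h"] by auto
      have "norm h powr (\<kappa> - ?n) \<le> w j"
        unfolding w_def
      proof (rule powr_mono2')
        show "r / 2 ^ Suc j \<le> norm h" using j True by (simp add: field_simps)
      qed (use \<kappa> r True in auto)
      then have "ennreal (norm h powr (\<kappa> - ?n)) * indicator (cball 0 r) h
          \<le> ennreal (w j) * indicator (cball 0 (r / 2 ^ j)) h"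
        using True j by (auto simp: indicator_def field_simps intro: ennreal_leI)
      also have "\<dots> \<le> (\<Sum>j. ennreal (w j) * indicator (cball 0 (r / 2 ^ j)) h)"
        by (rule ennreal_le_suminf)
      finally show ?thesis .
    qed (auto simp: indicator_def)
  qed
  also have "\<dots> = (\<Sum>j. ennreal (w j) * emeasure lborel (cball (0 :: real ^ 'n) (r / 2 ^ j)))"
  proof -
    have [measurable]: "cball (0 :: real ^ 'n) u \<in> sets borel" for u by simp
    show ?thesis by (subst nn_integral_suminf) (simp_all add: nn_integral_cmult_indicator)
  qed
  also have "\<dots> = (\<Sum>j. ennreal (w j * (V * (r / 2 ^ j) ^ CARD('n))))"
    using r V by (simp add: emeasure_cball V_def w_def ennreal_mult)
  also have "\<dots> = (\<Sum>j. ennreal ((r powr \<kappa> * V * 2 powr (?n - \<kappa>)) * (2 powr - \<kappa>) ^ j))"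
  proof (intro suminf_cong arg_cong[where f = ennreal])
    fix j
    have pw: "(2::real) ^ i = 2 powr real i" for i by (simp add: powr_realpow)
    have "w j = r powr (\<kappa> - ?n) * 2 powr ((?n - \<kappa>) * real (Suc j))"
    proof -
      have "w j = r powr (\<kappa> - ?n) / 2 powr (real (Suc j) * (\<kappa> - ?n))"
        using r unfolding w_def pw by (simp add: powr_divide powr_powr)
      also have "\<dots> = r powr (\<kappa> - ?n) * 2 powr (- (real (Suc j) * (\<kappa> - ?n)))"
        by (simp only: powr_minus divide_inverse)
      also have "- (real (Suc j) * (\<kappa> - ?n)) = (?n - \<kappa>) * real (Suc j)" by (simp add: algebra_simps)
      finally show ?thesis .
    qed
    moreover have "(r / 2 ^ j) ^ CARD('n) = r powr ?n * 2 powr (- (?n * real j))"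
    proof -
      have "(r / 2 ^ j) ^ CARD('n) = (r / 2 powr real j) powr ?n"
        using r unfolding pw[symmetric] by (subst powr_realpow) auto
      also have "\<dots> = r powr ?n / 2 powr (real j * ?n)" using r by (simp add: powr_divide powr_powr)
      also have "\<dots> = r powr ?n * 2 powr (- (real j * ?n))" by (simp only: powr_minus divide_inverse)
      finally show ?thesis by (simp add: mult.commute)
    qed
    ultimately have "w j * (V * (r / 2 ^ j) ^ CARD('n)) =
        V * (r powr (\<kappa> - ?n) * r powr ?n) * (2 powr ((?n - \<kappa>) * real (Suc j)) * 2 powr (- (?n * real j)))"
      by simp
    also have "r powr (\<kappa> - ?n) * r powr ?n = r powr \<kappa>" by (simp add: powr_add[symmetric])
    also have "(2::real) powr ((?n - \<kappa>) * real (Suc j)) * 2 powr (- (?n * real j)) = 2 powr (?n - \<kappa>) * (2 powr - \<kappa>) ^ j"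
      by (simp add: powr_add[symmetric] powr_realpow[symmetric] powr_powr algebra_simps)
    finally show "w j * (V * (r / 2 ^ j) ^ CARD('n)) = (r powr \<kappa> * V * 2 powr (?n - \<kappa>)) * (2 powr - \<kappa>) ^ j"
      by (simp add: algebra_simps)
  qed
  also have "\<dots> < \<infinity>"
  proof -
    have "summable (\<lambda>j. (r powr \<kappa> * V * 2 powr (?n - \<kappa>)) * (2 powr - \<kappa>) ^ j)"
      using \<kappa> by (intro summable_mult summable_geometric) (auto simp: powr_less_one)
    then show ?thesis using V by (subst suminf_ennreal2) auto
  qed
  finally show ?thesis .
qed

section \<open>The space \<open>L\<^sup>1\<close> of the torus\<close>

lemma L1_class_surj: "\<exists>g. integrable torus g \<and> f = L1_class g"
  by transfer (auto simp: L1_rel_def)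

lemma L1_class_add:
  "integrable torus f \<Longrightarrow> integrable torus g \<Longrightarrow> L1_class f + L1_class g = L1_class (\<lambda>x. f x + g x)"
  by transfer (auto simp: L1_rel_def)

lemma L1_class_diff:
  "integrable torus f \<Longrightarrow> integrable torus g \<Longrightarrow> L1_class f - L1_class g = L1_class (\<lambda>x. f x - g x)"
  by transfer (auto simp: L1_rel_def)

lemma L1_class_scaleR: "integrable torus f \<Longrightarrow> c *\<^sub>R L1_class f = L1_class (\<lambda>x. c * f x)"
  by transfer (auto simp: L1_rel_def)

lemma L1_class_0: "L1_class (\<lambda>_. 0) = 0"
  by transfer (auto simp: L1_rel_def)

lemma L1_class_sum:
  assumes "\<And>i. i \<in> J \<Longrightarrow> integrable torus (f i)"
  shows "(\<Sum>i\<in>J. L1_class (f i)) = L1_class (\<lambda>x. \<Sum>i\<in>J. f i x)"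
  using assms
proof (induction J rule: infinite_finite_induct)
  case (insert i J)
  have "L1_class (f i) + L1_class (\<lambda>x. \<Sum>i\<in>J. f i x) = L1_class (\<lambda>x. f i x + (\<Sum>i\<in>J. f i x))"
    using insert.prems by (intro L1_class_add Bochner_Integration.integrable_sum) auto
  with insert show ?case by simp
qed (simp_all add: L1_class_0)

lemma norm_L1_class: "integrable torus f \<Longrightarrow> norm (L1_class f) = (LINT x|torus. \<bar>f x\<bar>)"
  by transfer auto

lemma is_sobolev_L1_class:
  "integrable torus f \<Longrightarrow> is_sobolev \<alpha> q (L1_class f) \<longleftrightarrow>
    integrable torus (\<lambda>x. \<bar>f x\<bar> powr q) \<and> sobolev_integral \<alpha> q f < \<infinity>"
  by transfer auto

text \<open>Pairing with a function \<open>h\<close>, in practice a bounded wavelet. The value 0 for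
  non-measurable \<open>h\<close> makes the definition compatible with almost everywhere equality,
  since comparing the two integrals uses measurable integrands.\<close>

lift_definition torus_pair :: "(real ^ 'n::finite \<Rightarrow> real) \<Rightarrow> 'n L1_torus \<Rightarrow> real"
  is "\<lambda>h f. if h \<in> borel_measurable torus then LINT x|torus. f x * h x else 0"
proof -
  fix h f g :: "real ^ 'n \<Rightarrow> real"
  assume fg: "L1_rel f g"
  then have [measurable]: "f \<in> borel_measurable torus" "g \<in> borel_measurable torus"
    and ae: "AE x in torus. f x = g x" by (auto simp: L1_rel_def)
  have "(LINT x|torus. f x * h x) = (LINT x|torus. g x * h x)" if [measurable]: "h \<in> borel_measurable torus"
    by (rule integral_cong_AE) (use ae in auto)
  then show "(if h \<in> borel_measurable torus then LINT x|torus. f x * h x else 0) =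
      (if h \<in> borel_measurable torus then LINT x|torus. g x * h x else 0)" by simp
qed

lemma torus_pair_L1_class:
  "integrable torus f \<Longrightarrow> h \<in> borel_measurable torus \<Longrightarrow>
    torus_pair h (L1_class f) = (LINT x|torus. f x * h x)"
  by transfer auto

lemma integrable_mult_bounded:
  fixes f h :: "'a \<Rightarrow> real"
  assumes f: "integrable M f" and h[measurable]: "h \<in> borel_measurable M"
    and b: "\<And>x. x \<in> space M \<Longrightarrow> \<bar>h x\<bar> \<le> A"
  shows "integrable M (\<lambda>x. f x * h x)"
proof (rule Bochner_Integration.integrable_bound)
  show "integrable M (\<lambda>x. A * f x)" using f by simp
  have [measurable]: "f \<in> borel_measurable M" using f by auto
  show "(\<lambda>x. f x * h x) \<in> borel_measurable M" by measurable
  show "AE x in M. norm (f x * h x) \<le> norm (A * f x)"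
  proof (rule AE_I2)
    fix x assume "x \<in> space M"
    from b[OF this] have "\<bar>h x\<bar> * \<bar>f x\<bar> \<le> \<bar>A\<bar> * \<bar>f x\<bar>" by (intro mult_right_mono) auto
    then show "norm (f x * h x) \<le> norm (A * f x)" by (simp add: abs_mult mult.commute)
  qed
qed

text \<open>Boundedness of \<open>h\<close> makes the pairing continuous on L^1. Continuity lets
  coefficients be computed term by term in an L^1-convergent series and makes them Borel
  functions.\<close>

lemma bounded_linear_torus_pair:
  fixes h :: "real ^ 'n::finite \<Rightarrow> real"
  assumes h[measurable]: "h \<in> borel_measurable torus" and b: "\<And>x. x \<in> unit_cell \<Longrightarrow> \<bar>h x\<bar> \<le> A"
  shows "bounded_linear (torus_pair h)"
proof (rule bounded_linear_intro[where K = A])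
  have int: "integrable torus (\<lambda>x. g x * h x)" if "integrable torus g" for g
    by (rule integrable_mult_bounded[OF that h]) (use b in \<open>auto simp: space_torus\<close>)
  fix f g :: "'n L1_torus" and r :: real
  obtain f' where f': "integrable torus f'" "f = L1_class f'" using L1_class_surj by blast
  obtain g' where g': "integrable torus g'" "g = L1_class g'" using L1_class_surj by blast
  show "torus_pair h (f + g) = torus_pair h f + torus_pair h g"
    using f' g' int by (simp add: L1_class_add torus_pair_L1_class distrib_right)
  show "torus_pair h (r *\<^sub>R f) = r *\<^sub>R torus_pair h f"
    using f' int by (simp add: L1_class_scaleR torus_pair_L1_class mult.assoc)
  have "\<bar>LINT x|torus. f' x * h x\<bar> \<le> (LINT x|torus. \<bar>f' x * h x\<bar>)" by (rule integral_abs_bound)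
  also have "\<dots> \<le> (LINT x|torus. \<bar>f' x\<bar> * A)"
  proof (rule integral_mono)
    fix x :: "real ^ 'n" assume "x \<in> space torus"
    then have "\<bar>f' x\<bar> * \<bar>h x\<bar> \<le> \<bar>f' x\<bar> * A" by (intro mult_left_mono b) (auto simp: space_torus)
    then show "\<bar>f' x * h x\<bar> \<le> \<bar>f' x\<bar> * A" by (simp add: abs_mult)
  qed (use f' int in auto)
  finally show "norm (torus_pair h f) \<le> norm f * A"
    using f' by (simp add: torus_pair_L1_class norm_L1_class)
qed

text \<open>Dominated convergence with dominating function \<open>2 * h\<close>, because a partial
  sum and the full sum are both at most \<open>h\<close> in absolute value almost everywhere. It
  identifies the sum in the quotient space with the class of the pointwise sum, whose Sobolev
  integral can be estimated.\<close>

lemma L1_class_sums: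
  fixes f :: "nat \<Rightarrow> real ^ 'n::finite \<Rightarrow> real"
  assumes f: "\<And>k. integrable torus (f k)" and h: "integrable torus h"
    and dom: "AE x in torus. summable (\<lambda>k. \<bar>f k x\<bar>) \<and> (\<Sum>k. \<bar>f k x\<bar>) \<le> h x"
  shows "integrable torus (\<lambda>x. \<Sum>k. f k x)"
    and "(\<lambda>k. L1_class (f k)) sums L1_class (\<lambda>x. \<Sum>k. f k x)"
proof -
  have [measurable]: "f k \<in> borel_measurable torus" for k using f by auto
  have [measurable]: "h \<in> borel_measurable torus" using h by auto
  show i: "integrable torus (\<lambda>x. \<Sum>k. f k x)"
  proof (rule Bochner_Integration.integrable_bound[OF h])
    show "AE x in torus. norm (\<Sum>k. f k x) \<le> norm (h x)"
      using dom
    proof eventually_elim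
      case (elim x)
      with summable_rabs[of "\<lambda>k. f k x"] show ?case by (simp, linarith)
    qed
  qed measurable
  have "(\<lambda>N. LINT x|torus. \<bar>(\<Sum>k<N. f k x) - (\<Sum>k. f k x)\<bar>) \<longlonglongrightarrow> (LINT x|(torus :: (real ^ 'n) measure). (0::real))"
  proof (rule integral_dominated_convergence[where w = "\<lambda>x. 2 * h x" and f = "\<lambda>_. 0"
        and s = "\<lambda>N x. \<bar>(\<Sum>k<N. f k x) - (\<Sum>k. f k x)\<bar>"])
    show "AE x in torus. (\<lambda>N. \<bar>(\<Sum>k<N. f k x) - (\<Sum>k. f k x)\<bar>) \<longlonglongrightarrow> 0"
      using dom
    proof eventually_elim
      case (elim x)
      then have "(\<lambda>N. (\<Sum>k<N. f k x)) \<longlonglongrightarrow> (\<Sum>k. f k x)"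
        using summable_LIMSEQ[OF summable_rabs_cancel[of "\<lambda>k. f k x"]] by simp
      then show ?case by (rule tendsto_rabs_zero[OF LIM_zero])
    qed
    show "AE x in torus. norm \<bar>(\<Sum>k<N. f k x) - (\<Sum>k. f k x)\<bar> \<le> 2 * h x" for N
      using dom
    proof eventually_elim
      case (elim x)
      have "\<bar>\<Sum>k<N. f k x\<bar> \<le> (\<Sum>k<N. \<bar>f k x\<bar>)" by (rule sum_abs)
      also have "\<dots> \<le> (\<Sum>k. \<bar>f k x\<bar>)" using elim by (intro sum_le_suminf) auto
      finally show ?case using elim summable_rabs[of "\<lambda>k. f k x"] by (simp, linarith)
    qed
  qed (use h in auto)
  then have "(\<lambda>N. norm ((\<Sum>k<N. L1_class (f k)) - L1_class (\<lambda>x. \<Sum>k. f k x))) \<longlonglongrightarrow> 0"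
    using f i by (simp add: L1_class_sum L1_class_diff norm_L1_class)
  then show "(\<lambda>k. L1_class (f k)) sums L1_class (\<lambda>x. \<Sum>k. f k x)"
    unfolding sums_def by (rule LIM_zero_cancel[OF tendsto_norm_zero_cancel])
qed

section \<open>Compactly supported Lipschitz wavelets\<close>

text \<open>Quantitative form of a wavelet family: one box contains all supports, and one constant
  \<open>A\<close> serves as sup bound and as Lipschitz constant. The wavelets carry no factor
  2^(kn/2), so the squared L^2 norm at scale k is 2^(-kn).\<close>

locale lipschitz_wavelets =
  fixes \<Psi> :: "nat \<Rightarrow> real ^ 'n::finite \<Rightarrow> real" and R :: nat and A :: real
  assumes supp: "e < 2 ^ CARD('n) - 1 \<Longrightarrow> \<Psi> e x \<noteq> 0 \<Longrightarrow> x \<in> real_box (real R)"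
    and A_pos: "0 < A"
    and bnd: "e < 2 ^ CARD('n) - 1 \<Longrightarrow> \<bar>\<Psi> e x\<bar> \<le> A"
    and lip: "e < 2 ^ CARD('n) - 1 \<Longrightarrow> \<bar>\<Psi> e x - \<Psi> e y\<bar> \<le> A * norm (x - y)"
    and orth: "e < 2 ^ CARD('n) - 1 \<Longrightarrow> e' < 2 ^ CARD('n) - 1 \<Longrightarrow>
      (LINT x|lborel. \<Psi> e (2 ^ k *\<^sub>R x - of_int_vec m) * \<Psi> e' (2 ^ k' *\<^sub>R x - of_int_vec m')) =
      (if e = e' \<and> k = k' \<and> m = m' then 1 / 2 ^ (k * CARD('n)) else 0)"

text \<open>The derivative is bounded on a ball containing the support by compactness, and vanishes
  outside the ball, where \<open>g\<close> is locally zero; the mean value inequality on the whole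
  space gives the Lipschitz bound.\<close>

lemma C1_compact_support_bounds:
  fixes g :: "real ^ 'n::finite \<Rightarrow> real"
  assumes "C1_function g" "compact (closure {x. g x \<noteq> 0})"
  shows "\<exists>R A. \<forall>x y. (g x \<noteq> 0 \<longrightarrow> norm x \<le> R) \<and> \<bar>g x\<bar> \<le> A \<and> \<bar>g x - g y\<bar> \<le> A * norm (x - y)"
proof -
  from assms(1) obtain D where D: "\<And>x. (g has_derivative blinfun_apply (D x)) (at x)"
    and cD: "continuous_on UNIV D" by (auto simp: C1_function_def)
  have "bounded {x. g x \<noteq> 0}" 
    by (rule bounded_subset[OF compact_imp_bounded[OF assms(2)] closure_subset])
  then obtain r where r: "\<And>x. g x \<noteq> 0 \<Longrightarrow> norm x \<le> r" by (auto simp: bounded_iff)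
  have cg: "continuous_on UNIV g"
    using D by (meson continuous_at_imp_continuous_on has_derivative_continuous)
  have "bounded (D ` cball 0 r)"
    by (intro compact_imp_bounded compact_continuous_image continuous_on_subset[OF cD]) auto
  then obtain B where B: "\<And>x. norm x \<le> r \<Longrightarrow> norm (D x) \<le> B" unfolding bounded_iff by (metis dist_0_norm image_eqI mem_cball)
  have "bounded (g ` cball 0 r)"
    by (intro compact_imp_bounded compact_continuous_image continuous_on_subset[OF cg]) auto
  then obtain C where C: "\<And>x. norm x \<le> r \<Longrightarrow> \<bar>g x\<bar> \<le> C" unfolding bounded_iff by (metis dist_0_norm image_eqI mem_cball real_norm_def)
  define A where "A = max \<bar>B\<bar> \<bar>C\<bar>"
  have nD: "onorm (blinfun_apply (D x)) \<le> A" for x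
  proof (cases "norm x \<le> r")
    case True
    then show ?thesis using B[OF True] by (simp add: A_def norm_blinfun.rep_eq[symmetric])
  next
    case False
    have "(g has_derivative (\<lambda>_. 0)) (at x)"
    proof (rule has_derivative_transform_within_open[where s = "- cball 0 r" and f = "\<lambda>_. 0"])
      show "0 = g y" if "y \<in> - cball 0 r" for y using that r[of y] by auto
    qed (use False in auto)
    with D[of x] have "blinfun_apply (D x) = (\<lambda>_. 0)" by (rule has_derivative_unique)
    then show ?thesis by (simp add: onorm_zero A_def)
  qed
  have "norm (g x - g y) \<le> A * norm (x - y)" for x y
    by (rule differentiable_bound[where S = UNIV and f' = "\<lambda>x. blinfun_apply (D x)"]) (use D nD in auto)
  moreover have "\<bar>g x\<bar> \<le> A" for x
    using C[of x] r[of x] by (cases "g x = 0") (auto simp: A_def)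
  ultimately show ?thesis using r by (intro exI[of _ r] exI[of _ A]) auto
qed

lemma lipschitz_wavelets_exists:
  fixes \<Psi> :: "nat \<Rightarrow> real ^ 'n::finite \<Rightarrow> real"
  assumes "wavelet_family \<Psi>"
  shows "\<exists>R A. lipschitz_wavelets \<Psi> R A"
proof -
  define E :: nat where "E = 2 ^ CARD('n) - 1"
  have "\<forall>e<E. \<exists>R A. \<forall>x y. (\<Psi> e x \<noteq> 0 \<longrightarrow> norm x \<le> R) \<and> \<bar>\<Psi> e x\<bar> \<le> A \<and>
      \<bar>\<Psi> e x - \<Psi> e y\<bar> \<le> A * norm (x - y)"
  proof (intro allI impI)
    fix e assume "e < E"
    then have "C1_function (\<Psi> e)" "compact (closure {x. \<Psi> e x \<noteq> 0})"
      using assms by (auto simp: wavelet_family_def E_def)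
    then show "\<exists>R A. \<forall>x y. (\<Psi> e x \<noteq> 0 \<longrightarrow> norm x \<le> R) \<and> \<bar>\<Psi> e x\<bar> \<le> A \<and>
      \<bar>\<Psi> e x - \<Psi> e y\<bar> \<le> A * norm (x - y)" by (rule C1_compact_support_bounds)
  qed
  then obtain r a where ra: "\<And>e x y. e < E \<Longrightarrow> (\<Psi> e x \<noteq> 0 \<longrightarrow> norm x \<le> r e) \<and> \<bar>\<Psi> e x\<bar> \<le> a e \<and>
      \<bar>\<Psi> e x - \<Psi> e y\<bar> \<le> a e * norm (x - y)"
    by metis
  \<comment> \<open>Sums over the finitely many mother wavelets act as common upper bounds; the
    summand 1 in \<open>A\<close> makes it strictly positive.\<close>
  define R where "R = nat \<lceil>\<Sum>e<E. \<bar>r e\<bar>\<rceil>"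
  define A where "A = 1 + (\<Sum>e<E. \<bar>a e\<bar>)"
  have R: "r e \<le> real R" if "e < E" for e
  proof -
    have "\<bar>r e\<bar> \<le> (\<Sum>e<E. \<bar>r e\<bar>)" using that by (intro member_le_sum) auto
    then show ?thesis unfolding R_def by linarith
  qed
  have A: "a e \<le> A" if "e < E" for e
  proof -
    have "\<bar>a e\<bar> \<le> (\<Sum>e<E. \<bar>a e\<bar>)" using that by (intro member_le_sum) auto
    then show ?thesis unfolding A_def by linarith
  qed
  have "lipschitz_wavelets \<Psi> R A"
  proof (unfold_locales, fold E_def)
    fix e x y assume e: "e < E"
    show "x \<in> real_box (real R)" if "\<Psi> e x \<noteq> 0"
    proof -
      have "norm x \<le> real R" using that ra[OF e, of x] R[OF e] by fastforce
      then show ?thesis by (auto simp: real_box_def intro: order_trans[OF component_le_norm_cart])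
    qed
    show "\<bar>\<Psi> e x\<bar> \<le> A" using ra[OF e, of x x] A[OF e] by linarith
    have "a e * norm (x - y) \<le> A * norm (x - y)" using A[OF e] by (intro mult_right_mono) auto
    then show "\<bar>\<Psi> e x - \<Psi> e y\<bar> \<le> A * norm (x - y)" using ra[OF e, of x y] by linarith
  next
    show "0 < A" by (auto simp: A_def add_pos_nonneg sum_nonneg)
  next
    fix e e' k k' and m m' :: "int ^ 'n"
    assume e: "e < E" "e' < E"
    have "LINT x|lborel. (case (e, int k, m) of (e, k, m) \<Rightarrow> \<lambda>x. 2 powr (real_of_int k * real CARD('n) / 2) *
        \<Psi> e ((2 powi k) *\<^sub>R x - of_int_vec m)) x * (case (e', int k', m') of (e, k, m) \<Rightarrow> \<lambda>x.
        2 powr (real_of_int k * real CARD('n) / 2) * \<Psi> e ((2 powi k) *\<^sub>R x - of_int_vec m)) x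
      = (if (e, int k, m) = (e', int k', m') then 1 else 0 :: real)"
      using assms e unfolding wavelet_family_def L2_orthonormal_basis_def E_def by blast
    then have "LINT x|lborel. (2 powr (real k * real CARD('n) / 2) * 2 powr (real k' * real CARD('n) / 2)) *
       (\<Psi> e (2 ^ k *\<^sub>R x - of_int_vec m) * \<Psi> e' (2 ^ k' *\<^sub>R x - of_int_vec m'))
       = (if e = e' \<and> k = k' \<and> m = m' then 1 else 0)"
      by (simp add: mult_ac)
    then have *: "(2 powr (real k * real CARD('n) / 2) * 2 powr (real k' * real CARD('n) / 2)) *
       (LINT x|lborel. \<Psi> e (2 ^ k *\<^sub>R x - of_int_vec m) * \<Psi> e' (2 ^ k' *\<^sub>R x - of_int_vec m'))
       = (if e = e' \<and> k = k' \<and> m = m' then 1 else 0)" by simp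
    have sq: "(2::real) powr (real k * real CARD('n) / 2) * 2 powr (real k * real CARD('n) / 2) = 2 ^ (k * CARD('n))"
      by (simp add: powr_add[symmetric] powr_realpow[symmetric])
    show "(LINT x|lborel. \<Psi> e (2 ^ k *\<^sub>R x - of_int_vec m) * \<Psi> e' (2 ^ k' *\<^sub>R x - of_int_vec m'))
       = (if e = e' \<and> k = k' \<and> m = m' then 1 / 2 ^ (k * CARD('n)) else 0)"
    proof (cases "e = e' \<and> k = k' \<and> m = m'")
      case True
      then have "2 ^ (k * CARD('n)) *
          (LINT x|lborel. \<Psi> e (2 ^ k *\<^sub>R x - of_int_vec m) * \<Psi> e' (2 ^ k' *\<^sub>R x - of_int_vec m')) = 1"
        using * sq by (metis (no_types, lifting))
      then show ?thesis unfolding if_P[OF True]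
        by (subst eq_divide_eq) (simp add: mult.commute)
    next
      case False
      then show ?thesis using * by auto
    qed
  qed
  then show ?thesis by blast
qed

text \<open>Periodisation truncated to a finite box of shifts. On bounded regions it agrees with
  \<open>periodized_wavelet\<close> once \<open>s\<close> is large, and as a finite sum on the whole
  space it makes measurability and integration elementary.\<close>

definition wavelet_sum ::
  "(nat \<Rightarrow> real ^ 'n::finite \<Rightarrow> real) \<Rightarrow> nat \<Rightarrow> nat \<Rightarrow> nat \<times> (int ^ 'n) \<Rightarrow> real ^ 'n \<Rightarrow> real" where
  "wavelet_sum \<Psi> s k = (\<lambda>(e, m) x.
    \<Sum>l\<in>int_box s. \<Psi> e (2 ^ k *\<^sub>R (x - of_int_vec l) - of_int_vec m))"

lemma finite_Lam [simp]: "finite (Lam k :: (nat \<times> (int ^ 'n::finite)) set)"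
  using card_vec_set(1)[of "\<lambda>_. {0..<2^k}"] by (auto simp: Lam_def)

lemma card_Lam: "card (Lam k :: (nat \<times> (int ^ 'n::finite)) set) = (2 ^ CARD('n) - 1) * 2 ^ (k * CARD('n))"
  using card_vec_set(2)[of "\<lambda>_::'n. {0..<2^k :: int}"]
  by (simp add: Lam_def card_cartesian_product power_mult nat_power_eq)

context lipschitz_wavelets
begin

lemma continuous_wavelet: "e < 2 ^ CARD('n) - 1 \<Longrightarrow> continuous_on S (\<Psi> e)"
proof (rule continuous_at_imp_continuous_on, rule ballI)
  fix x :: "real ^ 'n" assume e: "e < 2 ^ CARD('n) - 1"
  have "((\<lambda>y. A * norm (y - x)) \<longlongrightarrow> A * norm (x - x)) (at x)" by (intro tendsto_intros)
  then have "((\<lambda>y. \<Psi> e y - \<Psi> e x) \<longlongrightarrow> 0) (at x)"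
    by (intro Lim_null_comparison[of "\<lambda>y. \<Psi> e y - \<Psi> e x" "\<lambda>y. A * norm (y - x)"]) (use lip[OF e] in auto)
  then show "isCont (\<Psi> e) x" unfolding isCont_def using LIM_zero_cancel by blast
qed

lemma measurable_wavelet: "e < 2 ^ CARD('n) - 1 \<Longrightarrow> \<Psi> e \<in> borel_measurable borel"
  by (rule borel_measurable_continuous_onI[OF continuous_wavelet])

lemma measurable_wavelet_affine:
  "e < 2 ^ CARD('n) - 1 \<Longrightarrow> (\<lambda>x. \<Psi> e (2 ^ k *\<^sub>R (x - v) - w)) \<in> borel_measurable borel"
  by (rule measurable_compose[OF _ measurable_wavelet]) simp_all

lemma support_scaled:
  assumes e: "(e, m) \<in> Lam k" and nz: "\<Psi> e (2 ^ k *\<^sub>R x - of_int_vec m) \<noteq> 0"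
  shows "\<bar>x $ i - of_int (m $ i) / 2 ^ k\<bar> \<le> real R / 2 ^ k" "x \<in> real_box (real (R + 1))"
proof -
  have *: "\<bar>x $ i - of_int (m $ i) / 2 ^ k\<bar> \<le> real R / 2 ^ k" for i
  proof -
    have "\<bar>2 ^ k * x $ i - of_int (m $ i)\<bar> \<le> real R"
      using supp[OF _ nz] e by (auto simp: Lam_def real_box_def)
    then have "\<bar>2 ^ k * x $ i - of_int (m $ i)\<bar> / 2 ^ k \<le> real R / 2 ^ k" by (simp add: divide_right_mono)
    moreover have "\<bar>2 ^ k * x $ i - of_int (m $ i)\<bar> / 2 ^ k = \<bar>x $ i - of_int (m $ i) / 2 ^ k\<bar>"
      by (simp add: field_simps abs_if split: if_splits)
    ultimately show ?thesis by simp
  qed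
  then show "\<bar>x $ i - of_int (m $ i) / 2 ^ k\<bar> \<le> real R / 2 ^ k" .
  have "\<bar>x $ i\<bar> \<le> real (R + 1)" for i
  proof -
    have m: "0 \<le> m $ i" "m $ i < 2 ^ k" using e by (auto simp: Lam_def)
    then have "real_of_int (m $ i) \<le> 2 ^ k" by (metis less_imp_le of_int_le_iff of_int_numeral of_int_power)
    then have "0 \<le> real_of_int (m $ i) / 2 ^ k" "real_of_int (m $ i) / 2 ^ k \<le> 1" using m by auto
    moreover have "real R / 2 ^ k \<le> real R / 1" by (rule divide_left_mono) auto
    ultimately show ?thesis using *[of i] unfolding of_nat_add of_nat_1 div_by_1 by linarith
  qed
  then show "x \<in> real_box (real (R + 1))" by (simp add: real_box_def)
qed

text \<open>Origin of \<open>R + D + 1\<close>: the support of a scaled wavelet with index in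
  \<open>Lam k\<close> stays within R + 1 of the origin in every coordinate, and the point
  \<open>x\<close> itself within D.\<close>

lemma support_lattice:
  assumes e: "(e, m) \<in> Lam k" and nz: "\<Psi> e (2 ^ k *\<^sub>R (x - of_int_vec l) - of_int_vec m) \<noteq> 0"
    and x: "x \<in> real_box (real D)" and s: "R + D + 1 \<le> s"
  shows "l \<in> int_box s"
proof -
  have "\<bar>l $ i\<bar> \<le> int s" for i
  proof -
    have "\<bar>x $ i - of_int (l $ i)\<bar> \<le> real (R + 1)" "\<bar>x $ i\<bar> \<le> real D"
      using support_scaled(2)[OF e nz] x by (auto simp: real_box_def)
    then have "\<bar>real_of_int (l $ i)\<bar> \<le> real (R + 1) + real D" by linarith
    then show ?thesis using s by linarith
  qed
  then show ?thesis by (simp add: int_box_def)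
qed

lemma periodized_eq_sum:
  assumes \<mu>: "\<mu> \<in> Lam k" and x: "x \<in> real_box (real D)" and s: "R + D + 1 \<le> s"
  shows "periodized_wavelet \<Psi> k \<mu> x = wavelet_sum \<Psi> s k \<mu> x"
proof -
  obtain e m where em: "\<mu> = (e, m)" by (cases \<mu>)
  have "periodized_wavelet \<Psi> k \<mu> x =
      (\<Sum>\<^sub>\<infinity>l\<in>int_box s. \<Psi> e (2 ^ k *\<^sub>R (x - of_int_vec l) - of_int_vec m))"
    unfolding periodized_wavelet_def em prod.case
    by (rule infsum_cong_neutral) (use support_lattice[OF _ _ x s] \<mu> em in auto)
  then show ?thesis by (simp add: wavelet_sum_def em)
qed

lemma unit_cell_sub: "unit_cell \<subseteq> real_box (real 1)"
  by (auto simp: unit_cell_def real_box_def) (smt (verit))+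

text \<open>The box size \<open>R + 4\<close> corresponds to D = 3. It also covers points of the
  cell moved by a vector of \<open>int_box 1\<close>, and it exceeds the radius \<open>R + 3\<close>
  that occurs when increments are unfolded.\<close>

lemma periodized_eq_sum_cell:
  "\<mu> \<in> Lam k \<Longrightarrow> x \<in> unit_cell \<Longrightarrow> periodized_wavelet \<Psi> k \<mu> x = wavelet_sum \<Psi> (R + 4) k \<mu> x"
  using periodized_eq_sum[of \<mu> k x 1 "R + 4"] unit_cell_sub by auto

lemma periodized_periodic: "periodized_wavelet \<Psi> k \<mu> (x - of_int_vec v) = periodized_wavelet \<Psi> k \<mu> x"
proof -
  obtain e m where em: "\<mu> = (e, m)" by (cases \<mu>)
  have "bij_betw (\<lambda>l. l + v) UNIV UNIV" by (rule bij_betwI[where g = "\<lambda>l. l - v"]) auto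
  from infsum_reindex_bij_betw[OF this, of "\<lambda>l. \<Psi> e (2 ^ k *\<^sub>R (x - of_int_vec l) - of_int_vec m)"]
  show ?thesis
    by (simp add: periodized_wavelet_def em of_int_vec_add diff_diff_eq add.commute)
qed

lemma measurable_wavelet_sum: "\<mu> \<in> Lam k \<Longrightarrow> wavelet_sum \<Psi> s k \<mu> \<in> borel_measurable borel"
  unfolding wavelet_sum_def
  by (cases \<mu>) (auto simp: Lam_def intro!: borel_measurable_sum measurable_wavelet_affine)

lemma abs_wavelet_sum_le:
  fixes \<mu> :: "nat \<times> (int ^ 'n)"
  shows "\<mu> \<in> Lam k \<Longrightarrow> \<bar>wavelet_sum \<Psi> s k \<mu> x\<bar> \<le> A * real (card (int_box s :: (int ^ 'n) set))"
proof -
  assume "\<mu> \<in> Lam k"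
  then obtain e m where em: "\<mu> = (e, m)" "e < 2 ^ CARD('n) - 1" by (cases \<mu>) (auto simp: Lam_def)
  have "\<bar>wavelet_sum \<Psi> s k \<mu> x\<bar> \<le>
      (\<Sum>l\<in>int_box s. \<bar>\<Psi> e (2 ^ k *\<^sub>R (x - of_int_vec l) - of_int_vec m)\<bar>)"
    unfolding wavelet_sum_def em prod.case by (rule sum_abs)
  also have "\<dots> \<le> (\<Sum>l\<in>(int_box s :: (int ^ 'n) set). A)" by (rule sum_mono) (rule bnd[OF em(2)])
  finally show ?thesis by (simp add: mult.commute)
qed

lemma measurable_periodized: "\<mu> \<in> Lam k \<Longrightarrow> periodized_wavelet \<Psi> k \<mu> \<in> borel_measurable torus"
  using measurable_torus[OF measurable_wavelet_sum[of \<mu> k "R + 4"]]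
  by (subst measurable_cong[where g = "wavelet_sum \<Psi> (R + 4) k \<mu>"])
    (auto simp: space_torus periodized_eq_sum_cell)

lemma abs_periodized_le:
  "\<mu> \<in> Lam k \<Longrightarrow> x \<in> unit_cell \<Longrightarrow>
    \<bar>periodized_wavelet \<Psi> k \<mu> x\<bar> \<le> A * real (card (int_box (R + 4) :: (int ^ 'n) set))"
  by (simp add: periodized_eq_sum_cell abs_wavelet_sum_le)

end

lemma integrable_compact_support:
  fixes h :: "real ^ 'n::finite \<Rightarrow> real"
  assumes "h \<in> borel_measurable borel" "\<And>x. \<bar>h x\<bar> \<le> C" "\<And>x. h x \<noteq> 0 \<Longrightarrow> x \<in> real_box r"
  shows "integrable lborel h"
  by (rule integrableI_bounded_set[where A = "real_box r" and B = C])
    (use assms emeasure_real_box_finite in auto)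

text \<open>Translating by the lattice vector l before dilating by 2^k moves the index m by 2^k
  l.\<close>

definition lattice_scale :: "nat \<Rightarrow> int ^ 'n::finite \<Rightarrow> int ^ 'n" where
  "lattice_scale k l = (\<chi> i. 2 ^ k * l $ i)"

lemma of_int_vec_lattice_scale: "of_int_vec (lattice_scale k l) = 2 ^ k *\<^sub>R of_int_vec l"
  by (simp add: vec_eq_iff lattice_scale_def)

lemma scaled_shift:
  "2 ^ k *\<^sub>R (x - of_int_vec l) - of_int_vec m = 2 ^ k *\<^sub>R x - of_int_vec (m + lattice_scale k l)"
  by (simp add: of_int_vec_add of_int_vec_lattice_scale scaleR_diff_right)

text \<open>Division with remainder by 2^k in every coordinate: m is the remainder and l the
  quotient. Pairs (m, l) thus correspond injectively to translation indices on the whole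
  space.\<close>

lemma Lam_decomposition:
  assumes "(e, m) \<in> Lam k" "(e', m') \<in> Lam k" "m + lattice_scale k l = m' + lattice_scale k l'"
  shows "m = m' \<and> l = l'"
proof -
  have "m $ i = m' $ i \<and> l $ i = l' $ i" for i
  proof -
    have eq: "m $ i + 2 ^ k * l $ i = m' $ i + 2 ^ k * l' $ i"
      using assms(3) by (simp add: vec_eq_iff lattice_scale_def)
    have m: "0 \<le> m $ i" "m $ i < 2 ^ k" "0 \<le> m' $ i" "m' $ i < 2 ^ k" using assms by (auto simp: Lam_def)
    have "m $ i = (m $ i + 2 ^ k * l $ i) mod 2 ^ k" using m by simp
    also have "\<dots> = m' $ i" unfolding eq using m by simp
    finally show ?thesis using eq by simp
  qed
  then show ?thesis by (simp add: vec_eq_iff)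
qed

context lipschitz_wavelets
begin

lemma integrable_wavelet: "e < 2 ^ CARD('n) - 1 \<Longrightarrow> integrable lborel (\<Psi> e)"
  by (rule integrable_compact_support[OF measurable_wavelet bnd supp])

text \<open>Orthonormality excludes the zero function, and Lipschitz continuity moves a nonzero
  value to a nearby dyadic point. The point has to be dyadic because a wavelet of some finer scale
  will be centred there.\<close>

lemma wavelet_nonzero_dyadic:
  assumes e: "e < 2 ^ CARD('n) - 1"
  shows "\<exists>J m. \<Psi> e ((1 / 2 ^ J) *\<^sub>R of_int_vec m) \<noteq> 0"
proof -
  have "\<exists>x. \<Psi> e x \<noteq> 0"
  proof (rule ccontr)
    assume "\<not> ?thesis"
    then show False using orth[OF e e, of 0 0 0 0] by simp
  qed
  then obtain x where x: "\<Psi> e x \<noteq> 0" by blast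
  have "(\<lambda>J. A * (real CARD('n) * (1 / 2) ^ J)) \<longlonglongrightarrow> A * (real CARD('n) * 0)"
    by (intro tendsto_intros LIMSEQ_power_zero) simp
  then have "\<forall>\<^sub>F J in sequentially. A * (real CARD('n) * (1 / 2) ^ J) < \<bar>\<Psi> e x\<bar>"
    using x by (intro order_tendstoD) auto
  then obtain J where J: "A * (real CARD('n) * (1 / 2) ^ J) < \<bar>\<Psi> e x\<bar>"
    by (auto simp: eventually_sequentially)
  define m where "m = (\<chi> i. \<lfloor>2 ^ J * x $ i\<rfloor>)"
  have "x - (1 / 2 ^ J) *\<^sub>R of_int_vec m \<in> real_box ((1 / 2) ^ J)"
  proof -
    have "\<bar>x $ i - of_int \<lfloor>2 ^ J * x $ i\<rfloor> / 2 ^ J\<bar> \<le> (1 / 2) ^ J" for i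
    proof -
      have "\<bar>2 ^ J * x $ i - of_int \<lfloor>2 ^ J * x $ i\<rfloor>\<bar> \<le> 1" by linarith
      then have "\<bar>2 ^ J * x $ i - of_int \<lfloor>2 ^ J * x $ i\<rfloor>\<bar> / 2 ^ J \<le> 1 / 2 ^ J" by (simp add: divide_right_mono)
      moreover have "\<bar>2 ^ J * x $ i - of_int \<lfloor>2 ^ J * x $ i\<rfloor>\<bar> / 2 ^ J = \<bar>x $ i - of_int \<lfloor>2 ^ J * x $ i\<rfloor> / 2 ^ J\<bar>"
        by (subst abs_div_pos) (simp_all add: diff_divide_distrib)
      ultimately show ?thesis by (simp add: power_divide)
    qed
    then show ?thesis by (simp add: real_box_def m_def)
  qed
  from norm_le_card_sup[OF this]
  have "A * norm (x - (1 / 2 ^ J) *\<^sub>R of_int_vec m) \<le> A * (real CARD('n) * (1 / 2) ^ J)"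
    using A_pos by (intro mult_left_mono) auto
  with J lip[OF e, of x "(1 / 2 ^ J) *\<^sub>R of_int_vec m"]
  have "\<Psi> e ((1 / 2 ^ J) *\<^sub>R of_int_vec m) \<noteq> 0" by auto
  then show ?thesis by blast
qed

text \<open>A fine-scale wavelet centred at a dyadic point \<open>x\<^sub>0\<close> with \<open>\<Psi> e x\<^sub>0 \<noteq> 0\<close> sees
  \<open>\<Psi> e\<close> as nearly constant, so orthogonality of scales forces the mean to vanish.\<close>

lemma wavelet_mean_zero:
  assumes e: "e < 2 ^ CARD('n) - 1"
  shows "(LINT x|lborel. \<Psi> e x) = 0"
proof -
  note [measurable] = measurable_wavelet[OF e]
  obtain J m0 where nz: "\<Psi> e ((1 / 2 ^ J) *\<^sub>R of_int_vec m0) \<noteq> 0" using wavelet_nonzero_dyadic[OF e] by blast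
  define x0 :: "real ^ 'n" where "x0 = (1 / 2 ^ J) *\<^sub>R of_int_vec m0"
  define N where "N = (LINT x|lborel. \<bar>\<Psi> e x\<bar>)"
  have bound: "\<bar>\<Psi> e x0 * (LINT x|lborel. \<Psi> e x)\<bar> \<le> A * (real CARD('n) * real R) * N * (1 / 2) ^ (J + Suc j)" for j
  proof -
    \<comment> \<open>\<open>k\<close> is at least \<open>J\<close>, so 2^k times \<open>x0\<close>
      is a lattice vector and hence the index of a wavelet; it is also positive, so this wavelet and
      the one of scale 0 are orthogonal.\<close>
    define k where "k = J + Suc j"
    define m where "m = lattice_scale (Suc j) m0"
    have km: "of_int_vec m = 2 ^ k *\<^sub>R x0"
      by (simp add: m_def k_def x0_def of_int_vec_lattice_scale power_add)
    let ?h = "\<lambda>x. \<Psi> e x * \<Psi> e (2 ^ k *\<^sub>R x - of_int_vec m)"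
    have "(LINT x|lborel. ?h x) = 0"
      using orth[OF e e, of 0 0 k m] by (simp add: k_def)
    then have "(LINT u|lborel. ?h (x0 + (1 / 2 ^ k) *\<^sub>R u)) = 0"
      by (subst integral_lborel_affine) auto
    then have z: "(LINT u|lborel. \<Psi> e (x0 + (1 / 2 ^ k) *\<^sub>R u) * \<Psi> e u) = 0"
      by (simp add: km scaleR_add_right)
    have i1: "integrable lborel (\<lambda>u. \<Psi> e (x0 + (1 / 2 ^ k) *\<^sub>R u) * \<Psi> e u)"
    proof (rule integrable_compact_support[where C = "A * A"])
      show "\<bar>\<Psi> e (x0 + (1 / 2 ^ k) *\<^sub>R x) * \<Psi> e x\<bar> \<le> A * A" for x
        using A_pos bnd[OF e] by (simp add: abs_mult mult_mono)
      show "x \<in> real_box (real R)" if "\<Psi> e (x0 + (1 / 2 ^ k) *\<^sub>R x) * \<Psi> e x \<noteq> 0" for x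
        using that supp[OF e] by auto
    qed measurable
    have i2: "integrable lborel (\<lambda>u. \<Psi> e x0 * \<Psi> e u)" using integrable_wavelet[OF e] by simp
    have "\<Psi> e x0 * (LINT x|lborel. \<Psi> e x) = (LINT u|lborel. \<Psi> e x0 * \<Psi> e u - \<Psi> e (x0 + (1 / 2 ^ k) *\<^sub>R u) * \<Psi> e u)"
      using z by (subst Bochner_Integration.integral_diff[OF i2 i1]) simp
    also have "\<bar>\<dots>\<bar> \<le> (LINT u|lborel. \<bar>\<Psi> e x0 * \<Psi> e u - \<Psi> e (x0 + (1 / 2 ^ k) *\<^sub>R u) * \<Psi> e u\<bar>)"
      by (rule integral_abs_bound)
    also have "\<dots> \<le> (LINT u|lborel. A * (real CARD('n) * real R) * (1 / 2) ^ k * \<bar>\<Psi> e u\<bar>)"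
    proof (rule integral_mono)
      show "integrable lborel (\<lambda>u. \<bar>\<Psi> e x0 * \<Psi> e u - \<Psi> e (x0 + (1 / 2 ^ k) *\<^sub>R u) * \<Psi> e u\<bar>)"
        using i1 i2 by auto
      show "integrable lborel (\<lambda>u. A * (real CARD('n) * real R) * (1 / 2) ^ k * \<bar>\<Psi> e u\<bar>)"
        using integrable_wavelet[OF e] by auto
      fix u
      show "\<bar>\<Psi> e x0 * \<Psi> e u - \<Psi> e (x0 + (1 / 2 ^ k) *\<^sub>R u) * \<Psi> e u\<bar> \<le> A * (real CARD('n) * real R) * (1 / 2) ^ k * \<bar>\<Psi> e u\<bar>"
      proof (cases "\<Psi> e u = 0")
        case False
        have "norm u \<le> real CARD('n) * real R" using norm_le_card_sup[OF supp[OF e False]] .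
        then have "A * norm ((1 / 2 ^ k) *\<^sub>R u) \<le> A * (real CARD('n) * real R) * (1 / 2) ^ k"
          using A_pos by (simp add: power_divide field_simps)
        moreover have "\<bar>\<Psi> e x0 - \<Psi> e (x0 + (1 / 2 ^ k) *\<^sub>R u)\<bar> \<le> A * norm ((1 / 2 ^ k) *\<^sub>R u)"
          using lip[OF e, of x0 "x0 + (1 / 2 ^ k) *\<^sub>R u"] by simp
        ultimately have "\<bar>\<Psi> e x0 - \<Psi> e (x0 + (1 / 2 ^ k) *\<^sub>R u)\<bar> * \<bar>\<Psi> e u\<bar> \<le> A * (real CARD('n) * real R) * (1 / 2) ^ k * \<bar>\<Psi> e u\<bar>"
          by (intro mult_right_mono) auto
        then show ?thesis by (simp add: abs_mult[symmetric] left_diff_distrib)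
      qed simp
    qed
    finally show ?thesis by (simp add: N_def k_def mult_ac)
  qed
  have "(\<lambda>j. A * (real CARD('n) * real R) * N * (1 / 2) ^ (J + Suc j)) \<longlonglongrightarrow> A * (real CARD('n) * real R) * N * 0"
    by (intro tendsto_intros LIMSEQ_power_zero[THEN filterlim_compose])
      (auto simp: filterlim_sequentially_Suc intro!: filterlim_subseq simp: strict_mono_def)
  then have "\<bar>\<Psi> e x0 * (LINT x|lborel. \<Psi> e x)\<bar> \<le> A * (real CARD('n) * real R) * N * 0"
    by (rule LIMSEQ_le_const) (use bound in blast)
  then show ?thesis using nz by (simp add: x0_def)
qed

lemma periodized_integral_zero:
  assumes \<mu>: "\<mu> \<in> Lam k"
  shows "(LINT x|torus. periodized_wavelet \<Psi> k \<mu> x) = 0"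
proof -
  obtain e m where em: "\<mu> = (e, m)" by (cases \<mu>)
  have e: "e < 2 ^ CARD('n) - 1" and emL: "(e, m) \<in> Lam k" using \<mu> em by (auto simp: Lam_def)
  note [measurable] = measurable_wavelet[OF e]
  let ?h = "\<lambda>x. \<Psi> e (2 ^ k *\<^sub>R x - of_int_vec m)"
  have h: "integrable lborel ?h"
    by (rule integrable_compact_support[where C = A, OF _ bnd[OF e] support_scaled(2)[OF emL]]) measurable
  have "(LINT x|torus. periodized_wavelet \<Psi> k \<mu> x) =
      (LINT x|torus. (\<Sum>l\<in>int_box (R + 4). ?h (x - of_int_vec l)))"
    by (rule Bochner_Integration.integral_cong[OF refl])
      (use \<mu> in \<open>auto simp: space_torus periodized_eq_sum_cell wavelet_sum_def em\<close>)
  also have "\<dots> = (LINT x|lborel. ?h x)"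
    by (rule integral_unfold[OF h support_scaled(2)[OF emL]]) auto
  also have "\<dots> = (LINT x|lborel. \<Psi> e (- of_int_vec m + 2 ^ k *\<^sub>R x))" by (simp add: uminus_add_conv_diff)
  also have "\<dots> = 0" by (subst integral_lborel_affine) (auto simp: wavelet_mean_zero[OF e])
  finally show ?thesis .
qed

text \<open>Only the first factor is unfolded: the torus integral becomes an integral over the whole
  space of one wavelet against the periodic second factor. On the support of the first, the second
  is a finite sum of translates with indices \<open>m' + lattice_scale k' l\<close>, and
  orthogonality on the whole space leaves at most the term l = 0.\<close>

lemma periodized_orthogonal:
  assumes \<mu>: "\<mu> \<in> Lam k" and \<nu>: "\<nu> \<in> Lam k'"
  shows "(LINT x|torus. periodized_wavelet \<Psi> k \<mu> x * periodized_wavelet \<Psi> k' \<nu> x) =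
    (if k = k' \<and> \<mu> = \<nu> then 1 / 2 ^ (k * CARD('n)) else 0)"
proof -
  obtain e m where em: "\<mu> = (e, m)" by (cases \<mu>)
  have e: "e < 2 ^ CARD('n) - 1" and emL: "(e, m) \<in> Lam k" using \<mu> em by (auto simp: Lam_def)
  obtain e' m' where em': "\<nu> = (e', m')" by (cases \<nu>)
  have e': "e' < 2 ^ CARD('n) - 1" and emL': "(e', m') \<in> Lam k'" using \<nu> em' by (auto simp: Lam_def)
  note [measurable] = measurable_wavelet[OF e] measurable_wavelet[OF e'] measurable_wavelet_sum[OF \<nu>]
  let ?g = "\<lambda>x. \<Psi> e (2 ^ k *\<^sub>R x - of_int_vec m)"
  \<comment> \<open>\<open>R + D + 1\<close> with D = R + 1, the size of the region that contains
    the support of \<open>?g\<close>.\<close>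
  let ?s = "2 * R + 2"
  let ?h = "\<lambda>x. ?g x * wavelet_sum \<Psi> ?s k' \<nu> x"
  have supph: "x \<in> real_box (real (R + 1))" if "?h x \<noteq> 0" for x
    using that by (intro support_scaled(2)[OF emL]) auto
  have h: "integrable lborel ?h"
  proof (rule integrable_compact_support)
    show "\<bar>?h x\<bar> \<le> A * (A * real (card (int_box ?s :: (int ^ 'n) set)))" for x
      unfolding abs_mult using A_pos by (intro mult_mono bnd[OF e] abs_wavelet_sum_le[OF \<nu>]) auto
  qed (use supph in auto)
  have hx: "?h (x - of_int_vec l) = ?g (x - of_int_vec l) * periodized_wavelet \<Psi> k' \<nu> x" for x l
  proof (cases "?g (x - of_int_vec l) = 0")
    case False
    have "periodized_wavelet \<Psi> k' \<nu> (x - of_int_vec l) = wavelet_sum \<Psi> ?s k' \<nu> (x - of_int_vec l)"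
      by (rule periodized_eq_sum[OF \<nu> support_scaled(2)[OF emL False]]) simp
    then show ?thesis by (simp add: periodized_periodic)
  qed simp
  have "(LINT x|torus. periodized_wavelet \<Psi> k \<mu> x * periodized_wavelet \<Psi> k' \<nu> x) =
      (LINT x|torus. (\<Sum>l\<in>int_box (R + 4). ?h (x - of_int_vec l)))"
    unfolding hx sum_distrib_right[symmetric]
    by (rule Bochner_Integration.integral_cong[OF refl])
      (use \<mu> in \<open>auto simp: space_torus periodized_eq_sum_cell wavelet_sum_def em\<close>)
  also have "\<dots> = (LINT x|lborel. ?h x)"
    by (rule integral_unfold[OF h supph]) auto
  also have "\<dots> = (LINT x|lborel. (\<Sum>l\<in>int_box ?s. ?g x * \<Psi> e' (2 ^ k' *\<^sub>R x - of_int_vec (m' + lattice_scale k' l))))"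
    by (simp add: wavelet_sum_def em' scaled_shift sum_distrib_left)
  also have "\<dots> = (\<Sum>l\<in>int_box ?s. LINT x|lborel. ?g x * \<Psi> e' (2 ^ k' *\<^sub>R x - of_int_vec (m' + lattice_scale k' l)))"
  proof (rule Bochner_Integration.integral_sum, rule integrable_compact_support)
    show "\<bar>?g x * \<Psi> e' (2 ^ k' *\<^sub>R x - of_int_vec (m' + lattice_scale k' l))\<bar> \<le> A * A" for x l
      unfolding abs_mult using A_pos by (intro mult_mono bnd[OF e] bnd[OF e']) auto
    show "x \<in> real_box (real (R + 1))" if "?g x * \<Psi> e' (2 ^ k' *\<^sub>R x - of_int_vec (m' + lattice_scale k' l)) \<noteq> 0" for x l
      using that by (intro support_scaled(2)[OF emL]) auto
  qed measurable
  also have "\<dots> = (\<Sum>l\<in>int_box ?s. if e = e' \<and> k = k' \<and> m = m' + lattice_scale k' l then 1 / 2 ^ (k * CARD('n)) else 0)"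
    by (simp add: orth[OF e e'])
  also have "\<dots> = (\<Sum>l\<in>(int_box ?s :: (int ^ 'n) set). if l = 0 then (if k = k' \<and> \<mu> = \<nu> then 1 / 2 ^ (k * CARD('n)) else 0) else 0)"
  proof (rule sum.cong[OF refl])
    fix l :: "int ^ 'n"
    have eq: "m = m' + lattice_scale k' l \<longleftrightarrow> m = m' \<and> l = 0" if "k = k'"
    proof -
      have 0: "lattice_scale k' 0 = (0 :: int ^ 'n)" by (simp add: lattice_scale_def vec_eq_iff)
      have "m = m' \<and> 0 = l" if "m = m' + lattice_scale k' l"
        using Lam_decomposition[of e m k' e' m' 0 l] emL emL' \<open>k = k'\<close> that 0 by simp
      moreover have "m' = m' + lattice_scale k' 0" unfolding 0 by simp
      ultimately show ?thesis by blast
    qed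
    show "(if e = e' \<and> k = k' \<and> m = m' + lattice_scale k' l then 1 / 2 ^ (k * CARD('n)) else 0) =
       (if l = 0 then (if k = k' \<and> \<mu> = \<nu> then 1 / 2 ^ (k * CARD('n)) else 0) else (0::real))"
    proof (cases "k = k'")
      case True
      show ?thesis unfolding eq[OF True] em em' by auto
    qed simp
  qed
  also have "\<dots> = (if k = k' \<and> \<mu> = \<nu> then 1 / 2 ^ (k * CARD('n)) else 0)"
  proof -
    have "(0 :: int ^ 'n) \<in> int_box ?s" by (simp add: int_box_def)
    then show ?thesis by (subst sum.delta) simp_all
  qed
  finally show ?thesis .
qed

text \<open>At a fixed point, a nonzero term with indices m and l puts the lattice point
  \<open>m + lattice_scale k l\<close> within R of 2^k x or of 2^k x + v in every coordinate, and
  this lattice point together with e determines the term. Two neighbourhoods, hence the factor 2,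
  are allowed because \<Phi> may be an increment of a wavelet.\<close>

lemma overlap_card:
  fixes x v :: "real ^ 'n" and \<Phi> :: "nat \<Rightarrow> real ^ 'n \<Rightarrow> real"
  assumes \<Phi>: "\<And>e u. e < 2 ^ CARD('n) - 1 \<Longrightarrow> \<Phi> e u \<noteq> 0 \<Longrightarrow> u \<in> real_box (real R) \<or> u + v \<in> real_box (real R)"
  shows "card {i \<in> Lam k \<times> int_box s. c (fst i) * \<Phi> (fst (fst i)) (2 ^ k *\<^sub>R (x - of_int_vec (snd i)) - of_int_vec (snd (fst i))) \<noteq> 0}
    \<le> (2 ^ CARD('n) - 1) * (2 * (2 * R + 1) ^ CARD('n))"
    (is "card ?S \<le> _")
proof -
  let ?N = "\<lambda>z. {l :: int ^ 'n. z - of_int_vec l \<in> real_box (real R)}"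
  let ?T = "{..<2 ^ CARD('n) - 1 :: nat} \<times> (?N (2 ^ k *\<^sub>R x) \<union> ?N (2 ^ k *\<^sub>R x + v))"
  let ?f = "\<lambda>i :: (nat \<times> (int ^ 'n)) \<times> (int ^ 'n). (fst (fst i), snd (fst i) + lattice_scale k (snd i))"
  have inj: "inj_on ?f ?S"
  proof (rule inj_onI)
    fix i j assume i: "i \<in> ?S" and j: "j \<in> ?S" and eq: "?f i = ?f j"
    obtain e m l e' m' l' where ij: "i = ((e, m), l)" "j = ((e', m'), l')" by (metis prod.collapse)
    show "i = j" using Lam_decomposition[of e m k e' m' l l'] i j eq by (auto simp: ij)
  qed
  have sub: "?f ` ?S \<subseteq> ?T"
  proof (rule image_subsetI)
    fix i assume i: "i \<in> ?S"
    obtain e m l where il: "i = ((e, m), l)" by (metis prod.collapse)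
    have e: "e < 2 ^ CARD('n) - 1" using i by (auto simp: il Lam_def)
    have "\<Phi> e (2 ^ k *\<^sub>R x - of_int_vec (m + lattice_scale k l)) \<noteq> 0" using i by (simp add: il scaled_shift)
    from \<Phi>[OF e this] show "?f i \<in> ?T" using e by (auto simp: il algebra_simps)
  qed
  have finT: "finite ?T" using card_lattice_near(1) by auto
  have "card ?S \<le> card ?T" by (rule card_inj_on_le[OF inj sub finT])
  also have "\<dots> \<le> (2 ^ CARD('n) - 1) * (card (?N (2 ^ k *\<^sub>R x)) + card (?N (2 ^ k *\<^sub>R x + v)))"
    unfolding card_cartesian_product card_lessThan by (intro mult_left_mono card_Un_le) auto
  also have "\<dots> \<le> (2 ^ CARD('n) - 1) * ((2 * R + 1) ^ CARD('n) + (2 * R + 1) ^ CARD('n))"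
    by (intro mult_left_mono add_mono card_lattice_near(2)) auto
  finally show ?thesis by (simp add: mult_2)
qed

definition overlap :: real where
  "overlap = real ((2 ^ CARD('n) - 1) * (2 * (2 * R + 1) ^ CARD('n)))"

text \<open>Bounded overlap lets the p-th power pass inside the sum at each point; every term is
  then unfolded and rescaled, which produces the factor 2^(-kn). The general profile \<Phi> covers
  wavelets (\<open>v = 0\<close>) and their increments (\<open>v\<close> equal to 2^k h) at
  once.\<close>

lemma nn_integral_lattice_sum_le:
  fixes v :: "real ^ 'n" and \<Phi> :: "nat \<Rightarrow> real ^ 'n \<Rightarrow> real" and c :: "nat \<times> (int ^ 'n) \<Rightarrow> real"
  assumes \<Phi>: "\<And>e u. e < 2 ^ CARD('n) - 1 \<Longrightarrow> \<Phi> e u \<noteq> 0 \<Longrightarrow> u \<in> real_box (real R) \<or> u + v \<in> real_box (real R)"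
    and v: "v \<in> real_box (2 * 2 ^ k)"
    and meas: "\<And>e. e < 2 ^ CARD('n) - 1 \<Longrightarrow> \<Phi> e \<in> borel_measurable borel"
    and p: "0 < p"
    and B: "\<And>e. e < 2 ^ CARD('n) - 1 \<Longrightarrow> (\<integral>\<^sup>+u. ennreal (\<bar>\<Phi> e u\<bar> powr p) \<partial>lborel) \<le> ennreal B" "0 \<le> B"
  shows "(\<integral>\<^sup>+x. ennreal (\<bar>\<Sum>\<mu>\<in>Lam k. c \<mu> * (\<Sum>l\<in>int_box (R + 4).
      \<Phi> (fst \<mu>) (2 ^ k *\<^sub>R (x - of_int_vec l) - of_int_vec (snd \<mu>)))\<bar> powr p) \<partial>torus)
    \<le> ennreal (overlap powr p * B * ((\<Sum>\<mu>\<in>Lam k. \<bar>c \<mu>\<bar> powr p) / 2 ^ (k * CARD('n))))"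
proof -
  let ?a = "\<lambda>x i. c (fst i) * \<Phi> (fst (fst i)) (2 ^ k *\<^sub>R (x - of_int_vec (snd i)) - of_int_vec (snd (fst i)))"
  let ?J = "Lam k \<times> (int_box (R + 4) :: (int ^ 'n) set)"
  let ?H = "\<lambda>\<mu> x. ennreal (\<bar>c \<mu> * \<Phi> (fst \<mu>) (2 ^ k *\<^sub>R x - of_int_vec (snd \<mu>))\<bar> powr p)"
  have pw: "ennreal (\<bar>\<Sum>\<mu>\<in>Lam k. c \<mu> * (\<Sum>l\<in>int_box (R + 4).
      \<Phi> (fst \<mu>) (2 ^ k *\<^sub>R (x - of_int_vec l) - of_int_vec (snd \<mu>)))\<bar> powr p)
    \<le> ennreal (overlap powr p) * (\<Sum>\<mu>\<in>Lam k. \<Sum>l\<in>int_box (R + 4). ?H \<mu> (x - of_int_vec l))" for x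
  proof -
    have "(\<Sum>\<mu>\<in>Lam k. c \<mu> * (\<Sum>l\<in>int_box (R + 4).
      \<Phi> (fst \<mu>) (2 ^ k *\<^sub>R (x - of_int_vec l) - of_int_vec (snd \<mu>)))) = (\<Sum>i\<in>?J. ?a x i)"
      by (simp add: sum_distrib_left sum.cartesian_product case_prod_beta)
    moreover have "\<bar>\<Sum>i\<in>?J. ?a x i\<bar> powr p \<le> overlap powr p * (\<Sum>i\<in>?J. \<bar>?a x i\<bar> powr p)"
      unfolding overlap_def by (rule powr_abs_sum_le[OF _ overlap_card[where v = v, OF \<Phi>] p]) auto
    moreover have "(\<Sum>i\<in>?J. \<bar>?a x i\<bar> powr p) = (\<Sum>\<mu>\<in>Lam k. \<Sum>l\<in>int_box (R + 4).
        \<bar>c \<mu> * \<Phi> (fst \<mu>) (2 ^ k *\<^sub>R (x - of_int_vec l) - of_int_vec (snd \<mu>))\<bar> powr p)"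
      by (simp add: sum.cartesian_product case_prod_beta)
    ultimately show ?thesis
      by (simp add: ennreal_mult[symmetric] sum_nonneg ennreal_leI)
  qed
  have Hm: "?H \<mu> \<in> borel_measurable borel" if "\<mu> \<in> Lam k" for \<mu>
  proof -
    have [measurable]: "\<Phi> (fst \<mu>) \<in> borel_measurable borel" using that by (intro meas) (auto simp: Lam_def)
    show ?thesis by measurable
  qed
  have HS: "(\<Sum>l\<in>int_box (R + 4). \<integral>\<^sup>+x. ?H \<mu> (x - of_int_vec l) \<partial>torus) \<le> ennreal (B * (\<bar>c \<mu>\<bar> powr p / 2 ^ (k * CARD('n))))"
    if \<mu>: "\<mu> \<in> Lam k" for \<mu>
  proof -
    obtain e m where em: "\<mu> = (e, m)" by (cases \<mu>)
    have e: "e < 2 ^ CARD('n) - 1" and emL: "(e, m) \<in> Lam k" using \<mu> em by (auto simp: Lam_def)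
    note [measurable] = meas[OF e]
    have "(\<Sum>l\<in>int_box (R + 4). \<integral>\<^sup>+x. ?H \<mu> (x - of_int_vec l) \<partial>torus) = (\<integral>\<^sup>+x. ?H \<mu> x \<partial>lborel)"
    proof (rule nn_integral_unfold[OF Hm[OF \<mu>]])
      show "R + 3 < R + 4" by simp
      fix x assume "?H \<mu> x \<noteq> 0"
      then have nz: "\<Phi> e (2 ^ k *\<^sub>R x - of_int_vec m) \<noteq> 0" by (auto simp: em)
      \<comment> \<open>R <= 2^k R from the support, 2 * 2^k from the shift \<open>v\<close> and 2^k
        from the index m add up to 2^k (R + 3).\<close>
      have "\<bar>x $ i\<bar> \<le> real (R + 3)" for i
      proof -
        have "\<bar>2 ^ k * x $ i - of_int (m $ i)\<bar> \<le> real R \<or> \<bar>2 ^ k * x $ i - of_int (m $ i) + v $ i\<bar> \<le> real R"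
          using \<Phi>[OF e nz] by (auto simp: real_box_def)
        moreover have "\<bar>v $ i\<bar> \<le> 2 * 2 ^ k" using v by (simp add: real_box_def)
        moreover have "0 \<le> m $ i" "m $ i < 2 ^ k" using emL by (auto simp: Lam_def)
        then have "0 \<le> real_of_int (m $ i)" "real_of_int (m $ i) \<le> 2 ^ k"
          by (auto intro: less_imp_le simp flip: of_int_le_iff)
        moreover have "1 * real R \<le> 2 ^ k * real R" by (intro mult_right_mono) auto
        ultimately have "\<bar>2 ^ k * x $ i\<bar> \<le> 2 ^ k * real R + 3 * 2 ^ k" by linarith
        then have "2 ^ k * \<bar>x $ i\<bar> \<le> 2 ^ k * (real R + 3)" by (simp add: abs_mult algebra_simps)
        then show ?thesis by simp
      qed
      then show "x \<in> real_box (real (R + 3))" by (simp add: real_box_def)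
    qed
    also have "\<dots> = (\<integral>\<^sup>+x. ennreal (\<bar>c \<mu> * \<Phi> e (- of_int_vec m + 2 ^ k *\<^sub>R x)\<bar> powr p) \<partial>lborel)"
      by (simp add: em)
    also have "\<dots> = ennreal (1 / (2 ^ k) ^ CARD('n)) * (\<integral>\<^sup>+x. ennreal (\<bar>c \<mu> * \<Phi> e x\<bar> powr p) \<partial>lborel)"
      by (subst nn_integral_lborel_affine[where h = "\<lambda>x. ennreal (\<bar>c \<mu> * \<Phi> e x\<bar> powr p)"]) auto
    also have "(\<integral>\<^sup>+x. ennreal (\<bar>c \<mu> * \<Phi> e x\<bar> powr p) \<partial>lborel) = ennreal (\<bar>c \<mu>\<bar> powr p) * (\<integral>\<^sup>+x. ennreal (\<bar>\<Phi> e x\<bar> powr p) \<partial>lborel)"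
      by (subst nn_integral_cmult[symmetric]) (auto simp: abs_mult powr_mult ennreal_mult)
    also have "ennreal (1 / (2 ^ k) ^ CARD('n)) * (ennreal (\<bar>c \<mu>\<bar> powr p) * (\<integral>\<^sup>+x. ennreal (\<bar>\<Phi> e x\<bar> powr p) \<partial>lborel))
        \<le> ennreal (1 / (2 ^ k) ^ CARD('n)) * (ennreal (\<bar>c \<mu>\<bar> powr p) * ennreal B)"
      by (intro mult_left_mono B(1)[OF e]) auto
    also have "\<dots> = ennreal (B * (\<bar>c \<mu>\<bar> powr p / 2 ^ (k * CARD('n))))"
      using B(2) by (simp add: ennreal_mult[symmetric] power_mult mult.commute)
    finally show ?thesis .
  qed
  have Hm': "(\<lambda>x. ?H \<mu> (x - of_int_vec l)) \<in> borel_measurable torus" if "\<mu> \<in> Lam k" for \<mu> l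
    by (rule measurable_torus, rule measurable_compose[OF _ Hm[OF that]]) simp
  have "(\<integral>\<^sup>+x. ennreal (\<bar>\<Sum>\<mu>\<in>Lam k. c \<mu> * (\<Sum>l\<in>int_box (R + 4).
      \<Phi> (fst \<mu>) (2 ^ k *\<^sub>R (x - of_int_vec l) - of_int_vec (snd \<mu>)))\<bar> powr p) \<partial>torus)
    \<le> (\<integral>\<^sup>+x. ennreal (overlap powr p) * (\<Sum>\<mu>\<in>Lam k. \<Sum>l\<in>int_box (R + 4). ?H \<mu> (x - of_int_vec l)) \<partial>torus)"
    by (rule nn_integral_mono) (rule pw)
  also have "\<dots> = ennreal (overlap powr p) * (\<integral>\<^sup>+x. (\<Sum>\<mu>\<in>Lam k. \<Sum>l\<in>int_box (R + 4). ?H \<mu> (x - of_int_vec l)) \<partial>torus)"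
    by (intro nn_integral_cmult borel_measurable_sum Hm')
  also have "(\<integral>\<^sup>+x. (\<Sum>\<mu>\<in>Lam k. \<Sum>l\<in>int_box (R + 4). ?H \<mu> (x - of_int_vec l)) \<partial>torus) =
     (\<Sum>\<mu>\<in>Lam k. \<Sum>l\<in>int_box (R + 4). \<integral>\<^sup>+x. ?H \<mu> (x - of_int_vec l) \<partial>torus)"
    by (subst nn_integral_sum, intro borel_measurable_sum Hm', assumption)
      (intro sum.cong refl nn_integral_sum Hm', assumption)
  also have "\<dots> \<le> (\<Sum>\<mu>\<in>Lam k. ennreal (B * (\<bar>c \<mu>\<bar> powr p / 2 ^ (k * CARD('n)))))"
    by (rule sum_mono) (rule HS)
  also have "\<dots> = ennreal (B * ((\<Sum>\<mu>\<in>Lam k. \<bar>c \<mu>\<bar> powr p) / 2 ^ (k * CARD('n))))"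
    using B(2) by (subst sum_ennreal) (auto simp: sum_distrib_left sum_divide_distrib)
  finally show ?thesis
    using B(2) by (simp add: ennreal_mult[symmetric] mult.assoc sum_nonneg divide_nonneg_nonneg mult_left_mono)
qed


section \<open>Sobolev integrals of wavelet series\<close>

text \<open>The block of scale k built from truncated periodisations: a Borel function on the whole
  space that agrees with the periodic block on \<open>real_box 3\<close> and can be evaluated at
  points outside the cell.\<close>

definition synthesis :: "nat \<Rightarrow> (nat \<times> (int ^ 'n) \<Rightarrow> real) \<Rightarrow> real ^ 'n \<Rightarrow> real" where
  "synthesis k c x = (\<Sum>\<mu>\<in>Lam k. c \<mu> * wavelet_sum \<Psi> (R + 4) k \<mu> x)"

lemma synthesis_eq:
  assumes "x \<in> real_box 3"
  shows "(\<Sum>\<mu>\<in>Lam k. c \<mu> * periodized_wavelet \<Psi> k \<mu> x) = synthesis k c x"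
  unfolding synthesis_def
  by (rule sum.cong[OF refl]) (use assms periodized_eq_sum[of _ k x 3 "R + 4"] in auto)

lemma measurable_synthesis: "synthesis k c \<in> borel_measurable borel"
  unfolding synthesis_def
  by (intro borel_measurable_sum borel_measurable_times measurable_wavelet_sum) auto

text \<open>Interpolation between the Lipschitz bound for |v| <= 1 and the sup bound for |v| > 1:
  both are at most \<open>2 * A * norm v powr \<gamma>\<close> when 0 < \<gamma> <= 1. The increment
  lives on the support box and a shift of it, hence the factor 2 in front of the volume.\<close>

lemma nn_integral_increment_powr_le:
  assumes p: "0 < p" and \<gamma>: "0 < \<gamma>" "\<gamma> \<le> 1" and e: "e < 2 ^ CARD('n) - 1"
  shows "(\<integral>\<^sup>+u. ennreal (\<bar>\<Psi> e (u + v) - \<Psi> e u\<bar> powr p) \<partial>lborel)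
    \<le> ennreal ((2 * A) powr p * (2 * measure lborel (real_box (real R) :: (real ^ 'n) set)) * norm v powr (\<gamma> * p))"
proof -
  note [measurable] = measurable_wavelet[OF e]
  let ?S = "real_box (real R) :: (real ^ 'n) set"
  have emS: "emeasure lborel ?S = ennreal (measure lborel ?S)"
  proof -
    have "emeasure lborel ?S < \<infinity>" by (rule emeasure_real_box_finite)
    then show ?thesis by (intro emeasure_eq_ennreal_measure) auto
  qed
  have pw: "\<bar>\<Psi> e (u + v) - \<Psi> e u\<bar> \<le> 2 * A * norm v powr \<gamma>" for u
  proof (cases "norm v \<le> 1")
    case True
    have "\<bar>\<Psi> e (u + v) - \<Psi> e u\<bar> \<le> A * norm v" using lip[OF e, of "u + v" u] by simp
    also have "norm v \<le> norm v powr \<gamma>"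
      using True \<gamma> powr_mono'[of \<gamma> 1 "norm v"] by (cases "v = 0") auto
    then have "A * norm v \<le> A * norm v powr \<gamma>" using A_pos by simp
    also have "\<dots> \<le> 2 * A * norm v powr \<gamma>" using A_pos by simp
    finally show ?thesis .
  next
    case False
    have "\<bar>\<Psi> e (u + v) - \<Psi> e u\<bar> \<le> 2 * A * 1" using bnd[OF e, of "u + v"] bnd[OF e, of u] by linarith
    also have "\<dots> \<le> 2 * A * norm v powr \<gamma>"
      using False \<gamma> A_pos by (intro mult_left_mono ge_one_powr_ge_zero) auto
    finally show ?thesis .
  qed
  have "ennreal (\<bar>\<Psi> e (u + v) - \<Psi> e u\<bar> powr p) \<le>
      ennreal ((2 * A) powr p * norm v powr (\<gamma> * p)) * (indicator ?S u + indicator ?S (v + u))" for u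
  proof (cases "\<Psi> e (u + v) = 0 \<and> \<Psi> e u = 0")
    case False
    have "\<bar>\<Psi> e (u + v) - \<Psi> e u\<bar> powr p \<le> (2 * A * norm v powr \<gamma>) powr p"
      using pw p by (intro powr_mono2) auto
    also have "\<dots> = (2 * A) powr p * norm v powr (\<gamma> * p)"
      using A_pos by (subst powr_mult) (auto simp: powr_powr)
    finally have "ennreal (\<bar>\<Psi> e (u + v) - \<Psi> e u\<bar> powr p) \<le> ennreal ((2 * A) powr p * norm v powr (\<gamma> * p)) * 1"
      by (simp add: ennreal_leI)
    also have "\<dots> \<le> ennreal ((2 * A) powr p * norm v powr (\<gamma> * p)) * (indicator ?S u + indicator ?S (v + u))"
      using False supp[OF e, of u] supp[OF e, of "u + v"]
      by (intro mult_left_mono) (auto simp: indicator_def add.commute)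
    finally show ?thesis .
  qed auto
  then have "(\<integral>\<^sup>+u. ennreal (\<bar>\<Psi> e (u + v) - \<Psi> e u\<bar> powr p) \<partial>lborel) \<le>
    (\<integral>\<^sup>+u. ennreal ((2 * A) powr p * norm v powr (\<gamma> * p)) * (indicator ?S u + indicator ?S (v + u)) \<partial>lborel)"
    by (intro nn_integral_mono)
  also have "\<dots> = ennreal ((2 * A) powr p * norm v powr (\<gamma> * p)) * ((\<integral>\<^sup>+u. indicator ?S u \<partial>lborel) + (\<integral>\<^sup>+u. indicator ?S (v + u) \<partial>lborel))"
    by (subst nn_integral_cmult, measurable) (subst nn_integral_add, auto)
  also have "(\<integral>\<^sup>+u. indicator ?S (v + u) \<partial>lborel) = (\<integral>\<^sup>+u. indicator ?S u \<partial>lborel)"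
    by (rule nn_integral_lborel_shift) measurable
  also have "(\<integral>\<^sup>+u. indicator ?S u \<partial>lborel) = ennreal (measure lborel ?S)"
    by (simp add: emS)
  finally show ?thesis
    by (simp add: ennreal_mult[symmetric] ennreal_plus[symmetric] mult_ac del: ennreal_plus)
qed

lemma nn_integral_powr_le:
  assumes p: "0 < p" and e: "e < 2 ^ CARD('n) - 1"
  shows "(\<integral>\<^sup>+u. ennreal (\<bar>\<Psi> e u\<bar> powr p) \<partial>lborel)
    \<le> ennreal (A powr p * measure lborel (real_box (real R) :: (real ^ 'n) set))"
proof -
  let ?S = "real_box (real R) :: (real ^ 'n) set"
  have emS: "emeasure lborel ?S = ennreal (measure lborel ?S)"
  proof -
    have "emeasure lborel ?S < \<infinity>" by (rule emeasure_real_box_finite)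
    then show ?thesis by (intro emeasure_eq_ennreal_measure) auto
  qed
  have "ennreal (\<bar>\<Psi> e u\<bar> powr p) \<le> ennreal (A powr p) * indicator ?S u" for u
    using supp[OF e, of u] bnd[OF e, of u] p
    by (cases "\<Psi> e u = 0") (auto simp: indicator_def intro!: ennreal_leI powr_mono2)
  then have "(\<integral>\<^sup>+u. ennreal (\<bar>\<Psi> e u\<bar> powr p) \<partial>lborel) \<le> (\<integral>\<^sup>+u. ennreal (A powr p) * indicator ?S u \<partial>lborel)"
    by (intro nn_integral_mono)
  also have "\<dots> = ennreal (A powr p * measure lborel ?S)"
    by (subst nn_integral_cmult_indicator) (auto simp: emS ennreal_mult)
  finally show ?thesis .
qed

lemma synthesis_powr_le:
  assumes p: "0 < p"
  shows "(\<integral>\<^sup>+x. ennreal (\<bar>synthesis k c x\<bar> powr p) \<partial>torus)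
    \<le> ennreal (overlap powr p * (A powr p * measure lborel (real_box (real R) :: (real ^ 'n) set)) *
        ((\<Sum>\<mu>\<in>Lam k. \<bar>c \<mu>\<bar> powr p) / 2 ^ (k * CARD('n))))"
  using nn_integral_lattice_sum_le[of \<Psi> 0 k p "A powr p * measure lborel (real_box (real R) :: (real ^ 'n) set)" c]
  by (simp add: synthesis_def wavelet_sum_def case_prod_beta supp measurable_wavelet p nn_integral_powr_le)
     (simp add: real_box_def)

lemma synthesis_increment_powr_le:
  assumes p: "0 < p" and \<gamma>: "0 < \<gamma>" "\<gamma> \<le> 1" and h: "h \<in> real_box 2"
  shows "(\<integral>\<^sup>+x. ennreal (\<bar>synthesis k c (x + h) - synthesis k c x\<bar> powr p) \<partial>torus)
    \<le> ennreal (overlap powr p * ((2 * A) powr p * (2 * measure lborel (real_box (real R) :: (real ^ 'n) set)) *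
        (2 ^ k * norm h) powr (\<gamma> * p)) * ((\<Sum>\<mu>\<in>Lam k. \<bar>c \<mu>\<bar> powr p) / 2 ^ (k * CARD('n))))"
proof -
  let ?v = "2 ^ k *\<^sub>R h"
  let ?\<Phi> = "\<lambda>e u. \<Psi> e (u + ?v) - \<Psi> e u"
  have "synthesis k c (x + h) - synthesis k c x = (\<Sum>\<mu>\<in>Lam k. c \<mu> * (\<Sum>l\<in>int_box (R + 4).
      ?\<Phi> (fst \<mu>) (2 ^ k *\<^sub>R (x - of_int_vec l) - of_int_vec (snd \<mu>))))" for x
    by (simp add: synthesis_def wavelet_sum_def case_prod_beta sum_subtractf algebra_simps)
  moreover have "(\<integral>\<^sup>+x. ennreal (\<bar>\<Sum>\<mu>\<in>Lam k. c \<mu> * (\<Sum>l\<in>int_box (R + 4).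
      ?\<Phi> (fst \<mu>) (2 ^ k *\<^sub>R (x - of_int_vec l) - of_int_vec (snd \<mu>)))\<bar> powr p) \<partial>torus)
    \<le> ennreal (overlap powr p * ((2 * A) powr p * (2 * measure lborel (real_box (real R) :: (real ^ 'n) set)) *
        norm ?v powr (\<gamma> * p)) * ((\<Sum>\<mu>\<in>Lam k. \<bar>c \<mu>\<bar> powr p) / 2 ^ (k * CARD('n))))"
  proof (rule nn_integral_lattice_sum_le[where v = ?v])
    fix e assume e: "e < 2 ^ CARD('n) - (1::nat)"
    note [measurable] = measurable_wavelet[OF e]
    show "(\<lambda>u. \<Psi> e (u + ?v) - \<Psi> e u) \<in> borel_measurable borel" by measurable
    show "(\<integral>\<^sup>+u. ennreal (\<bar>\<Psi> e (u + ?v) - \<Psi> e u\<bar> powr p) \<partial>lborel)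
      \<le> ennreal ((2 * A) powr p * (2 * measure lborel (real_box (real R) :: (real ^ 'n) set)) * norm ?v powr (\<gamma> * p))"
      by (rule nn_integral_increment_powr_le[OF p \<gamma> e])
    show "u \<in> real_box (real R) \<or> u + ?v \<in> real_box (real R)" if "\<Psi> e (u + ?v) - \<Psi> e u \<noteq> 0" for u
      using that supp[OF e, of u] supp[OF e, of "u + ?v"] by force
  next
    show "?v \<in> real_box (2 * 2 ^ k)" using h by (auto simp: real_box_def abs_mult)
  qed (use p in auto)
  ultimately show ?thesis by simp
qed

lemma real_box_translate:
  fixes x y :: "real ^ 'n"
  assumes "x \<in> unit_cell" "y \<in> unit_cell" "l \<in> int_box 1"
  shows "y + of_int_vec l \<in> real_box 2" "y - (x - of_int_vec l) \<in> real_box 2"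
proof -
  have *: "\<bar>y $ i + of_int (l $ i)\<bar> \<le> 2 \<and> \<bar>y $ i - (x $ i - of_int (l $ i))\<bar> \<le> 2" for i
  proof -
    have "\<bar>l $ i\<bar> \<le> 1" using assms(3) by (simp add: int_box_def)
    then have "real_of_int \<bar>l $ i\<bar> \<le> 1" by (simp only: of_int_le_1_iff)
    moreover have "0 \<le> x $ i" "x $ i < 1" "0 \<le> y $ i" "y $ i < 1"
      using assms by (auto simp: unit_cell_def)
    ultimately show ?thesis unfolding of_int_abs by linarith
  qed
  from * show "y + of_int_vec l \<in> real_box 2" "y - (x - of_int_vec l) \<in> real_box 2"
    by (auto simp: real_box_def)
qed

text \<open>The double integral is written in x and h = y - x, with the torus kernel dominated by a
  sum over finitely many translates. For fixed h the x-integral is the p-th power of the L^p size of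
  the increment, at most a constant times (2^k |h|)^(\<gamma> p) times the normalised coefficient
  sum. What remains is the radial integral of |h|^((\<gamma> - \<alpha>) p - n), finite because
  \<alpha> < \<gamma>. The constant depends neither on the scale nor on the coefficients.\<close>

lemma sobolev_synthesis_le:
  assumes p: "0 < p" and \<gamma>: "0 < \<gamma>" "\<gamma> \<le> 1" and \<alpha>: "\<alpha> < \<gamma>" "(\<gamma> - \<alpha>) * p \<le> real CARD('n)"
  shows "\<exists>C\<ge>0. \<forall>k c. sobolev_integral \<alpha> p (\<lambda>x. \<Sum>\<mu>\<in>Lam k. c \<mu> * periodized_wavelet \<Psi> k \<mu> x)
    \<le> ennreal (C * (2 powr (\<gamma> * p * real k) * ((\<Sum>\<mu>\<in>Lam k. \<bar>c \<mu>\<bar> powr p) / 2 ^ (k * CARD('n)))))"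
proof -
  let ?n = "real CARD('n)" and ?t = "\<alpha> * p + real CARD('n)"
  define L :: "(int ^ 'n) set" where "L = int_box 1"
  define D where "D = overlap powr p * ((2 * A) powr p * (2 * measure lborel (real_box (real R) :: (real ^ 'n) set)))"
  have D: "0 \<le> D" unfolding D_def by (intro mult_nonneg_nonneg) auto
  \<comment> \<open>Radius \<open>2 * ?n\<close>: a vector of \<open>real_box 2\<close> has norm at
    most twice the dimension.\<close>
  define I where "I = (\<integral>\<^sup>+h. ennreal (norm h powr ((\<gamma> - \<alpha>) * p - ?n)) * indicator (cball 0 (2 * ?n)) h
      \<partial>(lborel :: (real ^ 'n) measure))"
  have "I < \<infinity>" unfolding I_def
    by (rule nn_integral_radial_finite) (use assms in auto)
  then obtain I' where I': "I = ennreal I'" "0 \<le> I'" by (cases I) auto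
  have main: "sobolev_integral \<alpha> p (\<lambda>x. \<Sum>\<mu>\<in>Lam k. c \<mu> * periodized_wavelet \<Psi> k \<mu> x)
    \<le> ennreal (real (card L) * (D * (2 powr (\<gamma> * p * real k) * ((\<Sum>\<mu>\<in>Lam k. \<bar>c \<mu>\<bar> powr p) / 2 ^ (k * CARD('n))))) * I')"
    for k c
  proof -
    define b where "b = (\<Sum>\<mu>\<in>Lam k. \<bar>c \<mu>\<bar> powr p) / 2 ^ (k * CARD('n))"
    have b: "0 \<le> b" unfolding b_def by (intro divide_nonneg_nonneg sum_nonneg) auto
    define g where "g = synthesis k c"
    have [measurable]: "g \<in> borel_measurable borel" unfolding g_def by (rule measurable_synthesis)
    let ?f = "\<lambda>x. \<Sum>\<mu>\<in>Lam k. c \<mu> * periodized_wavelet \<Psi> k \<mu> x"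
    \<comment> \<open>Periodicity allows a point of the cell to be replaced by its translate by any
      vector of \<open>L\<close>, in particular by the one nearest to the other point; such
      translates stay in \<open>real_box 2\<close>, where the truncated block is still the periodic
      one.\<close>
    have fg: "?f x = g (x + of_int_vec l)" if "x \<in> unit_cell" "l \<in> L" for x l
    proof -
      have "?f x = ?f (x + of_int_vec l)"
        using periodized_periodic[where v = "- l" and x = x] by (simp add: of_int_vec_minus)
      also have "\<dots> = g (x + of_int_vec l)" unfolding g_def
        using real_box_translate(1)[OF that(1) that(1) that(2)[unfolded L_def]]
        by (intro synthesis_eq) (auto simp: real_box_def intro: order_trans)
      finally show ?thesis .
    qed
    have L0: "0 \<in> L" by (simp add: L_def int_box_def)
    define G where "G x z = ennreal (\<bar>g x - g z\<bar> powr p / norm (z - x) powr ?t)" for x z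
    have [measurable]: "(\<lambda>(x, z). G x z) \<in> borel_measurable (borel \<Otimes>\<^sub>M borel)"
      unfolding G_def by measurable
    have Gm [measurable]: "(\<lambda>z. G x z) \<in> borel_measurable borel" for x
      unfolding G_def by measurable
    have "sobolev_integral \<alpha> p ?f \<le> (\<integral>\<^sup>+x. \<integral>\<^sup>+y. (\<Sum>l\<in>L. G x (y + of_int_vec l)) \<partial>torus \<partial>torus)"
      unfolding sobolev_integral_def
    proof (intro nn_integral_mono)
      fix x y :: "real ^ 'n" assume "x \<in> space torus" "y \<in> space torus"
      then have x: "x \<in> unit_cell" and y: "y \<in> unit_cell" by (auto simp: space_torus)
      from torus_dist_attained[OF x y] obtain l where l: "l \<in> L" "torus_dist x y = norm (x - y - of_int_vec l)"
        by (auto simp: L_def)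
      have "ennreal (\<bar>?f x - ?f y\<bar> powr p / torus_dist x y powr ?t) = G x (y + of_int_vec l)"
        unfolding G_def l(2) fg[OF y l(1)] using fg[OF x L0]
        by (simp add: norm_minus_commute diff_diff_eq2 diff_diff_eq)
      also have "\<dots> \<le> (\<Sum>l\<in>L. G x (y + of_int_vec l))"
        by (rule member_le_sum) (use l in \<open>auto simp: L_def\<close>)
      finally show "ennreal (\<bar>?f x - ?f y\<bar> powr p / torus_dist x y powr ?t) \<le> (\<Sum>l\<in>L. G x (y + of_int_vec l))" .
    qed
    also have "\<dots> \<le> (\<integral>\<^sup>+x. of_nat (card L) * (\<integral>\<^sup>+h. indicator (real_box 2) h * G x (x + h) \<partial>lborel) \<partial>torus)"
    proof (rule nn_integral_mono)
      fix x :: "real ^ 'n" assume "x \<in> space torus"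
      then have x: "x \<in> unit_cell" by (auto simp: space_torus)
      have "(\<integral>\<^sup>+y. (\<Sum>l\<in>L. G x (y + of_int_vec l)) \<partial>torus) = (\<Sum>l\<in>L. \<integral>\<^sup>+y. G x (y + of_int_vec l) \<partial>torus)"
        by (rule nn_integral_sum) (rule measurable_torus, measurable)
      also have "\<dots> \<le> (\<Sum>l\<in>L. \<integral>\<^sup>+h. indicator (real_box 2) h * G x (x + h) \<partial>lborel)"
      proof (rule sum_mono)
        fix l assume l: "l \<in> L"
        have "(\<integral>\<^sup>+y. G x (y + of_int_vec l) \<partial>torus) = (\<integral>\<^sup>+y. G x (y + of_int_vec l) * indicator unit_cell y \<partial>lborel)"
          by (rule nn_integral_torus)
        also have "\<dots> = (\<integral>\<^sup>+h. G x ((x - of_int_vec l) + h + of_int_vec l) * indicator unit_cell ((x - of_int_vec l) + h) \<partial>lborel)"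
          by (rule nn_integral_lborel_shift[symmetric, where h = "\<lambda>y. G x (y + of_int_vec l) * indicator unit_cell y"]) measurable
        also have "\<dots> \<le> (\<integral>\<^sup>+h. indicator (real_box 2) h * G x (x + h) \<partial>lborel)"
        proof (rule nn_integral_mono)
          fix h
          show "G x ((x - of_int_vec l) + h + of_int_vec l) * indicator unit_cell ((x - of_int_vec l) + h) \<le> indicator (real_box 2) h * G x (x + h)"
          proof (cases "(x - of_int_vec l) + h \<in> unit_cell")
            case True
            have "h \<in> real_box 2" using real_box_translate(2)[OF x True l[unfolded L_def]] by simp
            then show ?thesis using True by simp
          qed simp
        qed
        finally show "(\<integral>\<^sup>+y. G x (y + of_int_vec l) \<partial>torus) \<le> (\<integral>\<^sup>+h. indicator (real_box 2) h * G x (x + h) \<partial>lborel)" .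
      qed
      finally show "(\<integral>\<^sup>+y. (\<Sum>l\<in>L. G x (y + of_int_vec l)) \<partial>torus) \<le> of_nat (card L) * (\<integral>\<^sup>+h. indicator (real_box 2) h * G x (x + h) \<partial>lborel)"
        by simp
    qed
    also have "\<dots> = of_nat (card L) * (\<integral>\<^sup>+x. (\<integral>\<^sup>+h. indicator (real_box 2) h * G x (x + h) \<partial>lborel) \<partial>torus)"
      by (rule nn_integral_cmult, rule measurable_torus) measurable
    also have "(\<integral>\<^sup>+x. (\<integral>\<^sup>+h. indicator (real_box 2) h * G x (x + h) \<partial>lborel) \<partial>torus) =
        (\<integral>\<^sup>+x. (\<integral>\<^sup>+h. indicator (real_box 2) h * G x (x + h) * indicator unit_cell x \<partial>lborel) \<partial>lborel)"
      unfolding nn_integral_torus by (rule nn_integral_cong) (rule nn_integral_multc[symmetric], measurable)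
    also have "\<dots> = (\<integral>\<^sup>+h. (\<integral>\<^sup>+x. indicator (real_box 2) h * G x (x + h) * indicator unit_cell x \<partial>lborel) \<partial>lborel)"
      by (rule lborel_pair.Fubini') measurable
    also have "\<dots> = (\<integral>\<^sup>+h. indicator (real_box 2) h * (\<integral>\<^sup>+x. G x (x + h) \<partial>torus) \<partial>lborel)"
      unfolding nn_integral_torus mult.assoc
      by (rule nn_integral_cong) (rule nn_integral_cmult, measurable)
    also have "\<dots> \<le> (\<integral>\<^sup>+h. ennreal (D * (2 powr (\<gamma> * p * real k) * b)) *
        (ennreal (norm h powr ((\<gamma> - \<alpha>) * p - ?n)) * indicator (cball 0 (2 * ?n)) h) \<partial>(lborel :: (real ^ 'n) measure))"
    proof (rule nn_integral_mono)
      fix h :: "real ^ 'n"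
      show "indicator (real_box 2) h * (\<integral>\<^sup>+x. G x (x + h) \<partial>torus) \<le> ennreal (D * (2 powr (\<gamma> * p * real k) * b)) *
        (ennreal (norm h powr ((\<gamma> - \<alpha>) * p - ?n)) * indicator (cball 0 (2 * ?n)) h)"
      proof (cases "h \<in> real_box 2 \<and> h \<noteq> 0")
        case True
        then have h: "h \<in> real_box 2" "h \<noteq> 0" by auto
        have hb: "h \<in> cball 0 (2 * ?n)" using norm_le_card_sup[OF h(1)] by (simp add: mult.commute)
        have "(\<integral>\<^sup>+x. G x (x + h) \<partial>torus) = (\<integral>\<^sup>+x. ennreal (1 / norm h powr ?t) * ennreal (\<bar>g (x + h) - g x\<bar> powr p) \<partial>torus)"
          by (intro nn_integral_cong) (simp add: G_def ennreal_mult[symmetric] abs_minus_commute)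
        also have "\<dots> = ennreal (1 / norm h powr ?t) * (\<integral>\<^sup>+x. ennreal (\<bar>g (x + h) - g x\<bar> powr p) \<partial>torus)"
          by (rule nn_integral_cmult, rule measurable_torus) measurable
        also have "\<dots> \<le> ennreal (1 / norm h powr ?t) * ennreal (overlap powr p * ((2 * A) powr p * (2 * measure lborel (real_box (real R) :: (real ^ 'n) set)) *
          (2 ^ k * norm h) powr (\<gamma> * p)) * b)"
          unfolding g_def b_def by (intro mult_left_mono synthesis_increment_powr_le p \<gamma> h) simp
        also have "\<dots> = ennreal (1 / norm h powr ?t) * ennreal (D * (2 ^ k * norm h) powr (\<gamma> * p) * b)"
          by (simp add: D_def mult.assoc)
        also have "\<dots> = ennreal (1 / norm h powr ?t * (D * (2 ^ k * norm h) powr (\<gamma> * p) * b))"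
          using D b by (subst ennreal_mult) auto
        also have "1 / norm h powr ?t * (D * (2 ^ k * norm h) powr (\<gamma> * p) * b) =
            D * (2 powr (\<gamma> * p * real k) * b) * norm h powr ((\<gamma> - \<alpha>) * p - ?n)"
        proof -
          have "(2 ^ k * norm h) powr (\<gamma> * p) = 2 powr (\<gamma> * p * real k) * norm h powr (\<gamma> * p)"
            by (simp add: powr_mult powr_realpow[symmetric] powr_powr mult.commute)
          moreover have "norm h powr ((\<gamma> - \<alpha>) * p - ?n) = norm h powr (\<gamma> * p) / norm h powr ?t"
            by (simp add: powr_diff[symmetric] algebra_simps)
          ultimately show ?thesis by (simp add: mult_ac)
        qed
        finally show ?thesis using h hb D b by (simp add: ennreal_mult)
      next
        case False
        have "(\<integral>\<^sup>+x. G x (x + 0) \<partial>torus) = 0" by (simp add: G_def)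
        then show ?thesis using False by (cases "h = 0") auto
      qed
    qed
    also have "\<dots> = ennreal (D * (2 powr (\<gamma> * p * real k) * b)) * I"
    proof -
      have [measurable]: "cball (0 :: real ^ 'n) (2 * ?n) \<in> sets borel" by simp
      show ?thesis unfolding I_def by (rule nn_integral_cmult) measurable
    qed
    finally have "sobolev_integral \<alpha> p ?f \<le> of_nat (card L) * (ennreal (D * (2 powr (\<gamma> * p * real k) * b)) * I)"
      by (simp add: mult_left_mono)
    also have "\<dots> = ennreal (real (card L) * (D * (2 powr (\<gamma> * p * real k) * b)) * I')"
      using D b I' by (simp add: ennreal_of_nat_eq_real_of_nat ennreal_mult[symmetric] mult.assoc)
    finally show ?thesis by (simp add: b_def)
  qed
  show ?thesis
    by (rule exI[of _ "real (card L) * D * I'"]) (use main D I' in \<open>simp add: mult_ac\<close>)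
qed

end

section \<open>Volume of the cell and measurability of the kernel\<close>

lemma emeasure_unit_cell: "emeasure lborel (unit_cell :: (real ^ 'n::finite) set) = 1"
proof (rule antisym)
  have 1: "emeasure lborel (cbox 0 1 :: (real ^ 'n) set) = 1" "emeasure lborel (box 0 1 :: (real ^ 'n) set) = 1"
  proof -
    have "(\<Prod>b\<in>Basis. (1 - 0 :: real ^ 'n) \<bullet> b) = 1"
      by (rule prod.neutral) (auto simp: Basis_vec_def inner_axis)
    moreover have "(0 :: real ^ 'n) \<bullet> b \<le> 1 \<bullet> b" if "b \<in> Basis" for b
      using that by (auto simp: Basis_vec_def inner_axis)
    ultimately show "emeasure lborel (cbox 0 1 :: (real ^ 'n) set) = 1" "emeasure lborel (box 0 1 :: (real ^ 'n) set) = 1"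
      by (simp_all add: emeasure_lborel_cbox emeasure_lborel_box)
  qed
  have "unit_cell \<subseteq> (cbox 0 1 :: (real ^ 'n) set)" "(box 0 1 :: (real ^ 'n) set) \<subseteq> unit_cell"
    by (auto simp: unit_cell_def cbox_def box_def Basis_vec_def inner_axis less_imp_le)
  then show "emeasure lborel (unit_cell :: (real ^ 'n) set) \<le> 1" "1 \<le> emeasure lborel (unit_cell :: (real ^ 'n) set)"
    using emeasure_mono[of unit_cell "cbox 0 1 :: (real ^ 'n) set" lborel]
      emeasure_mono[of "box 0 1 :: (real ^ 'n) set" unit_cell lborel] 1 by auto
qed

lemma finite_measure_torus: "finite_measure torus"
  by (rule finite_measureI)
    (simp add: space_torus, simp add: torus_eq emeasure_restrict_space emeasure_unit_cell)

lemma measurable_torus_dist: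
  "(\<lambda>z :: (real ^ 'n::finite) \<times> (real ^ 'n). torus_dist (fst z) (snd z)) \<in> borel_measurable (borel \<Otimes>\<^sub>M borel)"
proof -
  have "bdd_below ((\<lambda>l. norm (fst z - snd z - of_int_vec l)) ` UNIV)" for z :: "(real ^ 'n) \<times> (real ^ 'n)"
    by (rule bdd_belowI[of _ 0]) auto
  then show ?thesis
    unfolding torus_dist_def by (intro borel_measurable_cINF) (auto intro!: measurable_compose_rev)
qed

lemma id_measurable_torus: "(\<lambda>x. x) \<in> measurable torus borel"
  unfolding torus_eq by (rule measurable_restrict_space1) simp

lemma measurable_torus_dist_pair:
  "(\<lambda>z. torus_dist (fst z) (snd z)) \<in> borel_measurable (torus \<Otimes>\<^sub>M torus)"
proof -
  have "(\<lambda>z. (fst z, snd z)) \<in> measurable (torus \<Otimes>\<^sub>M torus) (borel \<Otimes>\<^sub>M borel)"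
    by (intro measurable_Pair measurable_compose[OF measurable_fst id_measurable_torus]
        measurable_compose[OF measurable_snd id_measurable_torus])
  from measurable_compose[OF this measurable_torus_dist] show ?thesis by simp
qed

lemma measurable_sobolev_kernel:
  fixes f :: "real ^ 'n::finite \<Rightarrow> real"
  assumes [measurable]: "f \<in> borel_measurable torus"
  shows "(\<lambda>(x, y). ennreal (\<bar>f x - f y\<bar> powr q / torus_dist x y powr t)) \<in> borel_measurable (torus \<Otimes>\<^sub>M torus)"
proof -
  note [measurable] = measurable_torus_dist_pair
  show ?thesis unfolding case_prod_beta by measurable
qed

lemma measurable_sobolev_kernel_snd:
  fixes f :: "real ^ 'n::finite \<Rightarrow> real"
  assumes "f \<in> borel_measurable torus" "x \<in> space torus"
  shows "(\<lambda>y. ennreal (\<bar>f x - f y\<bar> powr q / torus_dist x y powr t)) \<in> borel_measurable torus"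
  using measurable_compose[OF measurable_Pair1' measurable_sobolev_kernel, OF assms(2,1)] by simp

lemma measurable_sobolev_kernel_integral:
  fixes f :: "real ^ 'n::finite \<Rightarrow> real"
  assumes "f \<in> borel_measurable torus"
  shows "(\<lambda>x. \<integral>\<^sup>+y. ennreal (\<bar>f x - f y\<bar> powr q / torus_dist x y powr t) \<partial>torus) \<in> borel_measurable torus"
  using sigma_finite_measure.borel_measurable_nn_integral[OF sigma_finite_torus measurable_sobolev_kernel[OF assms]]
  by simp

lemma nn_integral_weighted_suminf:
  fixes H :: "nat \<Rightarrow> 'a \<Rightarrow> ennreal"
  assumes [measurable]: "\<And>k. H k \<in> borel_measurable M"
  shows "(\<integral>\<^sup>+x. c * (\<Sum>k. w k * H k x) \<partial>M) = c * (\<Sum>k. w k * (\<integral>\<^sup>+x. H k x \<partial>M))"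
  by (subst nn_integral_cmult, measurable, subst nn_integral_suminf, measurable) (simp add: nn_integral_cmult)

text \<open>If the weighted series diverges, the right-hand side is infinite because its constant is
  positive. Stated in \<open>ennreal\<close>, the bound applies to increments without first checking
  convergence of their weighted series pair by pair.\<close>

lemma ennreal_geometric_weight:
  fixes a :: "nat \<Rightarrow> real"
  assumes \<epsilon>: "0 < \<epsilon>" and p: "0 < p"
  shows "ennreal (\<bar>\<Sum>k. a k\<bar> powr p) \<le> ennreal ((1 / (1 - 2 powr - \<epsilon>)) powr p) *
      (\<Sum>k. ennreal (2 powr (\<epsilon> * p * real k) * \<bar>a k\<bar> powr p))"
proof (cases "(\<Sum>k. ennreal (2 powr (\<epsilon> * p * real k) * \<bar>a k\<bar> powr p)) = \<top>")
  case True
  have "(2::real) powr - \<epsilon> < 1" using \<epsilon> by (auto simp: powr_less_one)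
  then have "0 < (1 / (1 - 2 powr - \<epsilon>)) powr p" using \<epsilon> by simp
  then show ?thesis using True by (simp add: ennreal_mult_top)
next
  case False
  then have s: "summable (\<lambda>k. 2 powr (\<epsilon> * p * real k) * \<bar>a k\<bar> powr p)"
    by (intro summable_suminf_not_top) auto
  have "ennreal (\<bar>\<Sum>k. a k\<bar> powr p) \<le> ennreal ((1 / (1 - 2 powr - \<epsilon>)) powr p * (\<Sum>k. 2 powr (\<epsilon> * p * real k) * \<bar>a k\<bar> powr p))"
    by (rule ennreal_leI, rule geometric_weight_powr[OF assms s])
  also have "\<dots> = ennreal ((1 / (1 - 2 powr - \<epsilon>)) powr p) * (\<Sum>k. ennreal (2 powr (\<epsilon> * p * real k) * \<bar>a k\<bar> powr p))"
    using s by (subst suminf_ennreal2) (auto simp: ennreal_mult suminf_nonneg)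
  finally show ?thesis .
qed

context lipschitz_wavelets
begin

lemma integrable_periodized:
  assumes "\<mu> \<in> Lam k"
  shows "integrable torus (periodized_wavelet \<Psi> k \<mu>)"
  by (rule finite_measure.integrable_const_bound[OF finite_measure_torus AE_I2 measurable_periodized[OF assms],
        where B = "A * real (card (int_box (R + 4) :: (int ^ 'n) set))"])
    (simp add: space_torus abs_periodized_le[OF assms])

text \<open>The gap between \<alpha> and \<gamma> is spent twice:
  \<open>\<gamma>' = \<alpha> + \<eta>\<close> leaves room for the radial integral of a single
  block, and \<open>\<epsilon> = \<gamma> - \<gamma>'\<close> pays for the geometric weights that
  sum the blocks. The same weights, applied to the L^p bounds of the blocks, give convergence of the
  series in L^1 and integrability of the p-th power of its sum.\<close>

lemma wavelet_series_sobolev: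
  fixes c :: "nat \<Rightarrow> nat \<times> (int ^ 'n) \<Rightarrow> real"
  assumes p: "1 < p" and \<alpha>: "0 < \<alpha>" "\<alpha> < \<gamma>" "\<gamma> < 1"
    and sum: "summable (\<lambda>k. 2 powr (\<gamma> * p * real k) * ((\<Sum>\<mu>\<in>Lam k. \<bar>c k \<mu>\<bar> powr p) / 2 ^ (k * CARD('n))))"
  shows "summable (\<lambda>k. \<Sum>\<mu>\<in>Lam k. c k \<mu> *\<^sub>R L1_class (periodized_wavelet \<Psi> k \<mu>))"
    and "is_sobolev \<alpha> p (\<Sum>k. \<Sum>\<mu>\<in>Lam k. c k \<mu> *\<^sub>R L1_class (periodized_wavelet \<Psi> k \<mu>))"
proof -
  interpret finite_measure "torus :: (real ^ 'n) measure" by (rule finite_measure_torus)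
  \<comment> \<open>The bound 1 / p keeps \<open>(\<gamma>' - \<alpha>) * p\<close> at most 1, hence
    at most the dimension, as the radial integral requires; half the gap keeps \<epsilon>
    positive.\<close>
  define \<eta> where "\<eta> = min ((\<gamma> - \<alpha>) / 2) (1 / p)"
  have \<eta>: "0 < \<eta>" "\<eta> < \<gamma> - \<alpha>" using p \<alpha> by (auto simp: \<eta>_def min_less_iff_disj)
  have \<eta>p: "\<eta> * p \<le> 1"
  proof -
    have "\<eta> \<le> 1 / p" by (simp add: \<eta>_def)
    then show ?thesis using p by (simp add: field_simps)
  qed
  define \<gamma>' where "\<gamma>' = \<alpha> + \<eta>"
  define \<epsilon> where "\<epsilon> = \<gamma> - \<gamma>'"
  have \<epsilon>: "0 < \<epsilon>" using \<eta> by (simp add: \<epsilon>_def \<gamma>'_def)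
  have \<gamma>': "0 < \<gamma>'" "\<gamma>' \<le> 1" "\<alpha> < \<gamma>'" "(\<gamma>' - \<alpha>) * p \<le> real CARD('n)"
    using \<alpha> \<eta> \<eta>p zero_less_card_finite[where 'a='n] by (auto simp: \<gamma>'_def intro: order_trans)
  have p0: "0 < p" using p by simp
  define E where "E k = (\<Sum>\<mu>\<in>Lam k. \<bar>c k \<mu>\<bar> powr p) / 2 ^ (k * CARD('n))" for k
  have E: "0 \<le> E k" for k unfolding E_def by (intro divide_nonneg_nonneg sum_nonneg) auto
  define f where "f k x = (\<Sum>\<mu>\<in>Lam k. c k \<mu> * periodized_wavelet \<Psi> k \<mu> x)" for k x
  note ip = integrable_periodized
  have fi: "integrable torus (f k)" for k
    unfolding f_def using ip by (intro Bochner_Integration.integrable_sum integrable_mult_right) auto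
  have [measurable]: "f k \<in> borel_measurable torus" for k using fi by auto
  have fcls: "(\<Sum>\<mu>\<in>Lam k. c k \<mu> *\<^sub>R L1_class (periodized_wavelet \<Psi> k \<mu>)) = L1_class (f k)" for k
  proof -
    have "(\<Sum>\<mu>\<in>Lam k. c k \<mu> *\<^sub>R L1_class (periodized_wavelet \<Psi> k \<mu>)) =
        (\<Sum>\<mu>\<in>Lam k. L1_class (\<lambda>x. c k \<mu> * periodized_wavelet \<Psi> k \<mu> x))"
      by (rule sum.cong[OF refl]) (simp add: L1_class_scaleR ip)
    also have "\<dots> = L1_class (f k)"
      unfolding f_def using ip by (subst L1_class_sum) auto
    finally show ?thesis .
  qed
  define w where "w k = 2 powr (\<epsilon> * p * real k)" for k :: nat
  define Q where "Q x = (\<Sum>k. ennreal (w k * \<bar>f k x\<bar> powr p))" for x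
  have [measurable]: "Q \<in> borel_measurable torus" unfolding Q_def by measurable
  define K where "K = overlap powr p * (A powr p * measure lborel (real_box (real R) :: (real ^ 'n) set))"
  have K: "0 \<le> K" unfolding K_def by (intro mult_nonneg_nonneg) auto
  have "(\<integral>\<^sup>+x. Q x \<partial>torus) = (\<Sum>k. ennreal (w k) * (\<integral>\<^sup>+x. ennreal (\<bar>f k x\<bar> powr p) \<partial>torus))"
    unfolding Q_def
    by (subst nn_integral_suminf) (auto simp: ennreal_mult w_def intro!: nn_integral_cmult suminf_cong)
  also have "\<dots> \<le> (\<Sum>k. ennreal (K * (2 powr (\<gamma> * p * real k) * E k)))"
  proof (intro suminf_le allI)
    fix k
    have "(\<integral>\<^sup>+x. ennreal (\<bar>f k x\<bar> powr p) \<partial>torus) = (\<integral>\<^sup>+x. ennreal (\<bar>synthesis k (c k) x\<bar> powr p) \<partial>torus)"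
    proof (rule nn_integral_cong)
      fix x :: "real ^ 'n" assume "x \<in> space torus"
      then have "0 \<le> x $ i \<and> x $ i < 1" for i by (simp add: space_torus unit_cell_def)
      then have "\<bar>x $ i\<bar> \<le> 3" for i by (smt (verit))
      then have "x \<in> real_box 3" by (simp add: real_box_def)
      then show "ennreal (\<bar>f k x\<bar> powr p) = ennreal (\<bar>synthesis k (c k) x\<bar> powr p)"
        by (simp add: f_def synthesis_eq)
    qed
    also have "\<dots> \<le> ennreal (K * E k)" unfolding K_def E_def by (rule synthesis_powr_le[OF p0])
    finally have "ennreal (w k) * (\<integral>\<^sup>+x. ennreal (\<bar>f k x\<bar> powr p) \<partial>torus) \<le> ennreal (w k) * ennreal (K * E k)"
      by (rule mult_left_mono) simp
    also have "\<dots> = ennreal (w k * (K * E k))" using K E by (simp add: ennreal_mult w_def)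
    also have "\<dots> \<le> ennreal (2 powr (\<gamma> * p * real k) * (K * E k))"
    proof (intro ennreal_leI mult_right_mono)
      have "\<epsilon> * p * real k \<le> \<gamma> * p * real k"
        using \<gamma>' p by (intro mult_right_mono) (auto simp: \<epsilon>_def)
      then show "w k \<le> 2 powr (\<gamma> * p * real k)" unfolding w_def by simp
    qed (use K E in auto)
    finally show "ennreal (w k) * (\<integral>\<^sup>+x. ennreal (\<bar>f k x\<bar> powr p) \<partial>torus) \<le> ennreal (K * (2 powr (\<gamma> * p * real k) * E k))"
      by (simp add: mult_ac)
  qed auto
  also have "\<dots> < \<infinity>"
    using summable_mult[OF sum[folded E_def], of K] K E by (subst suminf_ennreal2) auto
  finally have Qfin: "(\<integral>\<^sup>+x. Q x \<partial>torus) < \<infinity>" .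
  then have AEQ: "AE x in torus. Q x \<noteq> \<infinity>" by (intro nn_integral_PInf_AE) auto
  define q where "q x = enn2real (Q x)" for x
  have [measurable]: "q \<in> borel_measurable torus" unfolding q_def by measurable
  have qi: "integrable torus q"
  proof (rule integrableI_bounded)
    have "(\<integral>\<^sup>+x. ennreal (norm (q x)) \<partial>torus) = (\<integral>\<^sup>+x. Q x \<partial>torus)"
      using AEQ by (intro nn_integral_cong_AE) (auto simp: q_def less_top)
    then show "(\<integral>\<^sup>+x. ennreal (norm (q x)) \<partial>torus) < \<infinity>" using Qfin by simp
  qed measurable
  have sumf: "summable (\<lambda>k. w k * \<bar>f k x\<bar> powr p) \<and> (\<Sum>k. w k * \<bar>f k x\<bar> powr p) = q x" if "Q x \<noteq> \<infinity>" for x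
  proof -
    have "summable (\<lambda>k. w k * \<bar>f k x\<bar> powr p)"
      using that by (intro summable_suminf_not_top) (auto simp: Q_def w_def)
    then show ?thesis unfolding q_def Q_def
      by (subst suminf_ennreal2) (auto simp: w_def suminf_nonneg)
  qed
  define Ce where "Ce = 1 / (1 - 2 powr - \<epsilon>)"
  have Ce: "0 < Ce"
  proof -
    have "(2::real) powr - \<epsilon> < 1" using \<epsilon> by (auto simp: powr_less_one)
    then show ?thesis by (simp add: Ce_def)
  qed
  have dom: "AE x in torus. summable (\<lambda>k. \<bar>f k x\<bar>) \<and> (\<Sum>k. \<bar>f k x\<bar>) \<le> Ce * (1 + q x)"
    using AEQ
  proof eventually_elim
    case (elim x)
    note s = sumf[OF elim, unfolded w_def]
    have q0: "0 \<le> q x" by (simp add: q_def)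
    have "(\<Sum>k. \<bar>f k x\<bar>) \<le> Ce * q x powr (1 / p)"
      using geometric_weight_sum(2)[OF \<epsilon> p0, of "\<lambda>k. f k x"] s by (simp add: Ce_def)
    \<comment> \<open>The crude bound \<open>1 + q x\<close> replaces the power 1 / p by a function
      that is integrable on a space of finite measure.\<close>
    also have "q x powr (1 / p) \<le> 1 + q x"
    proof (cases "q x \<le> 1")
      case True
      then have "q x powr (1 / p) \<le> 1" using q0 p by (intro powr_le1) auto
      then show ?thesis using q0 by simp
    next
      case False
      then have "q x powr (1 / p) \<le> q x powr 1" using p by (intro powr_mono) auto
      then show ?thesis using False by simp
    qed
    finally show ?case
      using geometric_weight_sum(1)[OF \<epsilon> p0, of "\<lambda>k. f k x"] s Ce by simp
  qed
  have di: "integrable torus (\<lambda>x. Ce * (1 + q x))" using qi by auto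
  note sums = L1_class_sums[OF fi di dom]
  define g where "g x = (\<Sum>k. f k x)" for x
  have gi: "integrable torus g" using sums(1) by (simp add: g_def[abs_def])
  have [measurable]: "g \<in> borel_measurable torus" using gi by auto
  show "summable (\<lambda>k. \<Sum>\<mu>\<in>Lam k. c k \<mu> *\<^sub>R L1_class (periodized_wavelet \<Psi> k \<mu>))"
    unfolding fcls using sums(2) by (rule sums_summable)
  have eq: "(\<Sum>k. \<Sum>\<mu>\<in>Lam k. c k \<mu> *\<^sub>R L1_class (periodized_wavelet \<Psi> k \<mu>)) = L1_class g"
    unfolding fcls g_def[abs_def] using sums(2) by (rule sums_unique[symmetric])
  have Lp: "integrable torus (\<lambda>x. \<bar>g x\<bar> powr p)"
  proof (rule Bochner_Integration.integrable_bound)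
    show "integrable torus (\<lambda>x. Ce powr p * q x)" using qi by simp
    show "AE x in torus. norm (\<bar>g x\<bar> powr p) \<le> norm (Ce powr p * q x)"
      using AEQ
    proof eventually_elim
      case (elim x)
      from geometric_weight_powr[OF \<epsilon> p0, of "\<lambda>k. f k x"] sumf[OF elim, unfolded w_def]
      show ?case by (simp add: Ce_def g_def q_def)
    qed
  qed measurable
  obtain C where C: "0 \<le> C" "\<And>k c. sobolev_integral \<alpha> p (\<lambda>x. \<Sum>\<mu>\<in>Lam k. c \<mu> * periodized_wavelet \<Psi> k \<mu> x)
    \<le> ennreal (C * (2 powr (\<gamma>' * p * real k) * ((\<Sum>\<mu>\<in>Lam k. \<bar>c \<mu>\<bar> powr p) / 2 ^ (k * CARD('n)))))"
    using sobolev_synthesis_le[OF p0 \<gamma>'] by blast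
  let ?t = "\<alpha> * p + real CARD('n)"
  let ?k = "\<lambda>f x y. ennreal (\<bar>f x - f y\<bar> powr p / torus_dist x y powr ?t)"
  have AEf: "AE x in torus. summable (\<lambda>k. f k x)"
    using dom by eventually_elim (blast intro: summable_rabs_cancel)
  have pw: "?k g x y \<le> ennreal (Ce powr p) * (\<Sum>k. ennreal (w k) * ?k (f k) x y)"
    if "summable (\<lambda>k. f k x)" "summable (\<lambda>k. f k y)" for x y
  proof -
    define d where "d = 1 / torus_dist x y powr ?t"
    have d: "0 \<le> d" by (simp add: d_def)
    have "?k g x y = ennreal d * ennreal (\<bar>\<Sum>k. f k x - f k y\<bar> powr p)"
      using d by (simp add: g_def suminf_diff[OF that] ennreal_mult[symmetric] d_def)
    also have "\<dots> \<le> ennreal d * (ennreal (Ce powr p) * (\<Sum>k. ennreal (2 powr (\<epsilon> * p * real k) * \<bar>f k x - f k y\<bar> powr p)))"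
      unfolding Ce_def by (intro mult_left_mono ennreal_geometric_weight[OF \<epsilon> p0]) simp
    also have "\<dots> = ennreal (Ce powr p) * (\<Sum>k. ennreal d * ennreal (2 powr (\<epsilon> * p * real k) * \<bar>f k x - f k y\<bar> powr p))"
      by (simp add: mult.left_commute)
    also have "\<dots> = ennreal (Ce powr p) * (\<Sum>k. ennreal (w k) * ?k (f k) x y)"
    proof -
      have "ennreal d * ennreal (2 powr (\<epsilon> * p * real k) * \<bar>f k x - f k y\<bar> powr p) = ennreal (w k) * ?k (f k) x y" for k
        by (simp add: ennreal_mult[symmetric] d_def w_def)
      then show ?thesis by simp
    qed
    finally show ?thesis .
  qed
  have mk: "?k (f k) x \<in> borel_measurable torus" if "x \<in> space torus" for k x
    by (rule measurable_sobolev_kernel_snd[OF _ that]) simp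
  have mi: "(\<lambda>x. \<integral>\<^sup>+y. ?k (f k) x y \<partial>torus) \<in> borel_measurable torus" for k
    by (rule measurable_sobolev_kernel_integral) simp
  have "sobolev_integral \<alpha> p g \<le> (\<integral>\<^sup>+x. \<integral>\<^sup>+y. ennreal (Ce powr p) * (\<Sum>k. ennreal (w k) * ?k (f k) x y) \<partial>torus \<partial>torus)"
    unfolding sobolev_integral_def
  proof (rule nn_integral_mono_AE)
    show "AE x in torus. (\<integral>\<^sup>+y. ?k g x y \<partial>torus) \<le> (\<integral>\<^sup>+y. ennreal (Ce powr p) * (\<Sum>k. ennreal (w k) * ?k (f k) x y) \<partial>torus)"
      using AEf
    proof eventually_elim
      case (elim x)
      show ?case
      proof (rule nn_integral_mono_AE)
        show "AE y in torus. ?k g x y \<le> ennreal (Ce powr p) * (\<Sum>k. ennreal (w k) * ?k (f k) x y)"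
          using AEf by eventually_elim (rule pw[OF elim])
      qed
    qed
  qed
  also have "\<dots> = (\<integral>\<^sup>+x. ennreal (Ce powr p) * (\<Sum>k. ennreal (w k) * (\<integral>\<^sup>+y. ?k (f k) x y \<partial>torus)) \<partial>torus)"
  proof (rule nn_integral_cong)
    fix x :: "real ^ 'n" assume x: "x \<in> space torus"
    show "(\<integral>\<^sup>+y. ennreal (Ce powr p) * (\<Sum>k. ennreal (w k) * ?k (f k) x y) \<partial>torus) =
      ennreal (Ce powr p) * (\<Sum>k. ennreal (w k) * (\<integral>\<^sup>+y. ?k (f k) x y \<partial>torus))"
      by (rule nn_integral_weighted_suminf[OF mk[OF x]])
  qed
  also have "\<dots> = ennreal (Ce powr p) * (\<Sum>k. ennreal (w k) * sobolev_integral \<alpha> p (f k))"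
    unfolding sobolev_integral_def
    by (rule nn_integral_weighted_suminf[OF mi])
  also have "\<dots> \<le> ennreal (Ce powr p) * (\<Sum>k. ennreal (C * (2 powr (\<gamma> * p * real k) * E k)))"
  proof (intro mult_left_mono suminf_le allI)
    fix k
    have "ennreal (w k) * sobolev_integral \<alpha> p (f k) \<le> ennreal (w k) * ennreal (C * (2 powr (\<gamma>' * p * real k) * E k))"
      unfolding f_def E_def by (intro mult_left_mono C(2)) simp
    also have "\<dots> = ennreal (w k * (C * (2 powr (\<gamma>' * p * real k) * E k)))"
      using C(1) E by (simp add: ennreal_mult w_def)
    also have "w k * (C * (2 powr (\<gamma>' * p * real k) * E k)) = C * ((w k * 2 powr (\<gamma>' * p * real k)) * E k)"
      by simp
    also have "w k * 2 powr (\<gamma>' * p * real k) = 2 powr (\<gamma> * p * real k)"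
      by (simp add: w_def powr_add[symmetric] \<epsilon>_def algebra_simps)
    finally show "ennreal (w k) * sobolev_integral \<alpha> p (f k) \<le> ennreal (C * (2 powr (\<gamma> * p * real k) * E k))" .
  qed auto
  also have "\<dots> < \<infinity>"
    using summable_mult[OF sum[folded E_def], of C] C(1) E
    by (subst suminf_ennreal2) (auto simp: ennreal_mult_less_top)
  finally have "sobolev_integral \<alpha> p g < \<infinity>" .
  then show "is_sobolev \<alpha> p (\<Sum>k. \<Sum>\<mu>\<in>Lam k. c k \<mu> *\<^sub>R L1_class (periodized_wavelet \<Psi> k \<mu>))"
    unfolding eq is_sobolev_L1_class[OF gi] using Lp by simp
qed

text \<open>The factor 2^(kn) undoes the squared L^2 norm of a wavelet normalised in the sup norm,
  so the functional returns the coefficient itself.\<close>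

definition wavelet_coeff :: "nat \<Rightarrow> nat \<times> (int ^ 'n) \<Rightarrow> 'n L1_torus \<Rightarrow> real" where
  "wavelet_coeff k \<mu> f = 2 ^ (k * CARD('n)) * torus_pair (periodized_wavelet \<Psi> k \<mu>) f"

lemma bounded_linear_wavelet_coeff:
  assumes "\<mu> \<in> Lam k"
  shows "bounded_linear (wavelet_coeff k \<mu>)"
  unfolding wavelet_coeff_def
  by (rule bounded_linear_const_mult bounded_linear_torus_pair[OF measurable_periodized abs_periodized_le] assms | assumption)+

lemma wavelet_coeff_periodized:
  assumes "\<mu> \<in> Lam k" "\<nu> \<in> Lam k'"
  shows "wavelet_coeff k \<mu> (L1_class (periodized_wavelet \<Psi> k' \<nu>)) = (if k = k' \<and> \<mu> = \<nu> then 1 else 0)"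
  using assms
  by (simp add: wavelet_coeff_def torus_pair_L1_class integrable_periodized measurable_periodized
      periodized_orthogonal mult.commute)

text \<open>A continuous functional passes through the series, and orthogonality leaves one term.
  The random coefficients become functions of the sum alone, which is what a statement about its law
  requires.\<close>

lemma wavelet_coeff_series:
  assumes s: "summable (\<lambda>k. \<Sum>\<mu>\<in>Lam k. c k \<mu> *\<^sub>R L1_class (periodized_wavelet \<Psi> k \<mu>))" and \<mu>: "\<mu> \<in> Lam k"
  shows "wavelet_coeff k \<mu> (\<Sum>k. \<Sum>\<mu>\<in>Lam k. c k \<mu> *\<^sub>R L1_class (periodized_wavelet \<Psi> k \<mu>)) = c k \<mu>"
proof -
  interpret bounded_linear "wavelet_coeff k \<mu>" by (rule bounded_linear_wavelet_coeff[OF \<mu>])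
  have *: "wavelet_coeff k \<mu> (\<Sum>\<nu>\<in>Lam k'. c k' \<nu> *\<^sub>R L1_class (periodized_wavelet \<Psi> k' \<nu>)) =
     (if k' = k then c k \<mu> else 0)" for k'
  proof -
    have "wavelet_coeff k \<mu> (\<Sum>\<nu>\<in>Lam k'. c k' \<nu> *\<^sub>R L1_class (periodized_wavelet \<Psi> k' \<nu>)) =
      (\<Sum>\<nu>\<in>Lam k'. c k' \<nu> * (if k = k' \<and> \<mu> = \<nu> then 1 else 0))"
      unfolding sum scaleR by (rule sum.cong[OF refl]) (simp add: wavelet_coeff_periodized[OF \<mu>])
    also have "\<dots> = (\<Sum>\<nu>\<in>Lam k'. if \<nu> = \<mu> then (if k' = k then c k' \<nu> else 0) else 0)"
      by (rule sum.cong) auto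
    also have "\<dots> = (if k' = k then c k \<mu> else 0)" using \<mu> by simp
    finally show ?thesis .
  qed
  have "wavelet_coeff k \<mu> (\<Sum>k. \<Sum>\<mu>\<in>Lam k. c k \<mu> *\<^sub>R L1_class (periodized_wavelet \<Psi> k \<mu>)) =
     (\<Sum>k'. wavelet_coeff k \<mu> (\<Sum>\<nu>\<in>Lam k'. c k' \<nu> *\<^sub>R L1_class (periodized_wavelet \<Psi> k' \<nu>)))"
    by (rule suminf[OF s])
  also have "\<dots> = c k \<mu>" unfolding * by (rule sums_unique[symmetric, OF sums_single])
  finally show ?thesis .
qed

end

section \<open>Wavelet coefficients of Sobolev functions\<close>

text \<open>The half-open cube of side 2^(-k) with corner 2^(-k) m, written as a preimage so that
  its volume follows by affine substitution.\<close>

definition dyadic_cube :: "nat \<Rightarrow> int ^ 'n::finite \<Rightarrow> (real ^ 'n) set" where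
  "dyadic_cube k m = {y. - of_int_vec m + 2 ^ k *\<^sub>R y \<in> unit_cell}"

lemma measurable_dyadic_cube [measurable]: "dyadic_cube k m \<in> sets borel"
  unfolding dyadic_cube_def by measurable

lemma emeasure_dyadic_cube:
  "emeasure lborel (dyadic_cube k m :: (real ^ 'n::finite) set) = ennreal (1 / 2 ^ (k * CARD('n)))"
proof -
  have "emeasure lborel (dyadic_cube k m :: (real ^ 'n) set) =
      (\<integral>\<^sup>+y. indicator unit_cell (- of_int_vec m + 2 ^ k *\<^sub>R y) \<partial>(lborel :: (real ^ 'n) measure))"
    unfolding nn_integral_indicator[OF measurable_dyadic_cube[of k m, folded sets_lborel], symmetric]
    by (intro nn_integral_cong) (simp add: dyadic_cube_def indicator_def)
  also have "\<dots> = ennreal (1 / (2 ^ k) ^ CARD('n)) * (\<integral>\<^sup>+y. indicator unit_cell y \<partial>(lborel :: (real ^ 'n) measure))"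
    by (rule nn_integral_lborel_affine) auto
  finally show ?thesis by (simp add: emeasure_unit_cell power_mult)
qed

lemma dyadic_cube_sub:
  assumes "(e, m) \<in> Lam k"
  shows "dyadic_cube k m \<subseteq> unit_cell"
proof
  fix y assume y: "y \<in> dyadic_cube k m"
  have "0 \<le> y $ i \<and> y $ i < 1" for i
  proof -
    have "0 \<le> 2 ^ k * y $ i - of_int (m $ i)" "2 ^ k * y $ i - of_int (m $ i) < 1"
      using y by (auto simp: dyadic_cube_def unit_cell_def)
    moreover have "0 \<le> m $ i" "m $ i < 2 ^ k" using assms by (auto simp: Lam_def)
    then have "0 \<le> m $ i" "m $ i + 1 \<le> 2 ^ k" by linarith+
    then have "0 \<le> real_of_int (m $ i)" "real_of_int (m $ i + 1) \<le> real_of_int (2 ^ k)"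
      by (simp, simp only: of_int_le_iff)
    ultimately have "2 ^ k * 0 \<le> 2 ^ k * y $ i" "2 ^ k * y $ i < 2 ^ k * 1" by (simp_all only: of_int_add of_int_power of_int_numeral of_int_1)
    then show ?thesis unfolding mult_le_cancel_left mult_less_cancel_left by simp
  qed
  then show "y \<in> unit_cell" by (simp add: unit_cell_def)
qed

lemma dyadic_cube_disjoint:
  assumes "y \<in> dyadic_cube k m" "y \<in> dyadic_cube k m'"
  shows "m = m'"
proof -
  have "m $ i = m' $ i" for i
  proof -
    have "0 \<le> 2 ^ k * y $ i - of_int (m $ i)" "2 ^ k * y $ i - of_int (m $ i) < 1"
      "0 \<le> 2 ^ k * y $ i - of_int (m' $ i)" "2 ^ k * y $ i - of_int (m' $ i) < 1"
      using assms by (auto simp: dyadic_cube_def unit_cell_def)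
    then show ?thesis by linarith
  qed
  then show ?thesis by (simp add: vec_eq_iff)
qed

text \<open>For a fixed mother wavelet the cubes of one scale are disjoint, so a point lies in at
  most one cube per mother wavelet.\<close>

lemma sum_indicator_dyadic_cube_le:
  fixes y :: "real ^ 'n::finite"
  assumes S: "S \<subseteq> Lam k"
  shows "(\<Sum>\<mu>\<in>S. indicator (dyadic_cube k (snd \<mu>)) y :: ennreal) \<le> of_nat (2 ^ CARD('n) - 1) * indicator unit_cell y"
proof -
  have fin: "finite S" using S finite_subset finite_Lam by blast
  let ?T = "{\<mu> \<in> S. y \<in> dyadic_cube k (snd \<mu>)}"
  have sum: "(\<Sum>\<mu>\<in>S. indicator (dyadic_cube k (snd \<mu>)) y :: ennreal) = of_nat (card ?T)"
    using fin by (simp add: indicator_def sum.If_cases Int_def)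
  have inj: "inj_on fst ?T"
    by (rule inj_onI) (use dyadic_cube_disjoint in \<open>auto simp: prod_eq_iff\<close>)
  have "card ?T \<le> card {..<2 ^ CARD('n) - 1 :: nat}"
    by (rule card_inj_on_le[OF inj]) (use S in \<open>auto simp: Lam_def\<close>)
  then have le: "card ?T \<le> 2 ^ CARD('n) - 1" by simp
  show ?thesis
  proof (cases "y \<in> unit_cell")
    case True
    then show ?thesis unfolding sum using le by (simp only: indicator_simps mult_1_right of_nat_le_iff)
  next
    case False
    then have "?T = {}" using dyadic_cube_sub S by fastforce
    then show ?thesis unfolding sum by (simp only: card.empty) simp
  qed
qed

text \<open>Below the threshold the first term suffices; above it the factor (u / \<tau>)^(q - 1) is
  at least 1. It serves in place of Hoelder's inequality: after integration the Sobolev integral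
  occurs linearly, with a free parameter \<tau>.\<close>

lemma young_threshold:
  fixes u \<tau> q :: real
  assumes "0 \<le> u" "0 < \<tau>" "1 \<le> q"
  shows "u \<le> \<tau> + \<tau> powr (1 - q) * u powr q"
proof (cases "u \<le> \<tau>")
  case False
  then have u: "0 < u" using assms by simp
  have "1 \<le> (u / \<tau>) powr (q - 1)" using False assms by (intro ge_one_powr_ge_zero) auto
  then have "u * 1 \<le> u * (u / \<tau>) powr (q - 1)" using u by (intro mult_left_mono) auto
  also have "\<dots> = \<tau> powr (1 - q) * u powr q"
    using u assms by (simp add: powr_divide powr_diff field_simps)
  finally show ?thesis using assms by simp
qed (use assms in \<open>simp add: add_increasing2\<close>)

context lipschitz_wavelets
begin

text \<open>R / 2^k comes from the support of the wavelet and 1 / 2^k from the side of the cube,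
  both measured from the point 2^(-k) m; the dimension converts the coordinatewise bound to the
  norm.\<close>

lemma periodized_support_dist:
  assumes \<mu>: "\<mu> \<in> Lam k" and x: "x \<in> unit_cell" and nz: "periodized_wavelet \<Psi> k \<mu> x \<noteq> 0"
    and y: "y \<in> dyadic_cube k (snd \<mu>)"
  shows "torus_dist y x \<le> real CARD('n) * (real (R + 1) / 2 ^ k)"
proof -
  obtain e m where em: "\<mu> = (e, m)" by (cases \<mu>)
  have emL: "(e, m) \<in> Lam k" using \<mu> em by simp
  have "wavelet_sum \<Psi> (R + 4) k (e, m) x \<noteq> 0" using nz periodized_eq_sum_cell[OF \<mu> x] em by simp
  then obtain l where l: "\<Psi> e (2 ^ k *\<^sub>R (x - of_int_vec l) - of_int_vec m) \<noteq> 0"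
    unfolding wavelet_sum_def prod.case by (meson sum.neutral)
  have "y - x - of_int_vec (- l) \<in> real_box (real (R + 1) / 2 ^ k)"
  proof -
    have "\<bar>y $ i - x $ i + of_int (l $ i)\<bar> \<le> real (R + 1) / 2 ^ k" for i
    proof -
      have 1: "\<bar>(x $ i - of_int (l $ i)) - of_int (m $ i) / 2 ^ k\<bar> \<le> real R / 2 ^ k"
        using support_scaled(1)[OF emL l, of i] by simp
      have "0 \<le> 2 ^ k * y $ i - of_int (m $ i)" "2 ^ k * y $ i - of_int (m $ i) < 1"
        using y by (auto simp: dyadic_cube_def unit_cell_def em)
      then have "0 \<le> y $ i - of_int (m $ i) / 2 ^ k" "y $ i - of_int (m $ i) / 2 ^ k \<le> 1 / 2 ^ k"
      proof -
        assume *: "0 \<le> 2 ^ k * y $ i - of_int (m $ i)" "2 ^ k * y $ i - of_int (m $ i) < 1"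
        have eq: "y $ i - of_int (m $ i) / 2 ^ k = (2 ^ k * y $ i - of_int (m $ i)) / 2 ^ k"
          by (simp add: diff_divide_distrib)
        show "0 \<le> y $ i - of_int (m $ i) / 2 ^ k" "y $ i - of_int (m $ i) / 2 ^ k \<le> 1 / 2 ^ k"
          unfolding eq using * by (auto intro: divide_right_mono)
      qed
      moreover have "real (R + 1) / 2 ^ k = real R / 2 ^ k + 1 / 2 ^ k" by (simp add: add_divide_distrib)
      ultimately show ?thesis using 1 by linarith
    qed
    then show ?thesis by (simp add: real_box_def)
  qed
  from norm_le_card_sup[OF this] torus_dist_le[of y x "- l"] show ?thesis by linarith
qed

lemma periodized_L1_le:
  assumes \<mu>: "\<mu> \<in> Lam k"
  shows "(\<integral>\<^sup>+x. ennreal \<bar>periodized_wavelet \<Psi> k \<mu> x\<bar> \<partial>torus)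
    \<le> ennreal (overlap * (A * measure lborel (real_box (real R) :: (real ^ 'n) set)) / 2 ^ (k * CARD('n)))"
proof -
  have ov: "0 \<le> overlap" by (simp add: overlap_def)
  let ?c = "\<lambda>\<nu>. if \<nu> = \<mu> then 1 else 0 :: real"
  have "(\<integral>\<^sup>+x. ennreal \<bar>periodized_wavelet \<Psi> k \<mu> x\<bar> \<partial>torus) = (\<integral>\<^sup>+x. ennreal (\<bar>synthesis k ?c x\<bar> powr 1) \<partial>torus)"
    by (rule nn_integral_cong)
      (use \<mu> in \<open>simp add: space_torus periodized_eq_sum_cell synthesis_def if_distrib[of "\<lambda>c. c * _"] cong: if_cong\<close>)
  also have "\<dots> \<le> ennreal (overlap powr 1 * (A powr 1 * measure lborel (real_box (real R) :: (real ^ 'n) set)) *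
        ((\<Sum>\<nu>\<in>Lam k. \<bar>?c \<nu>\<bar> powr 1) / 2 ^ (k * CARD('n))))"
    by (rule synthesis_powr_le) simp
  also have "(\<Sum>\<nu>\<in>Lam k. \<bar>?c \<nu>\<bar> powr 1) = 1"
    using \<mu> by (simp add: if_distrib[of abs] cong: if_cong)
  finally show ?thesis using A_pos ov by simp
qed

text \<open>By the vanishing mean, the coefficient is 2^(kn) times the integral of (f x - f y) times
  the wavelet, for every y. Splitting the increment at a threshold proportional to \<theta> makes
  the small part contribute at most \<theta> / 2. For the large part, distances to the support are
  at most \<rho> / 2^k, so inserting the kernel gains 2^(-k(\<alpha> q + n)), whose factor 2^(-kn)
  cancels the normalisation. Since y is arbitrary in the cube, the bound can afterwards be
  integrated over y.\<close>

lemma coefficient_pointwise_le: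
  assumes q: "1 < q" and \<alpha>: "0 < \<alpha>"
  shows "\<exists>C>0. \<forall>k \<mu> \<theta> f y. \<mu> \<in> Lam k \<longrightarrow> integrable torus f \<longrightarrow> 0 < \<theta> \<longrightarrow>
    \<theta> \<le> \<bar>2 ^ (k * CARD('n)) * (LINT x|torus. f x * periodized_wavelet \<Psi> k \<mu> x)\<bar> \<longrightarrow>
    y \<in> dyadic_cube k (snd \<mu>) \<longrightarrow>
    ennreal (\<theta> powr q) \<le> ennreal (C * 2 powr (- \<alpha> * q * real k)) *
      (\<integral>\<^sup>+x. ennreal (\<bar>f y - f x\<bar> powr q / torus_dist y x powr (\<alpha> * q + real CARD('n))) \<partial>torus)"
proof -
  let ?n = "real CARD('n)"
  let ?t = "\<alpha> * q + ?n"
  define A' where "A' = A * real (card (int_box (R + 4) :: (int ^ 'n) set))"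
  have "(0 :: int ^ 'n) \<in> int_box (R + 4)" by (simp add: int_box_def)
  then have "0 < card (int_box (R + 4) :: (int ^ 'n) set)" by (subst card_gt_0_iff) auto
  then have A': "0 < A'" unfolding A'_def using A_pos by (intro mult_pos_pos) (simp_all only: of_nat_0_less_iff)
  \<comment> \<open>\<open>C1\<close> divided by 2^(kn) bounds the L^1 norm of the wavelet; the
    summand 1 keeps \<open>C1\<close> positive for the division below.\<close>
  define C1 where "C1 = overlap * (A * measure lborel (real_box (real R) :: (real ^ 'n) set)) + 1"
  have C1: "0 < C1" using A_pos by (auto simp: C1_def overlap_def intro!: add_nonneg_pos mult_nonneg_nonneg)
  define \<rho> where "\<rho> = ?n * real (R + 1)"
  have \<rho>: "0 < \<rho>" by (simp add: \<rho>_def)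
  have t: "0 < ?t" using q \<alpha> by (simp add: add_pos_pos)
  define C where "C = 2 * (2 * C1) powr (q - 1) * A' * \<rho> powr ?t"
  have C: "0 < C" using C1 A' \<rho> by (simp add: C_def)
  have main: "ennreal (\<theta> powr q) \<le> ennreal (C * 2 powr (- \<alpha> * q * real k)) *
      (\<integral>\<^sup>+x. ennreal (\<bar>f y - f x\<bar> powr q / torus_dist y x powr ?t) \<partial>torus)"
    if \<mu>: "\<mu> \<in> Lam k" and f: "integrable torus f" and \<theta>: "0 < \<theta>"
      and le: "\<theta> \<le> \<bar>2 ^ (k * CARD('n)) * (LINT x|torus. f x * periodized_wavelet \<Psi> k \<mu> x)\<bar>"
      and y: "y \<in> dyadic_cube k (snd \<mu>)"
    for k \<mu> \<theta> f y
  proof -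
    let ?\<psi> = "periodized_wavelet \<Psi> k \<mu>"
    let ?N = "2 ^ (k * CARD('n)) :: real"
    have [measurable]: "f \<in> borel_measurable torus" using f by auto
    note [measurable] = measurable_periodized[OF \<mu>]
    have yc: "y \<in> unit_cell" using dyadic_cube_sub[of "fst \<mu>" "snd \<mu>" k] \<mu> y by auto
    define V where "V = (\<integral>\<^sup>+x. ennreal (\<bar>f y - f x\<bar> powr q / torus_dist y x powr ?t) \<partial>torus)"
    have kern: "(\<lambda>x. ennreal (\<bar>f y - f x\<bar> powr q / torus_dist y x powr ?t)) \<in> borel_measurable torus"
      by (rule measurable_sobolev_kernel_snd) (use yc in \<open>auto simp: space_torus\<close>)
    have i1: "integrable torus (\<lambda>x. f x * ?\<psi> x)"
      by (rule integrable_mult_bounded[OF f measurable_periodized[OF \<mu>] abs_periodized_le[OF \<mu>]]) (simp add: space_torus)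
    have i2: "integrable torus (\<lambda>x. f y * ?\<psi> x)" using integrable_periodized[OF \<mu>] by simp
    \<comment> \<open>Chosen so that 2^(kn) \<tau> times the L^1 bound \<open>C1 / ?N\<close> equals
      \<theta> / 2.\<close>
    define \<tau> where "\<tau> = \<theta> / (2 * C1)"
    have \<tau>: "0 < \<tau>" using \<theta> C1 by (simp add: \<tau>_def)
    define X where "X = \<tau> powr (1 - q) * A' * (\<rho> / 2 ^ k) powr ?t"
    have X: "0 \<le> X" using A' by (simp add: X_def)
    have pw: "ennreal (norm (f x * ?\<psi> x - f y * ?\<psi> x)) \<le> ennreal \<tau> * ennreal \<bar>?\<psi> x\<bar> +
        ennreal X * ennreal (\<bar>f y - f x\<bar> powr q / torus_dist y x powr ?t)" if x: "x \<in> unit_cell" for x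
    proof (cases "?\<psi> x = 0")
      case False
      let ?u = "\<bar>f y - f x\<bar>"
      have "norm (f x * ?\<psi> x - f y * ?\<psi> x) = ?u * \<bar>?\<psi> x\<bar>"
        by (simp add: left_diff_distrib[symmetric] abs_mult abs_minus_commute)
      also have "\<dots> \<le> (\<tau> + \<tau> powr (1 - q) * ?u powr q) * \<bar>?\<psi> x\<bar>"
        using \<tau> q by (intro mult_right_mono young_threshold) auto
      also have "\<dots> = \<tau> * \<bar>?\<psi> x\<bar> + \<tau> powr (1 - q) * ?u powr q * \<bar>?\<psi> x\<bar>" by (simp add: distrib_right)
      also have "\<tau> powr (1 - q) * ?u powr q * \<bar>?\<psi> x\<bar> \<le> X * (?u powr q / torus_dist y x powr ?t)"
      \<comment> \<open>Division by 0 makes the kernel 0 here, so it cannot dominate by its size;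
        but distance 0 inside the cell forces y = x, and then the left side is 0 as well.\<close>
      proof (cases "torus_dist y x = 0")
        case True
        then have "y = x" using torus_dist_eq_0[OF yc x] by simp
        then show ?thesis by simp
      next
        case nz: False
        have "torus_dist y x powr ?t \<le> (\<rho> / 2 ^ k) powr ?t"
          using t periodized_support_dist[OF \<mu> x False y] torus_dist_nonneg
          by (intro powr_mono2) (auto simp: \<rho>_def)
        then have "A' * torus_dist y x powr ?t \<le> A' * (\<rho> / 2 ^ k) powr ?t"
          using A' by (intro mult_left_mono) auto
        moreover have "\<bar>?\<psi> x\<bar> * torus_dist y x powr ?t \<le> A' * torus_dist y x powr ?t"
          using abs_periodized_le[OF \<mu> x] by (intro mult_right_mono) (auto simp: A'_def)
        ultimately have *: "\<bar>?\<psi> x\<bar> * torus_dist y x powr ?t \<le> A' * (\<rho> / 2 ^ k) powr ?t" by simp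
        have d: "0 < torus_dist y x powr ?t" using nz torus_dist_nonneg[of y x] by simp
        have "\<tau> powr (1 - q) * ?u powr q * \<bar>?\<psi> x\<bar> =
            (\<tau> powr (1 - q) * (?u powr q / torus_dist y x powr ?t)) * (\<bar>?\<psi> x\<bar> * torus_dist y x powr ?t)"
          using d by (simp add: field_simps)
        also have "\<dots> \<le> (\<tau> powr (1 - q) * (?u powr q / torus_dist y x powr ?t)) * (A' * (\<rho> / 2 ^ k) powr ?t)"
          using * by (intro mult_left_mono) auto
        also have "\<dots> = X * (?u powr q / torus_dist y x powr ?t)" by (simp add: X_def)
        finally show ?thesis .
      qed
      finally have "norm (f x * ?\<psi> x - f y * ?\<psi> x) \<le> \<tau> * \<bar>?\<psi> x\<bar> + X * (?u powr q / torus_dist y x powr ?t)"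
        by simp
      then have "ennreal (norm (f x * ?\<psi> x - f y * ?\<psi> x)) \<le> ennreal (\<tau> * \<bar>?\<psi> x\<bar> + X * (?u powr q / torus_dist y x powr ?t))"
        by (rule ennreal_leI)
      also have "\<dots> = ennreal \<tau> * ennreal \<bar>?\<psi> x\<bar> + ennreal X * ennreal (?u powr q / torus_dist y x powr ?t)"
      proof -
        have split: "ennreal (\<tau> * a + X * z) = ennreal \<tau> * ennreal a + ennreal X * ennreal z" if "0 \<le> a" "0 \<le> z" for a z
          using \<tau> X that by (simp add: ennreal_plus ennreal_mult)
        show ?thesis by (rule split) auto
      qed
      finally show ?thesis .
    qed simp
    have "(LINT x|torus. f x * ?\<psi> x) = (LINT x|torus. f x * ?\<psi> x - f y * ?\<psi> x)"
      by (subst Bochner_Integration.integral_diff[OF i1 i2]) (simp add: periodized_integral_zero[OF \<mu>])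
    then have "ennreal \<bar>LINT x|torus. f x * ?\<psi> x\<bar> \<le> (\<integral>\<^sup>+x. ennreal (norm (f x * ?\<psi> x - f y * ?\<psi> x)) \<partial>torus)"
      using integral_norm_bound_ennreal[OF Bochner_Integration.integrable_diff[OF i1 i2]] by simp
    also have "\<dots> \<le> (\<integral>\<^sup>+x. ennreal \<tau> * ennreal \<bar>?\<psi> x\<bar> +
        ennreal X * ennreal (\<bar>f y - f x\<bar> powr q / torus_dist y x powr ?t) \<partial>torus)"
      by (rule nn_integral_mono) (rule pw, simp add: space_torus)
    also have "\<dots> = ennreal \<tau> * (\<integral>\<^sup>+x. ennreal \<bar>?\<psi> x\<bar> \<partial>torus) + ennreal X * V"
    proof -
      have abs: "(\<lambda>x. ennreal \<bar>?\<psi> x\<bar>) \<in> borel_measurable torus" by measurable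
      show ?thesis
        unfolding V_def nn_integral_cmult[OF abs, symmetric] nn_integral_cmult[OF kern, symmetric]
        by (intro nn_integral_add borel_measurable_times_ennreal borel_measurable_const abs kern)
    qed
    also have "\<dots> \<le> ennreal \<tau> * ennreal (C1 / ?N) + ennreal X * V"
    proof -
      have "(\<integral>\<^sup>+x. ennreal \<bar>?\<psi> x\<bar> \<partial>torus) \<le> ennreal (C1 / ?N)"
        by (rule order_trans[OF periodized_L1_le[OF \<mu>]], rule ennreal_leI, rule divide_right_mono) (auto simp: C1_def)
      then show ?thesis by (intro add_right_mono mult_left_mono) auto
    qed
    finally have bound: "ennreal \<bar>LINT x|torus. f x * ?\<psi> x\<bar> \<le> ennreal \<tau> * ennreal (C1 / ?N) + ennreal X * V" .
    show ?thesis
    proof (cases "V = \<top>")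
      case True
      have "0 < C * 2 powr (- \<alpha> * q * real k)" using C by simp
      then show ?thesis using True C unfolding V_def[symmetric] by (simp add: ennreal_mult_top)
    next
      case False
      then obtain v where v: "V = ennreal v" "0 \<le> v" by (cases V) auto
      have "ennreal \<bar>LINT x|torus. f x * ?\<psi> x\<bar> \<le> ennreal (\<tau> * (C1 / ?N) + X * v)"
        using bound v \<tau> C1 X by (simp add: ennreal_mult[symmetric] ennreal_plus[symmetric] del: ennreal_plus)
      then have "\<bar>LINT x|torus. f x * ?\<psi> x\<bar> \<le> \<tau> * (C1 / ?N) + X * v"
        using \<tau> C1 X v by (subst (asm) ennreal_le_iff) (auto intro!: add_nonneg_nonneg)
      then have "?N * \<bar>LINT x|torus. f x * ?\<psi> x\<bar> \<le> ?N * (\<tau> * (C1 / ?N) + X * v)" by (intro mult_left_mono) auto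
      also have "\<dots> = \<theta> / 2 + ?N * X * v" using C1 by (simp add: \<tau>_def field_simps)
      finally have "\<theta> \<le> \<theta> / 2 + ?N * X * v" using le by (simp add: abs_mult)
      then have half: "\<theta> \<le> 2 * ?N * X * v" by simp
      have "\<theta> powr q = \<theta> powr (q - 1) * \<theta>" using \<theta> by (simp add: powr_diff)
      also have "\<dots> \<le> \<theta> powr (q - 1) * (2 * ?N * X * v)" using half by (intro mult_left_mono) auto
      also have "\<dots> = C * 2 powr (- \<alpha> * q * real k) * v"
      proof -
        have 1: "\<theta> powr (q - 1) * \<tau> powr (1 - q) = (2 * C1) powr (q - 1)"
          using \<theta> C1 by (simp add: \<tau>_def powr_divide powr_diff field_simps)
        have 2: "?N * (\<rho> / 2 ^ k) powr ?t = \<rho> powr ?t * 2 powr (- \<alpha> * q * real k)"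
        proof -
          have "(\<rho> / 2 ^ k) powr ?t = \<rho> powr ?t / (2 powr real k) powr ?t"
            using \<rho> by (simp add: powr_divide powr_realpow)
          also have "\<dots> = \<rho> powr ?t * 2 powr (- (real k * ?t))"
            by (simp only: powr_powr powr_minus divide_inverse)
          finally have "?N * (\<rho> / 2 ^ k) powr ?t = \<rho> powr ?t * (2 powr (real (k * CARD('n))) * 2 powr (- (real k * ?t)))"
          proof -
            have "?N = 2 powr (real (k * CARD('n)))" by (rule powr_realpow[symmetric]) simp
            moreover assume "(\<rho> / 2 ^ k) powr ?t = \<rho> powr ?t * 2 powr (- (real k * ?t))"
            ultimately show ?thesis by (simp only: mult.left_commute)
          qed
          also have "2 powr (real (k * CARD('n))) * 2 powr (- (real k * ?t)) = (2::real) powr (- \<alpha> * q * real k)"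
            by (simp add: powr_add[symmetric] algebra_simps)
          finally show ?thesis .
        qed
        have "\<theta> powr (q - 1) * (2 * ?N * X * v) =
            2 * (\<theta> powr (q - 1) * \<tau> powr (1 - q)) * A' * (?N * (\<rho> / 2 ^ k) powr ?t) * v"
          by (simp add: X_def)
        also have "\<dots> = C * 2 powr (- \<alpha> * q * real k) * v" unfolding 1 2 by (simp add: C_def)
        finally show ?thesis .
      qed
      finally have "ennreal (\<theta> powr q) \<le> ennreal (C * 2 powr (- \<alpha> * q * real k) * v)" by (rule ennreal_leI)
      also have "\<dots> = ennreal (C * 2 powr (- \<alpha> * q * real k)) * V" using v C by (simp add: ennreal_mult)
      finally show ?thesis by (simp add: V_def)
    qed
  qed
  show ?thesis by (rule exI[of _ C]) (use C main in blast)
qed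

text \<open>A Chebyshev-type count: the pointwise bound is integrated over the dyadic cube of every
  large coefficient, each of volume 2^(-kn). Since the cubes of one scale cover a point at most 2^n
  - 1 times, the total stays below a multiple of the full double integral.\<close>

lemma large_coefficients_le:
  assumes q: "1 < q" and \<alpha>: "0 < \<alpha>"
  shows "\<exists>C>0. \<forall>k \<theta> f. integrable torus f \<longrightarrow> 0 < \<theta> \<longrightarrow>
    ennreal (real (card {\<mu> \<in> Lam k. \<theta> \<le> \<bar>wavelet_coeff k \<mu> (L1_class f)\<bar>}) * \<theta> powr q / 2 ^ (k * CARD('n)))
    \<le> ennreal (C * 2 powr (- \<alpha> * q * real k)) * sobolev_integral \<alpha> q f"
proof -
  obtain C where C: "0 < C" and CI: "\<And>k \<mu> \<theta> f y. \<mu> \<in> Lam k \<Longrightarrow> integrable torus f \<Longrightarrow> 0 < \<theta> \<Longrightarrow>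
    \<theta> \<le> \<bar>2 ^ (k * CARD('n)) * (LINT x|torus. f x * periodized_wavelet \<Psi> k \<mu> x)\<bar> \<Longrightarrow>
    y \<in> dyadic_cube k (snd \<mu>) \<Longrightarrow>
    ennreal (\<theta> powr q) \<le> ennreal (C * 2 powr (- \<alpha> * q * real k)) *
      (\<integral>\<^sup>+x. ennreal (\<bar>f y - f x\<bar> powr q / torus_dist y x powr (\<alpha> * q + real CARD('n))) \<partial>torus)"
    using coefficient_pointwise_le[OF assms] by blast
  let ?E = "2 ^ CARD('n) - 1 :: nat"
  have main: "ennreal (real (card {\<mu> \<in> Lam k. \<theta> \<le> \<bar>wavelet_coeff k \<mu> (L1_class f)\<bar>}) * \<theta> powr q / 2 ^ (k * CARD('n)))
    \<le> ennreal (real ?E * C * 2 powr (- \<alpha> * q * real k)) * sobolev_integral \<alpha> q f"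
    if f: "integrable torus f" and \<theta>: "0 < \<theta>" for k \<theta> f
  proof -
    define S where "S = {\<mu> \<in> Lam k. \<theta> \<le> \<bar>wavelet_coeff k \<mu> (L1_class f)\<bar>}"
    have finS: "finite S" unfolding S_def using finite_Lam by auto
    have SL: "S \<subseteq> Lam k" by (auto simp: S_def)
    have fm: "f \<in> borel_measurable torus" using f by auto
    define V where "V y = (\<integral>\<^sup>+x. ennreal (\<bar>f y - f x\<bar> powr q / torus_dist y x powr (\<alpha> * q + real CARD('n))) \<partial>torus)" for y
    have Vm [measurable]: "V \<in> borel_measurable torus"
      unfolding V_def by (rule measurable_sobolev_kernel_integral[OF fm])
    define D where "D = ennreal (C * 2 powr (- \<alpha> * q * real k))"
    have cube: "ennreal (\<theta> powr q / 2 ^ (k * CARD('n))) \<le>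
        (\<integral>\<^sup>+y. D * V y * indicator (dyadic_cube k (snd \<mu>)) y \<partial>torus)" if \<mu>: "\<mu> \<in> S" for \<mu>
    proof -
      have \<mu>L: "\<mu> \<in> Lam k" and le: "\<theta> \<le> \<bar>2 ^ (k * CARD('n)) * (LINT x|torus. f x * periodized_wavelet \<Psi> k \<mu> x)\<bar>"
        using \<mu> f by (auto simp: S_def wavelet_coeff_def torus_pair_L1_class measurable_periodized)
      have "ennreal (\<theta> powr q / 2 ^ (k * CARD('n))) = ennreal (\<theta> powr q) * emeasure lborel (dyadic_cube k (snd \<mu>))"
        by (simp add: emeasure_dyadic_cube ennreal_mult[symmetric])
      also have "\<dots> = (\<integral>\<^sup>+y. ennreal (\<theta> powr q) * indicator (dyadic_cube k (snd \<mu>)) y \<partial>lborel)"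
        by (subst nn_integral_cmult_indicator) auto
      also have "\<dots> = (\<integral>\<^sup>+y. ennreal (\<theta> powr q) * indicator (dyadic_cube k (snd \<mu>)) y * indicator unit_cell y \<partial>lborel)"
        using dyadic_cube_sub[of "fst \<mu>" "snd \<mu>" k] \<mu>L
        by (intro nn_integral_cong) (auto split: split_indicator)
      also have "\<dots> = (\<integral>\<^sup>+y. ennreal (\<theta> powr q) * indicator (dyadic_cube k (snd \<mu>)) y \<partial>torus)"
        by (rule nn_integral_torus[symmetric])
      also have "\<dots> \<le> (\<integral>\<^sup>+y. D * V y * indicator (dyadic_cube k (snd \<mu>)) y \<partial>torus)"
        using CI[OF \<mu>L f \<theta> le] by (intro nn_integral_mono) (auto simp: D_def V_def split: split_indicator)
      finally show ?thesis .
    qed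
    have cm [measurable]: "indicator (dyadic_cube k m) \<in> borel_measurable torus" for m :: "int ^ 'n"
      by (rule measurable_torus) simp
    have "ennreal (real (card S) * \<theta> powr q / 2 ^ (k * CARD('n))) = (\<Sum>\<mu>\<in>S. ennreal (\<theta> powr q / 2 ^ (k * CARD('n))))"
      by (simp add: ennreal_of_nat_eq_real_of_nat ennreal_mult[symmetric])
    also have "\<dots> \<le> (\<Sum>\<mu>\<in>S. \<integral>\<^sup>+y. D * V y * indicator (dyadic_cube k (snd \<mu>)) y \<partial>torus)"
      by (rule sum_mono) (rule cube)
    also have "\<dots> = (\<integral>\<^sup>+y. (\<Sum>\<mu>\<in>S. D * V y * indicator (dyadic_cube k (snd \<mu>)) y) \<partial>torus)"
      by (rule nn_integral_sum[symmetric]) measurable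
    also have "\<dots> \<le> (\<integral>\<^sup>+y. (D * of_nat ?E) * V y \<partial>torus)"
    proof (rule nn_integral_mono)
      fix y :: "real ^ 'n" assume "y \<in> space torus"
      have "(\<Sum>\<mu>\<in>S. D * V y * indicator (dyadic_cube k (snd \<mu>)) y) = D * V y * (\<Sum>\<mu>\<in>S. indicator (dyadic_cube k (snd \<mu>)) y)"
        by (rule sum_distrib_left[symmetric])
      also have "\<dots> \<le> D * V y * (of_nat ?E * 1)"
      proof (rule mult_left_mono[OF order_trans[OF sum_indicator_dyadic_cube_le[OF SL, of y]]])
        show "of_nat ?E * indicator unit_cell y \<le> (of_nat ?E * 1 :: ennreal)"
          by (rule mult_left_mono) (auto simp: indicator_def)
      qed simp
      finally show "(\<Sum>\<mu>\<in>S. D * V y * indicator (dyadic_cube k (snd \<mu>)) y) \<le> (D * of_nat ?E) * V y"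
        by (simp add: mult_ac)
    qed
    also have "\<dots> = (D * of_nat ?E) * sobolev_integral \<alpha> q f"
      unfolding sobolev_integral_def V_def[symmetric] by (rule nn_integral_cmult) measurable
    also have "D * of_nat ?E = ennreal (real ?E * C * 2 powr (- \<alpha> * q * real k))"
      using C by (simp only: D_def ennreal_of_nat_eq_real_of_nat) (subst ennreal_mult[symmetric], auto simp: mult_ac)
    finally show ?thesis by (simp add: S_def)
  qed
  have "(2::nat) ^ 1 \<le> 2 ^ CARD('n)" by (rule power_increasing) auto
  then have "1 \<le> ?E" by simp
  then have "0 < real ?E * C" using C by (intro mult_pos_pos) auto
  then show ?thesis using main by blast
qed

lemma not_sobolev_of_large_coefficients:
  assumes q: "1 < q" and \<alpha>: "0 < \<alpha>" and \<eta>: "0 < \<eta>" and a: "0 < a" and rate: "0 < \<alpha> * q + b * q - d"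
    and ev: "\<forall>\<^sub>F k in sequentially. \<eta> * 2 powr ((real CARD('n) - d) * real k) \<le>
      real (card {\<mu> \<in> Lam k. a * 2 powr (b * real k) \<le> \<bar>wavelet_coeff k \<mu> f\<bar>})"
  shows "\<not> is_sobolev \<alpha> q f"
proof
  assume W: "is_sobolev \<alpha> q f"
  obtain g where g: "integrable torus g" "f = L1_class g" using L1_class_surj by blast
  have "sobolev_integral \<alpha> q g < \<infinity>" using W g by (simp add: is_sobolev_L1_class)
  then obtain S where S: "sobolev_integral \<alpha> q g = ennreal S" "0 \<le> S" by (cases "sobolev_integral \<alpha> q g") auto
  obtain C where C: "0 < C" and CI: "\<And>k \<theta> f. integrable torus f \<Longrightarrow> 0 < \<theta> \<Longrightarrow>
    ennreal (real (card {\<mu> \<in> Lam k. \<theta> \<le> \<bar>wavelet_coeff k \<mu> (L1_class f)\<bar>}) * \<theta> powr q / 2 ^ (k * CARD('n)))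
    \<le> ennreal (C * 2 powr (- \<alpha> * q * real k)) * sobolev_integral \<alpha> q f"
    using large_coefficients_le[OF q \<alpha>] by blast
  \<comment> \<open>\<open>r\<close> is the exponent left when the count, the size and the volume
    2^(-kn) are set against the decay 2^(-\<alpha> q k); for positive \<open>r\<close> the left side
    is unbounded in k while the right side stays at \<open>C * S\<close>.\<close>
  define r where "r = \<alpha> * q + b * q - d"
  have le: "\<forall>\<^sub>F k in sequentially. \<eta> * a powr q * 2 powr (r * real k) \<le> C * S"
    using ev
  proof eventually_elim
    case (elim k)
    define N where "N = real (card {\<mu> \<in> Lam k. a * 2 powr (b * real k) \<le> \<bar>wavelet_coeff k \<mu> f\<bar>})"
    let ?\<theta> = "a * 2 powr (b * real k)"
    have "ennreal (N * ?\<theta> powr q / 2 ^ (k * CARD('n))) \<le> ennreal (C * 2 powr (- \<alpha> * q * real k)) * ennreal S"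
      using CI[OF g(1), of ?\<theta> k] a S by (simp add: N_def g(2))
    also have "\<dots> = ennreal (C * 2 powr (- \<alpha> * q * real k) * S)" using C S by (simp add: ennreal_mult)
    finally have 1: "N * ?\<theta> powr q / 2 ^ (k * CARD('n)) \<le> C * 2 powr (- \<alpha> * q * real k) * S"
      using C S by (subst (asm) ennreal_le_iff) auto
    have \<theta>q: "?\<theta> powr q = a powr q * 2 powr (b * q * real k)"
      using a by (simp add: powr_mult powr_powr mult_ac)
    have pn: "(2::real) ^ (k * CARD('n)) = 2 powr (real CARD('n) * real k)"
      by (simp add: powr_realpow[symmetric] mult.commute)
    have "\<eta> * a powr q * 2 powr (r * real k) = (\<eta> * 2 powr ((real CARD('n) - d) * real k)) *
        ?\<theta> powr q / 2 ^ (k * CARD('n)) * 2 powr (\<alpha> * q * real k)"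
    proof -
      have "2 powr (r * real k) * 2 powr (real CARD('n) * real k) =
          2 powr ((real CARD('n) - d) * real k) * 2 powr (b * q * real k) * (2::real) powr (\<alpha> * q * real k)"
        by (simp add: powr_add[symmetric] r_def algebra_simps)
      then have "2 powr (r * real k) = 2 powr ((real CARD('n) - d) * real k) * 2 powr (b * q * real k) *
          (2::real) powr (\<alpha> * q * real k) / 2 powr (real CARD('n) * real k)"
        by (simp add: eq_divide_eq)
      then show ?thesis unfolding \<theta>q pn by (simp add: mult_ac)
    qed
    also have "\<dots> \<le> N * ?\<theta> powr q / 2 ^ (k * CARD('n)) * 2 powr (\<alpha> * q * real k)"
      using elim by (intro mult_right_mono divide_right_mono) (auto simp: N_def)
    also have "\<dots> \<le> C * 2 powr (- \<alpha> * q * real k) * S * 2 powr (\<alpha> * q * real k)"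
      using 1 by (intro mult_right_mono) auto
    also have "\<dots> = C * S * (2 powr (- \<alpha> * q * real k) * 2 powr (\<alpha> * q * real k))" by (simp add: mult_ac)
    also have "2 powr (- \<alpha> * q * real k) * 2 powr (\<alpha> * q * real k) = (1::real)"
      by (simp add: powr_add[symmetric])
    finally show ?case by simp
  qed
  have r: "0 < r" using rate by (simp add: r_def)
  have gt1: "1 < (2::real) powr r" using r by simp
  obtain N where N: "C * S / (\<eta> * a powr q) + 1 < (2 powr r) ^ N" using real_arch_pow[OF gt1] by blast
  have "C * S / (\<eta> * a powr q) + 1 \<le> (2 powr r) ^ k" if "N \<le> k" for k
    using N power_increasing[OF that, of "2 powr r"] gt1 by linarith
  then have "\<forall>\<^sub>F k in sequentially. C * S / (\<eta> * a powr q) + 1 \<le> (2 powr r) ^ k"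
    unfolding eventually_sequentially by blast
  with le have "\<forall>\<^sub>F k in sequentially. False"
  proof eventually_elim
    case (elim k)
    have pos: "0 < \<eta> * a powr q" using \<eta> a by simp
    have "(2 powr r) ^ k = (2::real) powr (r * real k)" by (simp add: powr_realpow[symmetric] powr_powr)
    with elim(2) have "C * S / (\<eta> * a powr q) + 1 \<le> 2 powr (r * real k)" by simp
    then have "\<eta> * a powr q * (C * S / (\<eta> * a powr q) + 1) \<le> \<eta> * a powr q * 2 powr (r * real k)"
      using pos by (intro mult_left_mono) auto
    also have "\<dots> \<le> C * S" by (rule elim(1))
    finally have "C * S + \<eta> * a powr q \<le> C * S"
      using pos unfolding distrib_left times_divide_eq_right nonzero_mult_div_cancel_left[OF less_imp_neq[OF pos, symmetric]] by simp
    then show False using pos by simp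
  qed
  then show False by simp
qed

end

section \<open>Borel measurability in \<open>L\<^sup>1\<close>\<close>

lemma sobolev_integral_mono:
  fixes f :: "real ^ 'n::finite \<Rightarrow> real"
  assumes f: "f \<in> borel_measurable torus" and \<alpha>: "\<alpha> \<le> \<alpha>'" and q: "0 < q"
  shows "sobolev_integral \<alpha> q f \<le> ennreal (real CARD('n) powr ((\<alpha>' - \<alpha>) * q)) * sobolev_integral \<alpha>' q f"
proof -
  let ?n = "real CARD('n)"
  let ?K = "?n powr ((\<alpha>' - \<alpha>) * q)"
  let ?k = "\<lambda>\<alpha> x y. ennreal (\<bar>f x - f y\<bar> powr q / torus_dist x y powr (\<alpha> * q + ?n))"
  have pw: "?k \<alpha> x y \<le> ennreal ?K * ?k \<alpha>' x y" if x: "x \<in> unit_cell" and y: "y \<in> unit_cell" for x y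
  proof (cases "torus_dist x y = 0")
    case False
    then have d: "0 < torus_dist x y" using torus_dist_nonneg[of x y] by simp
    have "torus_dist x y powr ((\<alpha>' - \<alpha>) * q) \<le> ?K"
      using d torus_dist_le_card[OF x y] \<alpha> q by (intro powr_mono2) auto
    then have "torus_dist x y powr ((\<alpha>' - \<alpha>) * q) / torus_dist x y powr (\<alpha>' * q + ?n) \<le> ?K / torus_dist x y powr (\<alpha>' * q + ?n)"
      by (intro divide_right_mono) auto
    moreover have "torus_dist x y powr ((\<alpha>' - \<alpha>) * q) / torus_dist x y powr (\<alpha>' * q + ?n) = 1 / torus_dist x y powr (\<alpha> * q + ?n)"
      using d by (simp add: powr_diff[symmetric] powr_minus_divide[symmetric] algebra_simps)
    ultimately have "\<bar>f x - f y\<bar> powr q * (1 / torus_dist x y powr (\<alpha> * q + ?n)) \<le>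
        \<bar>f x - f y\<bar> powr q * (?K / torus_dist x y powr (\<alpha>' * q + ?n))"
      by (intro mult_left_mono) auto
    then have "?k \<alpha> x y \<le> ennreal (?K * (\<bar>f x - f y\<bar> powr q / torus_dist x y powr (\<alpha>' * q + ?n)))"
      by (intro ennreal_leI) (simp add: mult_ac)
    also have "\<dots> = ennreal ?K * ?k \<alpha>' x y" by (rule ennreal_mult) auto
    finally show ?thesis .
  qed simp
  have "sobolev_integral \<alpha> q f \<le> (\<integral>\<^sup>+x. ennreal ?K * (\<integral>\<^sup>+y. ?k \<alpha>' x y \<partial>torus) \<partial>torus)"
    unfolding sobolev_integral_def
  proof (rule nn_integral_mono)
    fix x :: "real ^ 'n" assume x: "x \<in> space torus"
    have "(\<integral>\<^sup>+y. ?k \<alpha> x y \<partial>torus) \<le> (\<integral>\<^sup>+y. ennreal ?K * ?k \<alpha>' x y \<partial>torus)"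
      using x by (intro nn_integral_mono pw) (auto simp: space_torus)
    then show "(\<integral>\<^sup>+y. ?k \<alpha> x y \<partial>torus) \<le> ennreal ?K * (\<integral>\<^sup>+y. ?k \<alpha>' x y \<partial>torus)"
      by (simp add: nn_integral_cmult[OF measurable_sobolev_kernel_snd[OF f x]])
  qed
  also have "\<dots> = ennreal ?K * sobolev_integral \<alpha>' q f"
    unfolding sobolev_integral_def by (rule nn_integral_cmult[OF measurable_sobolev_kernel_integral[OF f]])
  finally show ?thesis .
qed

text \<open>The torus has finite diameter, so lowering the exponent only costs a constant. This
  reduces the continuum of exponents below \<open>s\<close> to a sequence tending to
  \<open>s\<close>, for which almost sure statements can be intersected.\<close>

lemma W_space_antimono:
  fixes f :: "'n::finite L1_torus"
  assumes "f \<in> W_space \<alpha>' q" "\<alpha> \<le> \<alpha>'" "0 < q"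
  shows "f \<in> W_space \<alpha> q"
proof -
  obtain g where g: "integrable torus g" "f = L1_class g" using L1_class_surj by blast
  then have "g \<in> borel_measurable torus" by auto
  from sobolev_integral_mono[OF this assms(2,3)] assms(1) g show ?thesis
    by (auto simp: W_space_def is_sobolev_L1_class ennreal_mult_less_top intro: le_less_trans)
qed

text \<open>Exhausts a Sobolev space by countably many sets that are closed in L^1; the two bounds
  match the two conditions in \<open>is_sobolev\<close>.\<close>

definition sobolev_sublevel :: "real \<Rightarrow> real \<Rightarrow> nat \<Rightarrow> 'n::finite L1_torus set" where
  "sobolev_sublevel \<alpha> q K = {f. \<exists>g. integrable torus g \<and> f = L1_class g \<and>
    (\<integral>\<^sup>+x. ennreal (\<bar>g x\<bar> powr q) \<partial>torus) \<le> of_nat K \<and> sobolev_integral \<alpha> q g \<le> of_nat K}"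

lemma W_space_eq_Union_sublevel: "W_space \<alpha> q = (\<Union>K. sobolev_sublevel \<alpha> q K)"
proof (intro set_eqI iffI)
  fix f :: "'a L1_torus" assume f: "f \<in> W_space \<alpha> q"
  obtain g where g: "integrable torus g" "f = L1_class g" using L1_class_surj by blast
  have fin: "integrable torus (\<lambda>x. \<bar>g x\<bar> powr q)" "sobolev_integral \<alpha> q g < \<infinity>"
    using f g by (auto simp: W_space_def is_sobolev_L1_class)
  then have "(\<integral>\<^sup>+x. ennreal (\<bar>g x\<bar> powr q) \<partial>torus) < \<infinity>" by (simp add: integrable_iff_bounded)
  then obtain K1 where K1: "(\<integral>\<^sup>+x. ennreal (\<bar>g x\<bar> powr q) \<partial>torus) \<le> of_nat K1"
    using ennreal_Ex_less_of_nat by (metis infinity_ennreal_def less_imp_le)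
  obtain K2 where K2: "sobolev_integral \<alpha> q g \<le> of_nat K2"
    using fin(2) ennreal_Ex_less_of_nat by (metis infinity_ennreal_def less_imp_le)
  have "of_nat K1 \<le> (of_nat (max K1 K2) :: ennreal)" "of_nat K2 \<le> (of_nat (max K1 K2) :: ennreal)"
    by (simp_all only: of_nat_le_iff)
  then have "f \<in> sobolev_sublevel \<alpha> q (max K1 K2)"
    unfolding sobolev_sublevel_def using g K1 K2 order_trans by blast
  then show "f \<in> (\<Union>K. sobolev_sublevel \<alpha> q K)" by blast
next
  fix f :: "'a L1_torus" assume "f \<in> (\<Union>K. sobolev_sublevel \<alpha> q K)"
  then obtain K g where g: "integrable torus g" "f = L1_class g"
    and le: "(\<integral>\<^sup>+x. ennreal (\<bar>g x\<bar> powr q) \<partial>torus) \<le> of_nat K" "sobolev_integral \<alpha> q g \<le> of_nat K"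
    by (auto simp: sobolev_sublevel_def)
  have [measurable]: "g \<in> borel_measurable torus" using g by auto
  have "integrable torus (\<lambda>x. \<bar>g x\<bar> powr q)"
    unfolding integrable_iff_bounded using le_less_trans[OF le(1) of_nat_less_top] by auto
  then show "f \<in> W_space \<alpha> q"
    using g le_less_trans[OF le(2) of_nat_less_top] by (auto simp: W_space_def is_sobolev_L1_class)
qed

text \<open>L^1 convergence yields a subsequence converging almost everywhere, along which Fatou's
  lemma bounds the L^q integral; for the Sobolev integral it is applied in y and then in x.\<close>

lemma closed_sobolev_sublevel:
  assumes q: "0 < q"
  shows "closed (sobolev_sublevel \<alpha> q K :: 'n::finite L1_torus set)"
  unfolding closed_sequential_limits
proof (intro allI impI, elim conjE)
  fix F :: "nat \<Rightarrow> 'n L1_torus" and f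
  assume F: "\<forall>n. F n \<in> sobolev_sublevel \<alpha> q K" and lim: "F \<longlonglongrightarrow> f"
  obtain g where g: "integrable torus g" "f = L1_class g" using L1_class_surj by blast
  have "\<forall>n. \<exists>g. integrable torus g \<and> F n = L1_class g \<and>
    (\<integral>\<^sup>+x. ennreal (\<bar>g x\<bar> powr q) \<partial>torus) \<le> of_nat K \<and> sobolev_integral \<alpha> q g \<le> of_nat K"
    using F by (simp add: sobolev_sublevel_def)
  then obtain G where G: "\<And>n. integrable torus (G n)" "\<And>n. F n = L1_class (G n)"
    "\<And>n. (\<integral>\<^sup>+x. ennreal (\<bar>G n x\<bar> powr q) \<partial>torus) \<le> of_nat K" "\<And>n. sobolev_integral \<alpha> q (G n) \<le> of_nat K"
    by metis
  have [measurable]: "g \<in> borel_measurable torus" "\<And>n. G n \<in> borel_measurable torus" using g G by auto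
  have "(\<lambda>n. norm (F n - f)) \<longlonglongrightarrow> 0" using lim by (simp add: tendsto_norm_zero LIM_zero)
  then have "(\<lambda>n. LINT x|torus. norm (G n x - g x)) \<longlonglongrightarrow> 0"
    using g G by (simp add: L1_class_diff norm_L1_class)
  from tendsto_L1_AE_subseq[OF _ this] g(1) G(1) obtain r where
    r: "AE x in torus. (\<lambda>n. G (r n) x - g x) \<longlonglongrightarrow> 0" by auto
  then have ae: "AE x in torus. (\<lambda>n. G (r n) x) \<longlonglongrightarrow> g x"
    by eventually_elim (rule LIM_zero_cancel)
  have "(\<integral>\<^sup>+x. ennreal (\<bar>g x\<bar> powr q) \<partial>torus) = (\<integral>\<^sup>+x. liminf (\<lambda>n. ennreal (\<bar>G (r n) x\<bar> powr q)) \<partial>torus)"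
  proof (rule nn_integral_cong_AE)
    show "AE x in torus. ennreal (\<bar>g x\<bar> powr q) = liminf (\<lambda>n. ennreal (\<bar>G (r n) x\<bar> powr q))"
      using ae
    proof eventually_elim
      case (elim x)
      have "(\<lambda>n. ennreal (\<bar>G (r n) x\<bar> powr q)) \<longlonglongrightarrow> ennreal (\<bar>g x\<bar> powr q)"
        using q by (intro tendsto_ennrealI tendsto_powr2 tendsto_rabs elim tendsto_const) auto
      then show ?case by (intro lim_imp_Liminf[symmetric]) auto
    qed
  qed
  also have "\<dots> \<le> liminf (\<lambda>n. \<integral>\<^sup>+x. ennreal (\<bar>G (r n) x\<bar> powr q) \<partial>torus)"
    by (rule nn_integral_liminf) measurable
  also have "\<dots> \<le> liminf (\<lambda>n. of_nat K :: ennreal)"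
    by (intro Liminf_mono always_eventually allI G(3))
  finally have 1: "(\<integral>\<^sup>+x. ennreal (\<bar>g x\<bar> powr q) \<partial>torus) \<le> of_nat K" by (simp add: Liminf_const)
  let ?k = "\<lambda>f x y. ennreal (\<bar>f x - f y\<bar> powr q / torus_dist x y powr (\<alpha> * q + real CARD('n)))"
  have "sobolev_integral \<alpha> q g \<le> (\<integral>\<^sup>+x. liminf (\<lambda>n. \<integral>\<^sup>+y. ?k (G (r n)) x y \<partial>torus) \<partial>torus)"
    unfolding sobolev_integral_def
  proof (rule nn_integral_mono_AE)
    show "AE x in torus. (\<integral>\<^sup>+y. ?k g x y \<partial>torus) \<le> liminf (\<lambda>n. \<integral>\<^sup>+y. ?k (G (r n)) x y \<partial>torus)"
      using ae AE_space
    proof eventually_elim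
      case (elim x)
      have "(\<integral>\<^sup>+y. ?k g x y \<partial>torus) = (\<integral>\<^sup>+y. liminf (\<lambda>n. ?k (G (r n)) x y) \<partial>torus)"
      proof (rule nn_integral_cong_AE)
        show "AE y in torus. ?k g x y = liminf (\<lambda>n. ?k (G (r n)) x y)"
          using ae
        proof eventually_elim
          case y: (elim y)
          have "(\<lambda>n. \<bar>G (r n) x - G (r n) y\<bar> powr q) \<longlonglongrightarrow> \<bar>g x - g y\<bar> powr q"
            using q by (intro tendsto_powr2 tendsto_rabs tendsto_diff elim y tendsto_const) auto
          then have "(\<lambda>n. ?k (G (r n)) x y) \<longlonglongrightarrow> ?k g x y"
            unfolding divide_inverse by (intro tendsto_ennrealI tendsto_mult_right)
          then show ?case by (intro lim_imp_Liminf[symmetric]) auto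
        qed
      qed
      also have "\<dots> \<le> liminf (\<lambda>n. \<integral>\<^sup>+y. ?k (G (r n)) x y \<partial>torus)"
        by (rule nn_integral_liminf) (rule measurable_sobolev_kernel_snd[OF _ elim(2)], simp)
      finally show ?case .
    qed
  qed
  also have "\<dots> \<le> liminf (\<lambda>n. \<integral>\<^sup>+x. \<integral>\<^sup>+y. ?k (G (r n)) x y \<partial>torus \<partial>torus)"
    by (rule nn_integral_liminf) (rule measurable_sobolev_kernel_integral, simp)
  also have "\<dots> \<le> liminf (\<lambda>n. of_nat K :: ennreal)"
    using G(4) by (intro Liminf_mono always_eventually allI) (simp add: sobolev_integral_def)
  finally have 2: "sobolev_integral \<alpha> q g \<le> of_nat K" by (simp add: Liminf_const)
  show "f \<in> sobolev_sublevel \<alpha> q K" unfolding sobolev_sublevel_def using g 1 2 by blast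
qed

lemma W_space_borel: "0 < q \<Longrightarrow> W_space \<alpha> q \<in> sets borel"
  unfolding W_space_eq_Union_sublevel by (intro sets.countable_UN image_subsetI borel_closed closed_sobolev_sublevel)

context lipschitz_wavelets
begin

text \<open>Coefficients are continuous on L^1, the count is a finite sum of indicators, and
  \<open>eventually\<close> is a countable union of countable intersections. Such a set excludes its
  elements from \<open>W_space\<close> for a whole range of exponents at once, where the complements
  of the spaces would form an uncountable intersection.\<close>

lemma large_coefficients_borel:
  "{f. \<forall>\<^sub>F k in sequentially. \<eta> k \<le> real (card {\<mu> \<in> Lam k. \<theta> k \<le> \<bar>wavelet_coeff k \<mu> f\<bar>})} \<in> sets borel"
proof -
  define S where "S k = {f. \<eta> k \<le> real (card {\<mu> \<in> Lam k. \<theta> k \<le> \<bar>wavelet_coeff k \<mu> f\<bar>})}" for k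
  have "S k \<in> sets borel" for k
  proof -
    have m: "wavelet_coeff k \<mu> \<in> borel_measurable borel" if "\<mu> \<in> Lam k" for \<mu>
      by (rule borel_measurable_continuous_onI, rule linear_continuous_on, rule bounded_linear_wavelet_coeff[OF that])
    have ind: "{f. \<theta> k \<le> \<bar>wavelet_coeff k \<mu> f\<bar>} \<in> sets borel" if "\<mu> \<in> Lam k" for \<mu>
    proof -
      note [measurable] = m[OF that]
      show ?thesis by measurable
    qed
    have eq: "real (card {\<mu> \<in> Lam k. \<theta> k \<le> \<bar>wavelet_coeff k \<mu> f\<bar>}) =
        (\<Sum>\<mu>\<in>Lam k. indicator {f. \<theta> k \<le> \<bar>wavelet_coeff k \<mu> f\<bar>} f)" for f
      by (simp add: indicator_def sum.If_cases Int_def)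
    have [measurable]: "(\<lambda>f. \<Sum>\<mu>\<in>Lam k. indicator {f. \<theta> k \<le> \<bar>wavelet_coeff k \<mu> f\<bar>} f :: real) \<in> borel_measurable borel"
      by (intro borel_measurable_sum borel_measurable_indicator ind)
    show ?thesis unfolding S_def eq by measurable
  qed
  moreover have "{f. \<forall>\<^sub>F k in sequentially. \<eta> k \<le> real (card {\<mu> \<in> Lam k. \<theta> k \<le> \<bar>wavelet_coeff k \<mu> f\<bar>})} =
      (\<Union>N. \<Inter>k\<in>{N..}. S k)"
    by (auto simp: eventually_sequentially S_def)
  ultimately show ?thesis by auto
qed

end

section \<open>Probability\<close>

text \<open>Pitfall: \<^const>\<open>distr\<close> assigns the junk value zero to sets whose preimage is not measurable;
  the bad set is null in either case.\<close>

lemma AE_distr_of_AE: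
  fixes F :: "'w \<Rightarrow> 'a::topological_space"
  assumes G: "G \<in> sets borel" and ae: "AE \<omega> in M. F \<omega> \<in> G" and GQ: "\<And>f. f \<in> G \<Longrightarrow> Q f"
  shows "AE f in distr M borel F. Q f"
proof (rule AE_I)
  show "{f \<in> space (distr M borel F). \<not> Q f} \<subseteq> - G" using GQ by auto
  show "- G \<in> sets (distr M borel F)" using G by (simp add: borel_comp)
  obtain N where N: "N \<in> null_sets M" "{\<omega> \<in> space M. F \<omega> \<notin> G} \<subseteq> N"
    using ae by (auto simp: eventually_ae_filter)
  have "emeasure M (F -` (- G) \<inter> space M) \<le> emeasure M N"
    using N by (intro emeasure_mono) auto
  then have "emeasure M (F -` (- G) \<inter> space M) = 0" using N by auto
  then show "emeasure (distr M borel F) (- G) = 0"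
    by (simp add: distr_def emeasure_measure_of_conv)
qed

text \<open>Second moment method: pairwise independence makes the variance of the count at most its
  mean m, and Chebyshev's inequality at distance m / 2 gives m / (m / 2)^2 = 4 / m.\<close>

lemma (in prob_space) count_lower_tail:
  fixes A :: "'i \<Rightarrow> 'a set"
  assumes J: "finite J" and A: "\<And>i. i \<in> J \<Longrightarrow> A i \<in> events"
    and \<pi>: "\<And>i. i \<in> J \<Longrightarrow> prob (A i) = \<pi>"
    and indep: "\<And>i j. i \<in> J \<Longrightarrow> j \<in> J \<Longrightarrow> i \<noteq> j \<Longrightarrow> prob (A i \<inter> A j) = \<pi> * \<pi>"
    and pos: "0 < real (card J) * \<pi>"
  shows "prob {\<omega> \<in> space M. real (card {i \<in> J. \<omega> \<in> A i}) < real (card J) * \<pi> / 2} \<le> 4 / (real (card J) * \<pi>)"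
proof -
  define X where "X \<omega> = (\<Sum>i\<in>J. indicator (A i) \<omega> :: real)" for \<omega>
  define m where "m = real (card J) * \<pi>"
  have m: "0 < m" using pos by (simp only: m_def)
  have Xeq: "X \<omega> = real (card {i \<in> J. \<omega> \<in> A i})" for \<omega>
    using J by (simp add: X_def indicator_def sum.If_cases Int_def)
  have \<pi>0: "0 \<le> \<pi>"
  proof -
    from pos have "card J \<noteq> 0" by (metis less_irrefl mult_zero_left of_nat_0)
    then obtain i where "i \<in> J" by fastforce
    then show ?thesis using \<pi> measure_nonneg by metis
  qed
  have iA: "integrable M (indicator (A i) :: 'a \<Rightarrow> real)" if "i \<in> J" for i
    using A[OF that] by (simp add: less_top[symmetric])
  have iX: "integrable M X" unfolding X_def by (intro Bochner_Integration.integrable_sum iA)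
  have EX: "expectation X = m"
  proof -
    have "expectation X = (\<Sum>i\<in>J. expectation (indicator (A i)))"
      unfolding X_def by (rule Bochner_Integration.integral_sum[OF iA])
    also have "\<dots> = (\<Sum>i\<in>J. \<pi>)" by (rule sum.cong[OF refl]) (use \<pi> A in auto)
    finally show ?thesis by (simp add: m_def)
  qed
  have iAA: "integrable M (\<lambda>\<omega>. indicator (A i \<inter> A j) \<omega> :: real)" if "i \<in> J" "j \<in> J" for i j
    using A[OF that(1)] A[OF that(2)] by (simp add: less_top[symmetric])
  have X2: "(X \<omega>)\<^sup>2 = (\<Sum>i\<in>J. \<Sum>j\<in>J. indicator (A i \<inter> A j) \<omega>)" for \<omega>
    by (simp add: X_def power2_eq_square sum_product indicator_inter_arith)
  have iX2: "integrable M (\<lambda>\<omega>. (X \<omega>)\<^sup>2)"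
    unfolding X2 by (intro Bochner_Integration.integrable_sum iAA)
  have "expectation (\<lambda>\<omega>. (X \<omega>)\<^sup>2) = (\<Sum>i\<in>J. \<Sum>j\<in>J. prob (A i \<inter> A j))"
    unfolding X2
    by (subst Bochner_Integration.integral_sum, intro Bochner_Integration.integrable_sum iAA, assumption+)
      (intro sum.cong refl, subst Bochner_Integration.integral_sum, use A iAA in auto)
  \<comment> \<open>The diagonal is overestimated by \<pi> + \<pi>^2, so that the double sum becomes
    \<open>m\<close> plus its square, and subtracting the squared mean leaves
    \<open>m\<close>.\<close>
  also have "\<dots> \<le> (\<Sum>i\<in>J. \<Sum>j\<in>J. (if i = j then \<pi> else 0) + \<pi> * \<pi>)"
    by (intro sum_mono) (use \<pi> indep \<pi>0 in auto)
  also have "\<dots> = m + m\<^sup>2"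
    using J by (simp add: sum.distrib m_def power2_eq_square algebra_simps)
  finally have "variance X \<le> m"
    using variance_eq[OF iX iX2] EX by simp
  moreover have "prob {\<omega> \<in> space M. m / 2 \<le> \<bar>X \<omega> - expectation X\<bar>} \<le> variance X / (m / 2)\<^sup>2"
    using iX iX2 m by (intro Chebyshev_inequality) auto
  ultimately have cheb: "prob {\<omega> \<in> space M. m / 2 \<le> \<bar>X \<omega> - m\<bar>} \<le> m / (m / 2)\<^sup>2"
    unfolding EX by (meson divide_right_mono order_trans zero_le_power2)
  have [measurable]: "X \<in> borel_measurable M" using iX by auto
  have "prob {\<omega> \<in> space M. X \<omega> < m / 2} \<le> prob {\<omega> \<in> space M. m / 2 \<le> \<bar>X \<omega> - m\<bar>}"
    by (rule finite_measure_mono) (use m in \<open>auto simp: abs_if\<close>)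
  also note cheb
  also have "m / (m / 2)\<^sup>2 = 4 / m" using m by (simp add: power2_eq_square)
  finally show ?thesis by (simp add: Xeq m_def)
qed

text \<open>The means grow at least like 2^(rk), so the failure probabilities from
  \<open>count_lower_tail\<close> are dominated by a geometric series, and the first Borel-Cantelli
  lemma applies whatever the dependence between scales.\<close>

lemma (in prob_space) count_eventually_large:
  fixes A :: "nat \<Rightarrow> 'i \<Rightarrow> 'a set"
  assumes J: "\<And>k. finite (J k)" and A: "\<And>k i. i \<in> J k \<Longrightarrow> A k i \<in> events"
    and \<pi>: "\<And>k i. i \<in> J k \<Longrightarrow> prob (A k i) = \<pi> k"
    and indep: "\<And>k i j. i \<in> J k \<Longrightarrow> j \<in> J k \<Longrightarrow> i \<noteq> j \<Longrightarrow> prob (A k i \<inter> A k j) = \<pi> k * \<pi> k"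
    and K: "0 < K" and r: "0 < r" and growth: "\<And>k. K * 2 powr (r * real k) \<le> real (card (J k)) * \<pi> k"
  shows "AE \<omega> in M. \<forall>\<^sub>F k in sequentially. K / 2 * 2 powr (r * real k) \<le> real (card {i \<in> J k. \<omega> \<in> A k i})"
proof -
  define S where "S k = {\<omega> \<in> space M. real (card {i \<in> J k. \<omega> \<in> A k i}) < real (card (J k)) * \<pi> k / 2}" for k
  have Sm: "S k \<in> events" for k
  proof -
    have "real (card {i \<in> J k. \<omega> \<in> A k i}) = (\<Sum>i\<in>J k. indicator (A k i) \<omega>)" for \<omega>
      using J by (simp add: indicator_def sum.If_cases Int_def)
    moreover have [measurable]: "(\<lambda>\<omega>. \<Sum>i\<in>J k. indicator (A k i) \<omega> :: real) \<in> borel_measurable M"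
      using A by (intro borel_measurable_sum borel_measurable_indicator)
    ultimately show ?thesis unfolding S_def by simp
  qed
  have le: "prob (S k) \<le> 4 / K * (2 powr - r) ^ k" for k
  proof -
    have pos: "0 < K * 2 powr (r * real k)" using K by simp
    then have pos': "0 < real (card (J k)) * \<pi> k" using growth[of k] by linarith
    have "prob (S k) \<le> 4 / (real (card (J k)) * \<pi> k)"
      unfolding S_def by (rule count_lower_tail[OF J A \<pi> indep pos'])
    also have "\<dots> \<le> 4 / (K * 2 powr (r * real k))"
      by (rule divide_left_mono[OF growth]) (simp, rule mult_pos_pos[OF pos' pos])
    also have "\<dots> = 4 / K * 2 powr (- (r * real k))" by (simp add: powr_minus divide_inverse)
    also have "2 powr (- (r * real k)) = (2 powr - r :: real) ^ k"
      by (simp add: powr_realpow[symmetric] powr_powr)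
    finally show ?thesis .
  qed
  have "summable (\<lambda>k. 4 / K * (2 powr - r) ^ k)"
    using r by (intro summable_mult summable_geometric) (auto simp: powr_less_one)
  then have "summable (\<lambda>k. prob (S k))"
    by (rule summable_comparison_test[rotated]) (use le in auto)
  then have "AE \<omega> in M. \<forall>\<^sub>F k in sequentially. \<omega> \<in> space M - S k"
    by (intro borel_cantelli_AE1 Sm) (auto simp: less_top[symmetric])
  then show ?thesis
  proof eventually_elim
    case (elim \<omega>)
    then show ?case
    proof eventually_elim
      case (elim k)
      then show ?case using growth[of k] by (auto simp: S_def)
    qed
  qed
qed

text \<open>The parameters \<open>s\<close>, \<open>\<beta>\<close>, \<open>\<delta>\<close>, \<open>p\<close> are tuned so that both values of the Bernoulli
  variable contribute the same order \<open>2\<^bsup>-spk\<^esup>\<close> to the \<open>p\<close>-th moment.\<close>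

lemma (in prob_space) mixture_moment_le:
  fixes W B :: "'a \<Rightarrow> real"
  assumes indep: "indep_var borel W borel B" and p: "0 < p"
    and W: "integrable M (\<lambda>\<omega>. \<bar>W \<omega>\<bar> powr p)"
    and B1: "prob {\<omega> \<in> space M. B \<omega> = 1} = 2 powr (- \<delta> * x)"
    and B0: "prob {\<omega> \<in> space M. B \<omega> = 0} = 1 - 2 powr (- \<delta> * x)"
    and B01: "AE \<omega> in M. B \<omega> = 0 \<or> B \<omega> = 1"
    and \<delta>: "\<delta> = p * (s + \<beta>)"
  shows "(\<integral>\<^sup>+\<omega>. ennreal (\<bar>W \<omega> * (2 powr (- x * s) * (1 - B \<omega>) + 2 powr (x * \<beta>) * B \<omega>)\<bar> powr p) \<partial>M)
    \<le> ennreal (2 * expectation (\<lambda>\<omega>. \<bar>W \<omega>\<bar> powr p) * 2 powr (- s * p * x))"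
proof -
  define V where "V \<omega> = \<bar>W \<omega>\<bar> powr p" for \<omega>
  have Wm [measurable]: "W \<in> borel_measurable M" by (rule indep_var_rv1[OF indep])
  have Bm [measurable]: "B \<in> borel_measurable M" by (rule indep_var_rv2[OF indep])
  have iV: "integrable M V" using W by (simp add: V_def[abs_def])
  have V0: "0 \<le> expectation V" by (simp add: V_def)
  have mixed: "integrable M (\<lambda>\<omega>. V \<omega> * indicator {b} (B \<omega>)) \<and>
      expectation (\<lambda>\<omega>. V \<omega> * indicator {b} (B \<omega>)) = expectation V * prob {\<omega> \<in> space M. B \<omega> = b}" for b :: real
  proof -
    have "indep_var borel ((\<lambda>w. \<bar>w\<bar> powr p) \<circ> W) borel ((indicator {b} :: real \<Rightarrow> real) \<circ> B)"
      by (rule indep_var_compose[OF indep]) measurable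
    then have iv: "indep_var borel V borel (\<lambda>\<omega>. indicator {b} (B \<omega>) :: real)"
      by (simp add: comp_def V_def[abs_def])
    have ib: "integrable M (\<lambda>\<omega>. indicator {b} (B \<omega>) :: real)"
      by (rule integrable_const_bound[where B = 1]) auto
    have "expectation (\<lambda>\<omega>. indicator {b} (B \<omega>) :: real) = prob {\<omega> \<in> space M. B \<omega> = b}"
    proof -
      have "expectation (\<lambda>\<omega>. indicator {b} (B \<omega>) :: real) = expectation (indicator {\<omega> \<in> space M. B \<omega> = b})"
        by (rule Bochner_Integration.integral_cong) (auto simp: indicator_def)
      then show ?thesis by simp
    qed
    then show ?thesis using indep_var_integrable[OF iv iV ib] indep_var_lebesgue_integral[OF iv iV ib] by simp
  qed
  let ?c = "\<lambda>\<omega>. \<bar>W \<omega> * (2 powr (- x * s) * (1 - B \<omega>) + 2 powr (x * \<beta>) * B \<omega>)\<bar> powr p"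
  let ?u = "2 powr (- s * p * x) :: real" and ?v = "2 powr (\<beta> * p * x) :: real"
  let ?R = "\<lambda>\<omega>. ?u * (V \<omega> * indicator {0} (B \<omega>)) + ?v * (V \<omega> * indicator {1} (B \<omega>))"
  have "(\<integral>\<^sup>+\<omega>. ennreal (?c \<omega>) \<partial>M) = (\<integral>\<^sup>+\<omega>. ennreal (?R \<omega>) \<partial>M)"
  proof (rule nn_integral_cong_AE)
    show "AE \<omega> in M. ennreal (?c \<omega>) = ennreal (?R \<omega>)"
      using B01
    proof eventually_elim
      case (elim \<omega>)
      have "?c \<omega> = ?R \<omega>"
        using elim by (auto simp: V_def abs_mult powr_mult powr_powr mult_ac)
      then show ?case by simp
    qed
  qed
  also have "\<dots> = ennreal (expectation ?R)"
    using mixed by (intro nn_integral_eq_integral) (auto simp: V_def)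
  also have "expectation ?R = ?u * (expectation V * (1 - 2 powr (- \<delta> * x))) + ?v * (expectation V * 2 powr (- \<delta> * x))"
    using mixed[of 0] mixed[of 1] B0 B1 by simp
  also have "?v * (expectation V * 2 powr (- \<delta> * x)) = expectation V * ?u"
  proof -
    have "?v * 2 powr (- \<delta> * x) = ?u" by (simp add: powr_add[symmetric] \<delta> algebra_simps)
    then show ?thesis by (simp add: mult.left_commute)
  qed
  also have "?u * (expectation V * (1 - 2 powr (- \<delta> * x))) + expectation V * ?u \<le> 2 * expectation V * ?u"
    using V0 by (simp add: algebra_simps)
  finally show ?thesis by (simp add: V_def[abs_def] ennreal_leI)
qed

theorem theorem5p2:
  fixes s p \<beta> \<delta> :: real
    and \<Psi> :: "nat \<Rightarrow> real ^ 'n::finite \<Rightarrow> real"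
    and M :: "'w measure"
    and W B c :: "nat \<times> (nat \<times> (int ^ 'n)) \<Rightarrow> 'w \<Rightarrow> real"
    and I :: "(nat \<times> (nat \<times> (int ^ 'n))) set"
    and F :: "'w \<Rightarrow> 'n L1_torus"
    and P :: "'n L1_torus measure"
  assumes s: "0 < s" "s < 1" and p: "1 < p" and \<beta>: "\<beta> > - s"
    and \<delta>: "\<delta> = p * (s + \<beta>)" "\<delta> < real CARD('n)"
    and wavelets: "wavelet_family \<Psi>"
    and I: "I = (SIGMA k:UNIV. Lam k)"
    and M: "prob_space M"
    and W_indep: "prob_space.indep_vars M (\<lambda>_. borel) W I"
    and W_distr: "\<And>i j. i \<in> I \<Longrightarrow> j \<in> I \<Longrightarrow> distr M borel (W i) = distr M borel (W j)"
    and W_moments: "\<And>i r. i \<in> I \<Longrightarrow> integrable M (\<lambda>\<omega>. \<bar>W i \<omega>\<bar> ^ (r::nat))"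
    and W_mean: "\<And>i. i \<in> I \<Longrightarrow> prob_space.expectation M (W i) = 0"
    and W_var: "\<And>i. i \<in> I \<Longrightarrow> prob_space.variance M (W i) = 1"
    and B_indep: "prob_space.indep_vars M (\<lambda>_. borel) B I"
    and B_1: "\<And>k l. (k, l) \<in> I \<Longrightarrow>
      prob_space.prob M {\<omega> \<in> space M. B (k, l) \<omega> = 1} = 2 powr (- \<delta> * real k)"
    and B_0: "\<And>k l. (k, l) \<in> I \<Longrightarrow>
      prob_space.prob M {\<omega> \<in> space M. B (k, l) \<omega> = 0} = 1 - 2 powr (- \<delta> * real k)"
    and WB_indep: "prob_space.indep_var M
      (PiM I (\<lambda>_. borel)) (\<lambda>\<omega>. \<lambda>i\<in>I. W i \<omega>) (PiM I (\<lambda>_. borel)) (\<lambda>\<omega>. \<lambda>i\<in>I. B i \<omega>)"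
    and c: "\<And>k l \<omega>. c (k, l) \<omega> =
      W (k, l) \<omega> * (2 powr (- real k * s) * (1 - B (k, l) \<omega>) + 2 powr (real k * \<beta>) * B (k, l) \<omega>)"
    and F: "\<And>\<omega>. F \<omega> = (\<Sum>k. \<Sum>l\<in>Lam k. c (k, l) \<omega> *\<^sub>R L1_class (periodized_wavelet \<Psi> k l))"
    and P: "P = distr M borel F"
  shows "AE f in P.
    (\<forall>\<alpha>. 0 < \<alpha> \<and> \<alpha> < s \<longrightarrow> f \<in> W_space \<alpha> p) \<and>
    (\<forall>\<alpha>. s < \<alpha> \<and> \<alpha> < 1 \<longrightarrow> f \<notin> W_space \<alpha> p) \<and>
    (\<forall>q>p. \<exists>\<alpha>. 0 < \<alpha> \<and> \<alpha> < s \<and> (\<forall>\<sigma>. \<alpha> < \<sigma> \<and> \<sigma> < s \<longrightarrow> f \<notin> W_space \<sigma> q))"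
proof -
  interpret M: prob_space M by (rule M)
  obtain R A where "lipschitz_wavelets \<Psi> R A" using lipschitz_wavelets_exists[OF wavelets] by blast
  then interpret lipschitz_wavelets \<Psi> R A .
  let ?n = "real CARD('n)"
  have p0: "0 < p" using p by simp
  have s\<beta>: "0 < s + \<beta>" using \<beta> by simp
  have memI: "(k, \<mu>) \<in> I \<longleftrightarrow> \<mu> \<in> Lam k" for k \<mu> by (simp add: I)
  have cI: "countable I" by (rule countableI_type)
  have card_pos: "1 \<le> (2 ^ CARD('n) - 1 :: nat)"
  proof -
    have "(2::nat) ^ 1 \<le> 2 ^ CARD('n)" by (rule power_increasing) auto
    then show ?thesis by simp
  qed
  have card_ge: "2 ^ (k * CARD('n)) \<le> real (card (Lam k :: (nat \<times> (int ^ 'n)) set))" for k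
  proof -
    have "1 * 2 ^ (k * CARD('n)) \<le> card (Lam k :: (nat \<times> (int ^ 'n)) set)"
      unfolding card_Lam using card_pos by (rule mult_right_mono) simp
    then have "real (1 * 2 ^ (k * CARD('n))) \<le> real (card (Lam k :: (nat \<times> (int ^ 'n)) set))"
      by (simp only: of_nat_le_iff)
    then show ?thesis by simp
  qed
  have Wm: "W i \<in> borel_measurable M" if "i \<in> I" for i
    using W_indep that by (simp add: M.indep_vars_def)
  have Bm: "B i \<in> borel_measurable M" if "i \<in> I" for i
    using B_indep that by (simp add: M.indep_vars_def)

  \<comment> \<open>Lower tail and moments of the variables W\<close>
  have "(Lam 0 :: (nat \<times> (int ^ 'n)) set) \<noteq> {}" using card_ge[of 0] by force
  then obtain \<mu>0 :: "nat \<times> (int ^ 'n)" where "\<mu>0 \<in> Lam 0" by blast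
  define i0 where "i0 = (0::nat, \<mu>0)"
  have i0: "i0 \<in> I" using \<open>\<mu>0 \<in> Lam 0\<close> by (simp add: i0_def memI)

  \<comment> \<open>Mean 0 and variance 1 exclude that \<open>W i0\<close> vanishes almost surely;
    this supplies a threshold \<open>a\<close> and a probability \<eta>, which serve all indices
    because the laws agree.\<close>
  have "\<exists>a>0. 0 < M.prob {\<omega> \<in> space M. a \<le> \<bar>W i0 \<omega>\<bar>}"
  proof (rule ccontr)
    assume "\<not> ?thesis"
    then have z: "M.prob {\<omega> \<in> space M. a \<le> \<bar>W i0 \<omega>\<bar>} = 0" if "0 < a" for a
      using that measure_nonneg[of M] by (meson antisym not_le)
    note [measurable] = Wm[OF i0]
    have "AE \<omega> in M. \<bar>W i0 \<omega>\<bar> < 1 / real (Suc j)" for j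
    proof (rule AE_I[where N = "{\<omega> \<in> space M. 1 / real (Suc j) \<le> \<bar>W i0 \<omega>\<bar>}"])
      show "emeasure M {\<omega> \<in> space M. 1 / real (Suc j) \<le> \<bar>W i0 \<omega>\<bar>} = 0"
        using z[of "1 / real (Suc j)"] by (simp add: M.emeasure_eq_measure)
    qed auto
    then have "AE \<omega> in M. \<forall>j. \<bar>W i0 \<omega>\<bar> < 1 / real (Suc j)" by (simp add: AE_all_countable)
    then have "AE \<omega> in M. (W i0 \<omega> - M.expectation (W i0))\<^sup>2 = 0"
    proof eventually_elim
      case (elim \<omega>)
      have "\<bar>W i0 \<omega>\<bar> \<le> 0"
      proof (rule field_le_epsilon)
        fix e :: real assume "0 < e"
        then obtain j where "inverse (real (Suc j)) < e" using reals_Archimedean by blast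
        with elim show "\<bar>W i0 \<omega>\<bar> \<le> 0 + e" by (smt (verit) inverse_eq_divide)
      qed
      then show ?case using W_mean[OF i0] by simp
    qed
    then have "M.variance (W i0) = 0" by (intro integral_eq_zero_AE)
    then show False using W_var[OF i0] by simp
  qed
  then obtain a where a: "0 < a" "0 < M.prob {\<omega> \<in> space M. a \<le> \<bar>W i0 \<omega>\<bar>}" by blast
  define \<eta> where "\<eta> = M.prob {\<omega> \<in> space M. a \<le> \<bar>W i0 \<omega>\<bar>}"
  have \<eta>: "0 < \<eta>" using a by (simp add: \<eta>_def)
  let ?A = "\<lambda>i. {\<omega> \<in> space M. a \<le> \<bar>W i \<omega>\<bar>}" and ?B1 = "\<lambda>i. {\<omega> \<in> space M. B i \<omega> = 1}"
  have W_tail: "M.prob (?A i) = \<eta>" if i: "i \<in> I" for i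
  proof -
    have S: "{x :: real. a \<le> \<bar>x\<bar>} \<in> sets borel" by measurable
    have *: "M.prob (?A j) = measure (distr M borel (W j)) {x. a \<le> \<bar>x\<bar>}" if "j \<in> I" for j
      by (subst measure_distr[OF Wm[OF that] S]) (simp add: vimage_def Int_def conj_commute)
    show ?thesis unfolding \<eta>_def *[OF i] *[OF i0] W_distr[OF i i0] ..
  qed

  have W_p: "integrable M (\<lambda>\<omega>. \<bar>W i \<omega>\<bar> powr p)" if i: "i \<in> I" for i
  proof (rule Bochner_Integration.integrable_bound)
    \<comment> \<open>Moments are given for natural exponents, so p is rounded up; the summand 1
      covers values of modulus at most 1.\<close>
    show "integrable M (\<lambda>\<omega>. 1 + \<bar>W i \<omega>\<bar> ^ nat \<lceil>p\<rceil>)" using W_moments[OF i] by auto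
    note [measurable] = Wm[OF i]
    show "(\<lambda>\<omega>. \<bar>W i \<omega>\<bar> powr p) \<in> borel_measurable M" by measurable
    show "AE \<omega> in M. norm (\<bar>W i \<omega>\<bar> powr p) \<le> norm (1 + \<bar>W i \<omega>\<bar> ^ nat \<lceil>p\<rceil>)"
    proof (rule AE_I2)
      fix \<omega>
      have "\<bar>W i \<omega>\<bar> powr p \<le> 1 + \<bar>W i \<omega>\<bar> ^ nat \<lceil>p\<rceil>"
      proof (cases "\<bar>W i \<omega>\<bar> \<le> 1")
        case True
        then have "\<bar>W i \<omega>\<bar> powr p \<le> 1" using p0 by (intro powr_le1) auto
        then show ?thesis by (simp add: add_increasing2)
      next
        case False
        have "p \<le> real (nat \<lceil>p\<rceil>)" by linarith
        then have "\<bar>W i \<omega>\<bar> powr p \<le> \<bar>W i \<omega>\<bar> powr real (nat \<lceil>p\<rceil>)" using False by (intro powr_mono) auto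
        also have "\<dots> = \<bar>W i \<omega>\<bar> ^ nat \<lceil>p\<rceil>" using False by (intro powr_realpow) auto
        finally show ?thesis by simp
      qed
      then show "norm (\<bar>W i \<omega>\<bar> powr p) \<le> norm (1 + \<bar>W i \<omega>\<bar> ^ nat \<lceil>p\<rceil>)" by simp
    qed
  qed
  define m where "m = M.expectation (\<lambda>\<omega>. \<bar>W i0 \<omega>\<bar> powr p)"
  have m0: "0 \<le> m" by (simp add: m_def)
  have W_m: "M.expectation (\<lambda>\<omega>. \<bar>W i \<omega>\<bar> powr p) = m" if i: "i \<in> I" for i
  proof -
    have *: "M.expectation (\<lambda>\<omega>. \<bar>W j \<omega>\<bar> powr p) = (LINT x|distr M borel (W j). \<bar>x\<bar> powr p)" if "j \<in> I" for j
      by (rule integral_distr[symmetric, OF Wm[OF that]]) measurable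
    show ?thesis unfolding m_def *[OF i] *[OF i0] W_distr[OF i i0] ..
  qed

  \<comment> \<open>The Bernoulli variables and their independence of the variables W\<close>
  have B01i: "AE \<omega> in M. B i \<omega> = 0 \<or> B i \<omega> = 1" if i: "i \<in> I" for i
  proof -
    note [measurable] = Bm[OF i]
    obtain k \<mu> where k\<mu>: "i = (k, \<mu>)" by (cases i)
    have "M.prob ({\<omega> \<in> space M. B i \<omega> = 0} \<union> ?B1 i) =
        M.prob {\<omega> \<in> space M. B i \<omega> = 0} + M.prob (?B1 i)"
      by (rule M.finite_measure_Union) auto
    also have "\<dots> = 1" using B_0[of k \<mu>] B_1[of k \<mu>] i by (simp add: k\<mu>)
    finally have "AE \<omega> in M. \<omega> \<in> {\<omega> \<in> space M. B i \<omega> = 0} \<union> ?B1 i"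
      by (subst M.AE_in_set_eq_1) auto
    then show ?thesis by eventually_elim auto
  qed
  have B01: "AE \<omega> in M. \<forall>i\<in>I. B i \<omega> = 0 \<or> B i \<omega> = 1"
    unfolding AE_ball_countable[OF cI] using B01i by blast

  have WB_i: "M.indep_var borel (W i) borel (B i)" if i: "i \<in> I" for i
  proof -
    have "M.indep_var borel ((\<lambda>w. w i) \<circ> (\<lambda>\<omega>. \<lambda>i\<in>I. W i \<omega>)) borel ((\<lambda>w. w i) \<circ> (\<lambda>\<omega>. \<lambda>i\<in>I. B i \<omega>))"
      by (rule M.indep_var_compose[OF WB_indep]) (rule measurable_component_singleton[OF i])+
    then show ?thesis using i by (simp add: comp_def)
  qed

  \<comment> \<open>Almost sure summability of the coefficient energies\<close>
  have c_moment: "(\<integral>\<^sup>+\<omega>. ennreal (\<bar>c (k, \<mu>) \<omega>\<bar> powr p) \<partial>M) \<le> ennreal (2 * m * 2 powr (- s * p * real k))"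
    if \<mu>: "\<mu> \<in> Lam k" for k \<mu>
  proof -
    have i: "(k, \<mu>) \<in> I" using \<mu> by (simp add: memI)
    show ?thesis
      unfolding c W_m[OF i, symmetric]
      by (rule M.mixture_moment_le[OF WB_i[OF i] p0 W_p[OF i] B_1[OF i] B_0[OF i] B01i[OF i] \<delta>(1)])
  qed
  have cm: "c (k, \<mu>) \<in> borel_measurable M" if \<mu>: "\<mu> \<in> Lam k" for k \<mu>
  proof -
    have i: "(k, \<mu>) \<in> I" using \<mu> by (simp add: memI)
    note [measurable] = Wm[OF i] Bm[OF i]
    have "c (k, \<mu>) = (\<lambda>\<omega>. W (k, \<mu>) \<omega> * (2 powr (- real k * s) * (1 - B (k, \<mu>) \<omega>) + 2 powr (real k * \<beta>) * B (k, \<mu>) \<omega>))"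
      by (rule ext) (rule c)
    then show ?thesis by simp
  qed
  define E where "E \<omega> k = (\<Sum>\<mu>\<in>Lam k. \<bar>c (k, \<mu>) \<omega>\<bar> powr p) / 2 ^ (k * CARD('n))" for \<omega> k
  have E0: "0 \<le> E \<omega> k" for \<omega> k unfolding E_def by (intro divide_nonneg_nonneg sum_nonneg) auto
  have Em: "(\<lambda>\<omega>. E \<omega> k) \<in> borel_measurable M" for k
    unfolding E_def using cm by (intro borel_measurable_divide borel_measurable_sum borel_measurable_const) auto
  \<comment> \<open>The number of wavelets of scale k is a constant times 2^(kn), which cancels the
    normalisation and leaves a bound of order 2^(-spk).\<close>
  have E_mean: "(\<integral>\<^sup>+\<omega>. ennreal (E \<omega> k) \<partial>M) \<le> ennreal (real (2 ^ CARD('n) - 1 :: nat) * 2 * m * 2 powr (- s * p * real k))" for k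
  proof -
    let ?N = "2 ^ (k * CARD('n)) :: real"
    have "(\<integral>\<^sup>+\<omega>. ennreal (E \<omega> k) \<partial>M) = (\<integral>\<^sup>+\<omega>. ennreal (1 / ?N) * (\<Sum>\<mu>\<in>Lam k. ennreal (\<bar>c (k, \<mu>) \<omega>\<bar> powr p)) \<partial>M)"
      by (intro nn_integral_cong) (simp add: E_def ennreal_mult[symmetric] sum_nonneg)
    also have "\<dots> = ennreal (1 / ?N) * (\<Sum>\<mu>\<in>Lam k. \<integral>\<^sup>+\<omega>. ennreal (\<bar>c (k, \<mu>) \<omega>\<bar> powr p) \<partial>M)"
    proof -
      have m: "(\<lambda>\<omega>. ennreal (\<bar>c (k, \<mu>) \<omega>\<bar> powr p)) \<in> borel_measurable M" if "\<mu> \<in> Lam k" for \<mu>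
        using cm[OF that] by measurable
      show ?thesis
        by (subst nn_integral_cmult, intro borel_measurable_sum m, assumption) (subst nn_integral_sum[OF m], auto)
    qed
    also have "\<dots> \<le> ennreal (1 / ?N) * (\<Sum>\<mu>\<in>(Lam k :: (nat \<times> (int ^ 'n)) set). ennreal (2 * m * 2 powr (- s * p * real k)))"
      by (intro mult_left_mono sum_mono c_moment) auto
    also have "\<dots> = ennreal (1 / ?N * (real (card (Lam k :: (nat \<times> (int ^ 'n)) set)) * (2 * m * 2 powr (- s * p * real k))))"
      using m0 by (simp add: ennreal_of_nat_eq_real_of_nat ennreal_mult[symmetric] del: times_divide_eq_left times_divide_eq_right)
    also have "1 / ?N * (real (card (Lam k :: (nat \<times> (int ^ 'n)) set)) * (2 * m * 2 powr (- s * p * real k)))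
        = real (2 ^ CARD('n) - 1 :: nat) * 2 * m * 2 powr (- s * p * real k)"
      unfolding card_Lam of_nat_mult by simp
    finally show ?thesis .
  qed
  have energy: "AE \<omega> in M. summable (\<lambda>k. 2 powr (\<gamma> * p * real k) * E \<omega> k)" if \<gamma>: "\<gamma> < s" for \<gamma>
  proof -
    let ?L = "real (2 ^ CARD('n) - 1 :: nat)"
    have "(\<integral>\<^sup>+\<omega>. (\<Sum>k. ennreal (2 powr (\<gamma> * p * real k) * E \<omega> k)) \<partial>M) =
        (\<Sum>k. ennreal (2 powr (\<gamma> * p * real k)) * (\<integral>\<^sup>+\<omega>. ennreal (E \<omega> k) \<partial>M))"
      using Em E0 by (subst nn_integral_suminf) (auto simp: ennreal_mult intro!: suminf_cong nn_integral_cmult)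
    also have "\<dots> \<le> (\<Sum>k. ennreal ((?L * 2 * m) * (2 powr (- ((s - \<gamma>) * p))) ^ k))"
    proof (intro suminf_le allI)
      fix k
      have "ennreal (2 powr (\<gamma> * p * real k)) * (\<integral>\<^sup>+\<omega>. ennreal (E \<omega> k) \<partial>M)
          \<le> ennreal (2 powr (\<gamma> * p * real k)) * ennreal (?L * 2 * m * 2 powr (- s * p * real k))"
        by (intro mult_left_mono E_mean) simp
      also have "\<dots> = ennreal (2 powr (\<gamma> * p * real k) * (?L * 2 * m * 2 powr (- s * p * real k)))"
        by (rule ennreal_mult'[symmetric]) simp
      also have "2 powr (\<gamma> * p * real k) * (?L * 2 * m * 2 powr (- s * p * real k)) =
          (?L * 2 * m) * (2 powr (\<gamma> * p * real k) * 2 powr (- s * p * real k))"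
        by (simp only: mult_ac)
      also have "2 powr (\<gamma> * p * real k) * 2 powr (- s * p * real k) = (2 powr (- ((s - \<gamma>) * p)) :: real) ^ k"
        by (simp add: powr_add[symmetric] powr_realpow[symmetric] powr_powr algebra_simps)
      finally show "ennreal (2 powr (\<gamma> * p * real k)) * (\<integral>\<^sup>+\<omega>. ennreal (E \<omega> k) \<partial>M)
          \<le> ennreal ((?L * 2 * m) * (2 powr (- ((s - \<gamma>) * p))) ^ k)" .
    qed auto
    also have "\<dots> < \<infinity>"
    proof -
      have "(2::real) powr (- ((s - \<gamma>) * p)) < 1" using \<gamma> p0 by (simp add: powr_less_one)
      then have "summable (\<lambda>k. (?L * 2 * m) * (2 powr (- ((s - \<gamma>) * p))) ^ k)"
        by (intro summable_mult summable_geometric) simp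
      moreover have "0 \<le> (?L * 2 * m) * (2 powr (- ((s - \<gamma>) * p))) ^ k" for k
        using m0 by (intro mult_nonneg_nonneg) auto
      ultimately show ?thesis by (subst suminf_ennreal2) auto
    qed
    finally have "AE \<omega> in M. (\<Sum>k. ennreal (2 powr (\<gamma> * p * real k) * E \<omega> k)) \<noteq> \<infinity>"
      using Em by (intro nn_integral_PInf_AE borel_measurable_suminf) auto
    then show ?thesis
      by eventually_elim (rule summable_suminf_not_top, auto simp: E0)
  qed

  \<comment> \<open>Joint probabilities for pairs of indices\<close>
  have pairW: "M.prob (?A i \<inter> ?A j) = \<eta> * \<eta>"
    if ij: "i \<in> I" "j \<in> I" "i \<noteq> j" for i j
  proof -
    have "M.prob (\<Inter>l\<in>{i, j}. W l -` {x. a \<le> \<bar>x\<bar>} \<inter> space M) = (\<Prod>l\<in>{i, j}. M.prob (W l -` {x. a \<le> \<bar>x\<bar>} \<inter> space M))"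
      by (rule M.indep_varsD[OF W_indep]) (use ij in auto)
    moreover have "W l -` {x. a \<le> \<bar>x\<bar>} \<inter> space M = ?A l" for l by auto
    ultimately show ?thesis using ij W_tail by simp
  qed
  have pairB: "M.prob (?B1 i \<inter> ?B1 j) =
      M.prob (?B1 i) * M.prob (?B1 j)"
    if ij: "i \<in> I" "j \<in> I" "i \<noteq> j" for i j
  proof -
    have "M.prob (\<Inter>l\<in>{i, j}. B l -` {1} \<inter> space M) = (\<Prod>l\<in>{i, j}. M.prob (B l -` {1} \<inter> space M))"
      by (rule M.indep_varsD[OF B_indep]) (use ij in auto)
    moreover have "B l -` {1} \<inter> space M = ?B1 l" for l by auto
    ultimately show ?thesis using ij by simp
  qed
  \<comment> \<open>The case \<open>i = j\<close> is included: it yields the probability of a single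
    event in \<open>count2\<close>, while distinct indices yield the pairs.\<close>
  have WB: "M.prob ((?A i \<inter> ?A j) \<inter>
      (?B1 i \<inter> ?B1 j)) =
      M.prob (?A i \<inter> ?A j) *
      M.prob (?B1 i \<inter> ?B1 j)"
    if ij: "i \<in> I" "j \<in> I" for i j
  proof -
    let ?P = "PiM I (\<lambda>_. borel) :: (_ \<Rightarrow> real) measure"
    let ?X = "{w \<in> space ?P. a \<le> \<bar>w i\<bar> \<and> a \<le> \<bar>w j\<bar>}" and ?Y = "{b \<in> space ?P. b i = 1 \<and> b j = 1}"
    have [measurable]: "(\<lambda>w. w i) \<in> borel_measurable ?P" "(\<lambda>w. w j) \<in> borel_measurable ?P"
      using ij by (auto intro: measurable_component_singleton)
    have X: "?X \<in> sets ?P" and Y: "?Y \<in> sets ?P" by measurable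
    have "M.prob ((\<lambda>\<omega>. (\<lambda>i\<in>I. W i \<omega>, \<lambda>i\<in>I. B i \<omega>)) -` (?X \<times> ?Y) \<inter> space M) =
       M.prob ((\<lambda>\<omega>. \<lambda>i\<in>I. W i \<omega>) -` ?X \<inter> space M) * M.prob ((\<lambda>\<omega>. \<lambda>i\<in>I. B i \<omega>) -` ?Y \<inter> space M)"
      by (rule M.indep_varD[OF WB_indep X Y])
    moreover have "(\<lambda>\<omega>. \<lambda>i\<in>I. W i \<omega>) -` ?X \<inter> space M = ?A i \<inter> ?A j"
      using ij by (auto simp: space_PiM)
    moreover have "(\<lambda>\<omega>. \<lambda>i\<in>I. B i \<omega>) -` ?Y \<inter> space M = ?B1 i \<inter> ?B1 j"
      using ij by (auto simp: space_PiM)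
    moreover have "(\<lambda>\<omega>. (\<lambda>i\<in>I. W i \<omega>, \<lambda>i\<in>I. B i \<omega>)) -` (?X \<times> ?Y) \<inter> space M =
       (?A i \<inter> ?A j) \<inter>
       (?B1 i \<inter> ?B1 j)"
      using ij by (auto simp: space_PiM)
    ultimately show ?thesis by simp
  qed
  have Wset: "?A i \<in> sets M" if "i \<in> I" for i
    using Wm[OF that] by measurable
  have Bset: "?B1 i \<in> sets M" if "i \<in> I" for i
    using Bm[OF that] by measurable

  \<comment> \<open>Counts of large coefficients\<close>
  have pn: "(2::real) ^ (k * CARD('n)) = 2 powr (?n * real k)" for k
    by (simp add: powr_realpow[symmetric] mult.commute)
  have count1: "AE \<omega> in M. \<forall>\<^sub>F k in sequentially. \<eta> / 2 * 2 powr (?n * real k) \<le>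
      real (card {\<mu> \<in> Lam k. \<omega> \<in> ?A (k, \<mu>)})"
  proof (rule M.count_eventually_large[where \<pi> = "\<lambda>_. \<eta>"])
    show "\<eta> * 2 powr (?n * real k) \<le> real (card (Lam k :: (nat \<times> (int ^ 'n)) set)) * \<eta>" for k
      using card_ge[of k] \<eta> unfolding pn by (simp add: mult.commute)
  qed (use \<eta> Wset W_tail pairW memI in auto)
  \<comment> \<open>The expected count is at least \<eta> 2^((n - \<delta>) k), which grows because
    \<delta> < n; this is what makes the tail bounds summable.\<close>
  have count2: "AE \<omega> in M. \<forall>\<^sub>F k in sequentially. \<eta> / 2 * 2 powr ((?n - \<delta>) * real k) \<le>
      real (card {\<mu> \<in> Lam k. \<omega> \<in> ?A (k, \<mu>) \<inter> ?B1 (k, \<mu>)})"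
  proof (rule M.count_eventually_large[where \<pi> = "\<lambda>k. \<eta> * 2 powr (- \<delta> * real k)"])
    show "M.prob (?A (k, \<mu>) \<inter> ?B1 (k, \<mu>)) = \<eta> * 2 powr (- \<delta> * real k)"
      if "\<mu> \<in> Lam k" for k \<mu>
      using WB[of "(k, \<mu>)" "(k, \<mu>)"] that W_tail B_1 by (simp add: memI)
    show "M.prob ((?A (k, \<mu>) \<inter> ?B1 (k, \<mu>)) \<inter>
        (?A (k, \<nu>) \<inter> ?B1 (k, \<nu>))) =
        (\<eta> * 2 powr (- \<delta> * real k)) * (\<eta> * 2 powr (- \<delta> * real k))"
      if "\<mu> \<in> Lam k" "\<nu> \<in> Lam k" "\<mu> \<noteq> \<nu>" for k \<mu> \<nu>
    proof -
      have i: "(k, \<mu>) \<in> I" "(k, \<nu>) \<in> I" "(k, \<mu>) \<noteq> (k, \<nu>)" using that by (auto simp: memI)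
      have "(?A (k, \<mu>) \<inter> ?B1 (k, \<mu>)) \<inter>
        (?A (k, \<nu>) \<inter> ?B1 (k, \<nu>)) =
        (?A (k, \<mu>) \<inter> ?A (k, \<nu>)) \<inter>
        (?B1 (k, \<mu>) \<inter> ?B1 (k, \<nu>))" by blast
      then show ?thesis
        by (simp only: WB[OF i(1,2)] pairW[OF i] pairB[OF i] B_1[OF i(1)] B_1[OF i(2)]) (simp only: mult_ac)
    qed
    show "\<eta> * 2 powr ((?n - \<delta>) * real k) \<le> real (card (Lam k :: (nat \<times> (int ^ 'n)) set)) * (\<eta> * 2 powr (- \<delta> * real k))" for k
    proof -
      have "2 powr ((?n - \<delta>) * real k) = 2 powr (?n * real k) * (2::real) powr (- \<delta> * real k)"
        by (simp add: powr_add[symmetric] algebra_simps)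
      then have "\<eta> * 2 powr ((?n - \<delta>) * real k) = 2 powr (?n * real k) * (\<eta> * 2 powr (- \<delta> * real k))" by simp
      also have "\<dots> \<le> real (card (Lam k :: (nat \<times> (int ^ 'n)) set)) * (\<eta> * 2 powr (- \<delta> * real k))"
        using card_ge[of k] \<eta> unfolding pn by (intro mult_right_mono) auto
      finally show ?thesis .
    qed
  qed (use \<eta> Wset Bset memI \<delta> in auto)

  \<comment> \<open>The Borel set of good functions\<close>
  define \<gamma> where "\<gamma> j = s - s / real (j + 2)" for j
  \<comment> \<open>With \<open>j + 2\<close> the sequence starts at s / 2 and hence stays positive;
    it increases strictly to \<open>s\<close>.\<close>
  have \<gamma>: "0 < \<gamma> j" "\<gamma> j < \<gamma> (Suc j)" "\<gamma> j < s" for j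
  proof -
    have "s / real (j + 2) < s / 1" using s by (intro divide_strict_left_mono) auto
    then show "0 < \<gamma> j" by (simp add: \<gamma>_def)
    have "s / real (Suc j + 2) < s / real (j + 2)" using s by (intro divide_strict_left_mono) auto
    then show "\<gamma> j < \<gamma> (Suc j)" by (simp add: \<gamma>_def)
    have "0 < s / real (j + 2)" using s by (intro divide_pos_pos) auto
    then show "\<gamma> j < s" by (simp add: \<gamma>_def)
  qed
  define G1 :: "'n L1_torus set" where "G1 = (\<Inter>j. W_space (\<gamma> j) p)"
  define H :: "real \<Rightarrow> real \<Rightarrow> 'n L1_torus set" where "H b d = {f. \<forall>\<^sub>F k in sequentially. \<eta> / 2 * 2 powr ((?n - d) * real k) \<le>
      real (card {\<mu> \<in> Lam k. a * 2 powr (b * real k) \<le> \<bar>wavelet_coeff k \<mu> f\<bar>})}" for b d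
  \<comment> \<open>\<open>G1\<close> decides (i), \<open>H (- s) 0\<close> decides (ii) and
    \<open>H \<beta> \<delta>\<close> decides (iii), each for all exponents simultaneously.\<close>
  define G where "G = G1 \<inter> H (- s) 0 \<inter> H \<beta> \<delta>"
  have G_borel: "G \<in> sets borel"
    unfolding G_def G1_def H_def
    by (intro sets.Int sets.countable_INT' image_subsetI W_space_borel p0 large_coefficients_borel) auto
  \<comment> \<open>Summability at index \<open>Suc j\<close> gives membership at index
    \<open>j\<close>, since the Sobolev criterion needs a weight exponent strictly above the
    smoothness.\<close>
  have "AE \<omega> in M. \<forall>j. summable (\<lambda>k. 2 powr (\<gamma> (Suc j) * p * real k) * E \<omega> k)"
    unfolding AE_all_countable using energy \<gamma>(3) by blast
  then have "AE \<omega> in M. F \<omega> \<in> G"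
    using count1 count2 B01 AE_space
  proof eventually_elim
    case (elim \<omega>)
    have sob: "summable (\<lambda>k. \<Sum>\<mu>\<in>Lam k. c (k, \<mu>) \<omega> *\<^sub>R L1_class (periodized_wavelet \<Psi> k \<mu>)) \<and>
        is_sobolev (\<gamma> j) p (F \<omega>)" for j
    proof -
      have "\<gamma> (Suc j) < 1" using \<gamma>(3)[of "Suc j"] s by simp
      note sobolev = wavelet_series_sobolev[OF p \<gamma>(1) \<gamma>(2) this, of "\<lambda>k \<mu>. c (k, \<mu>) \<omega>"]
      have "summable (\<lambda>k. 2 powr (\<gamma> (Suc j) * p * real k) * ((\<Sum>\<mu>\<in>Lam k. \<bar>c (k, \<mu>) \<omega>\<bar> powr p) / 2 ^ (k * CARD('n))))"
        using elim(1) by (simp only: E_def)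
      from sobolev[OF this] show ?thesis unfolding F by (rule conjI)
    qed
    have coeff: "wavelet_coeff k \<mu> (F \<omega>) = c (k, \<mu>) \<omega>" if "\<mu> \<in> Lam k" for k \<mu>
      unfolding F using wavelet_coeff_series[of "\<lambda>k \<mu>. c (k, \<mu>) \<omega>", OF _ that] sob by blast
    have c1: "\<bar>c (k, \<mu>) \<omega>\<bar> = \<bar>W (k, \<mu>) \<omega>\<bar> * 2 powr (\<beta> * real k)" if "B (k, \<mu>) \<omega> = 1" for k \<mu>
      using that by (simp add: c abs_mult mult.commute)
    \<comment> \<open>Because \<beta> > - s, replacing the regular size by the exceptional one at
      \<open>B = 1\<close> can only enlarge a coefficient, so the lower bound of order 2^(-sk) holds
      for both values of \<open>B\<close>.\<close>
    have c0: "\<bar>W (k, \<mu>) \<omega>\<bar> * 2 powr (- s * real k) \<le> \<bar>c (k, \<mu>) \<omega>\<bar>" if \<mu>: "\<mu> \<in> Lam k" for k \<mu>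
    proof -
      have "(k, \<mu>) \<in> I" using \<mu> by (simp add: memI)
      then consider "B (k, \<mu>) \<omega> = 0" | "B (k, \<mu>) \<omega> = 1" using elim(4) by blast
      then show ?thesis
      proof cases
        case 1
        then show ?thesis by (simp add: c abs_mult mult.commute)
      next
        case 2
        have "- s * real k \<le> \<beta> * real k" using \<beta> by (intro mult_right_mono) auto
        then show ?thesis unfolding c1[OF 2] by (intro mult_left_mono) auto
      qed
    qed
    have card_mono': "real (card S) \<le> real (card T)" if "S \<subseteq> T" "T \<subseteq> Lam k" for S T :: "(nat \<times> (int ^ 'n)) set" and k
      using card_mono[OF finite_subset[OF that(2) finite_Lam] that(1)] by simp
    have "F \<omega> \<in> H (- s) 0"
      unfolding H_def mem_Collect_eq using elim(2)
    proof eventually_elim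
      case (elim k)
      have "{\<mu> \<in> Lam k. \<omega> \<in> ?A (k, \<mu>)} \<subseteq>
          {\<mu> \<in> Lam k. a * 2 powr (- s * real k) \<le> \<bar>wavelet_coeff k \<mu> (F \<omega>)\<bar>}"
      proof (rule subsetI, unfold mem_Collect_eq, elim conjE, rule conjI, assumption)
        fix \<mu> :: "nat \<times> (int ^ 'n)" assume \<mu>: "\<mu> \<in> Lam k" and W: "a \<le> \<bar>W (k, \<mu>) \<omega>\<bar>"
        have "a * 2 powr (- s * real k) \<le> \<bar>W (k, \<mu>) \<omega>\<bar> * 2 powr (- s * real k)"
          using W by (intro mult_right_mono) auto
        also note c0[OF \<mu>]
        finally show "a * 2 powr (- s * real k) \<le> \<bar>wavelet_coeff k \<mu> (F \<omega>)\<bar>" unfolding coeff[OF \<mu>] .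
      qed
      from elim card_mono'[OF this] show ?case by force
    qed
    moreover have "F \<omega> \<in> H \<beta> \<delta>"
      unfolding H_def mem_Collect_eq using elim(3)
    proof eventually_elim
      case (elim k)
      have "{\<mu> \<in> Lam k. \<omega> \<in> ?A (k, \<mu>) \<inter> ?B1 (k, \<mu>)} \<subseteq>
          {\<mu> \<in> Lam k. a * 2 powr (\<beta> * real k) \<le> \<bar>wavelet_coeff k \<mu> (F \<omega>)\<bar>}"
        by (auto simp: coeff c1)
      from elim card_mono'[OF this] show ?case by force
    qed
    ultimately show ?case using sob by (simp add: G_def G1_def W_space_def)
  qed

  \<comment> \<open>Transfer to the law and the three claims\<close>
  then show ?thesis
    unfolding P
  proof (rule AE_distr_of_AE[OF G_borel], intro conjI allI impI)
    fix f :: "'n L1_torus" assume f: "f \<in> G"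
    have f1: "f \<in> W_space (\<gamma> j) p" for j using f by (auto simp: G_def G1_def)
    have f2: "\<forall>\<^sub>F k in sequentially. \<eta> / 2 * 2 powr ((?n - 0) * real k) \<le>
      real (card {\<mu> \<in> Lam k. a * 2 powr (- s * real k) \<le> \<bar>wavelet_coeff k \<mu> f\<bar>})"
      using f unfolding G_def H_def by blast
    have f3: "\<forall>\<^sub>F k in sequentially. \<eta> / 2 * 2 powr ((?n - \<delta>) * real k) \<le>
      real (card {\<mu> \<in> Lam k. a * 2 powr (\<beta> * real k) \<le> \<bar>wavelet_coeff k \<mu> f\<bar>})"
      using f unfolding G_def H_def by blast
    have \<eta>2: "0 < \<eta> / 2" using \<eta> by simp
    show "f \<in> W_space \<alpha> p" if \<alpha>: "0 < \<alpha> \<and> \<alpha> < s" for \<alpha>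
    proof -
      obtain j where j: "s / (s - \<alpha>) < real j" using reals_Archimedean2 by blast
      then have "s < real j * (s - \<alpha>)" using \<alpha> by (simp add: pos_divide_less_eq)
      also have "\<dots> \<le> real (j + 2) * (s - \<alpha>)" using \<alpha> by (intro mult_right_mono) auto
      finally have "s / real (j + 2) < s - \<alpha>" by (simp add: pos_divide_less_eq mult.commute)
      then have "\<alpha> \<le> \<gamma> j" by (simp add: \<gamma>_def)
      from W_space_antimono[OF f1 this p0] show ?thesis .
    qed
    show "f \<notin> W_space \<alpha> p" if \<alpha>: "s < \<alpha> \<and> \<alpha> < 1" for \<alpha>
    proof -
      have "0 < (\<alpha> - s) * p" using \<alpha> p0 by simp
      then have "0 < \<alpha> * p + - s * p - 0" by (simp add: algebra_simps)
      from not_sobolev_of_large_coefficients[OF p _ \<eta>2 a(1) this f2] \<alpha> s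
      show ?thesis by (simp add: W_space_def)
    qed
    fix q assume q: "p < q"
    \<comment> \<open>The second entry is the critical exponent:
      \<open>\<sigma> * q + \<beta> * q > \<delta>\<close> holds exactly for \<sigma> above it. It
      lies below \<open>s\<close> because q > p and s + \<beta> > 0; the entry s / 2 only keeps
      \<alpha> positive.\<close>
    define \<alpha> where "\<alpha> = max (s / 2) (p / q * (s + \<beta>) - \<beta>)"
    have q0: "0 < q" "1 < q" using p q by auto
    have "p / q * (s + \<beta>) < 1 * (s + \<beta>)" using q0 q s\<beta> by (intro mult_strict_right_mono) auto
    then have "0 < \<alpha>" "\<alpha> < s" using s by (auto simp: \<alpha>_def)
    moreover have "f \<notin> W_space \<sigma> q" if \<sigma>: "\<alpha> < \<sigma> \<and> \<sigma> < s" for \<sigma>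
    proof -
      have "p / q * (s + \<beta>) < \<sigma> + \<beta>" using \<sigma> by (simp add: \<alpha>_def)
      then have "q * (p / q * (s + \<beta>)) < q * (\<sigma> + \<beta>)"
        using q0(1) by (rule mult_strict_left_mono)
      moreover have "q * (p / q * (s + \<beta>)) = \<delta>" using q0 by (simp add: \<delta>)
      ultimately have "0 < \<sigma> * q + \<beta> * q - \<delta>" by (simp add: algebra_simps)
      from not_sobolev_of_large_coefficients[OF q0(2) _ \<eta>2 a(1) this f3] \<sigma> \<open>0 < \<alpha>\<close>
      show ?thesis by (simp add: W_space_def)
    qed
    ultimately show "\<exists>\<alpha>. 0 < \<alpha> \<and> \<alpha> < s \<and> (\<forall>\<sigma>. \<alpha> < \<sigma> \<and> \<sigma> < s \<longrightarrow> f \<notin> W_space \<sigma> q)" by blast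
  qed
qed

end
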